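(* Let $N\ge 3$, $\frac{N}{N-2}\le p<\frac{N+2}{N-2}$, and $\lambda\le\frac{(N-1)^2}{4}$. Then the equation $$\Delta_{\mathbb{H}^N}u+\lambda u+u^p=0\qquad\text{in }\mathbb{H}^N\setminus\{Q\}$$ admits an (infinite) family of positive radial singular solutions $u_s(r)$ such that each of them satisfies, as $r\to0^+$, $$u_s(r)\sim\begin{cases}\left(\frac{N-2}{\sqrt2}\right)^{N-2}r^{2-N}\left(\ln\frac1r\right)^{-\frac{N-2}{2}}, & \text{if } p=\frac{N}{N-2},\\[1mm] L\,r^{-m}, & \text{if } \frac{N}{N-2}<p<\frac{N+2}{N-2},\end{cases}$$ and $$u_s(r)\sim u_\infty e^{-\nu r}\qquad\text{as } r\to+\infty$$ for some constant $u_\infty>0$ (depending on the solution).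
   Context: $\mathbb{H}^N$ is the $N$-dimensional hyperbolic space (constant curvature $-1$), $\Delta_{\mathbb{H}^N}$ its Laplace–Beltrami operator, $Q\in\mathbb{H}^N$ a fixed point, and $r=d_{\mathbb{H}^N}(x,Q)$ the hyperbolic distance to $Q$. "Radial" means depending only on $r$; for radial $u=u(r)$ the equation reads $$u''+(N-1)\coth r\,u'+\lambda u+u^p=0,\qquad r>0.$$ A function $u\in C^2((0,\infty))$ is a positive radial singular solution if it solves this ODE, $u(r)>0$ for all $r>0$, and $u(r)\to+\infty$ as $r\to0^+$. Notation: $m=\frac{2}{p-1}$, $L=\bigl(m(N-2-m)\bigr)^{1/(p-1)}$, $\nu=\frac{N-1}{2}+\sqrt{\frac{(N-1)^2}{4}-\lambda}$. The relation $f\sim g$ means $f/g\to1$. *)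

theory Defs
  imports "HOL-Analysis.Analysis" "HOL-Library.Landau_Symbols" "HOL-Library.FuncSet"
begin

text \<open>
  Functions of the hyperbolic distance \<open>r = d(x, Q)\<close>, \<open>r > 0\<close>, are represented by total
  functions on the reals; everything below only depends on their values on \<open>{0<..}\<close>.
\<close>

definition C2_on :: "(real \<Rightarrow> real) \<Rightarrow> real set \<Rightarrow> bool" where
  "C2_on u S \<longleftrightarrow>
     (\<forall>x\<in>S. u differentiable (at x)) \<and>
     (\<forall>x\<in>S. deriv u differentiable (at x)) \<and>
     continuous_on S (deriv (deriv u))"

text \<open>
  The Laplace-Beltrami operator of the \<open>N\<close>-dimensional hyperbolic space (curvature \<open>-1\<close>) acting
  on a function of the distance \<open>r > 0\<close> to a fixed point; \<open>cosh r / sinh r\<close> is \<open>coth r\<close>.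
\<close>

definition hyp_radial_laplacian :: "nat \<Rightarrow> (real \<Rightarrow> real) \<Rightarrow> real \<Rightarrow> real" where
  "hyp_radial_laplacian N u r =
     deriv (deriv u) r + (real N - 1) * (cosh r / sinh r) * deriv u r"

definition positive_radial_singular_solution ::
  "nat \<Rightarrow> real \<Rightarrow> real \<Rightarrow> (real \<Rightarrow> real) \<Rightarrow> bool" where
  "positive_radial_singular_solution N p lam u \<longleftrightarrow>
     C2_on u {0<..} \<and>
     (\<forall>r>0. hyp_radial_laplacian N u r + lam * u r + u r powr p = 0) \<and>
     (\<forall>r>0. u r > 0) \<and>
     filterlim u at_top (at_right 0)"

definition m_exp :: "real \<Rightarrow> real" where
  "m_exp p = 2 / (p - 1)"

definition L_const :: "nat \<Rightarrow> real \<Rightarrow> real" where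
  "L_const N p = (m_exp p * (real N - 2 - m_exp p)) powr (1 / (p - 1))"

definition nu_exp :: "nat \<Rightarrow> real \<Rightarrow> real" where
  "nu_exp N lam = (real N - 1) / 2 + sqrt ((real N - 1)\<^sup>2 / 4 - lam)"

definition singular_profile :: "nat \<Rightarrow> real \<Rightarrow> real \<Rightarrow> real" where
  "singular_profile N p r =
     (if p = real N / (real N - 2)
      then ((real N - 2) / sqrt 2) powr (real N - 2) * r powr (2 - real N) *
           ln (1 / r) powr (- ((real N - 2) / 2))
      else L_const N p * r powr (- m_exp p))"

end

theory Submission
  imports Defs "HOL-Real_Asymp.Real_Asymp"
begin

text \<open>
  Solutions are shot inwards from infinity. Put \<open>k = N - 1\<close>, \<open>\<sigma>\<^sup>2 = k\<^sup>2 / 4 - \<lambda>\<close> and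
  \<open>u = sinh r powr (- k / 2) * exp (- \<sigma> r) * \<Phi> r\<close>. The equation for \<open>\<Phi>\<close> has coefficients that
  decay exponentially, so for each \<open>\<alpha> > 0\<close> there is a solution with \<open>\<Phi> \<rightarrow> \<alpha>\<close> at infinity
  (\<open>fast_decay_family\<close>); this is a \<open>u\<close> with the decay \<open>2 powr (k / 2) * \<alpha> * exp (- \<nu> r)\<close>. It remains
  to see that for small \<open>\<alpha>\<close> the solution reaches the origin as a positive function with the right
  singularity; different \<open>\<alpha>\<close> then give different solutions.

  Positivity comes from a Pohozaev functional \<open>F\<close> that vanishes at infinity
  (\<open>pohozaev_has_derivative\<close>). For a suitable multiplier the quadratic part of \<open>F'\<close> is nonnegative on
  the whole half-line, whereas the nonlinear part is positive near the origin, which is where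
  \<open>p < (N + 2) / (N - 2)\<close> enters, and its coefficient is not integrable there, which is where
  \<open>p \<ge> N / (N - 2)\<close> enters. If \<open>\<alpha>\<close> is small, \<open>\<Phi>\<close> stays comparable with \<open>\<alpha>\<close> so long, on the way
  inwards, that \<open>F\<close> has become negative. From there on \<open>F\<close> decreases further towards the origin, and
  since \<open>F \<ge> 0\<close> at a zero of \<open>\<Phi>\<close>, there is none (\<open>positive_fast_decay_solutions\<close>).

  The bound \<open>F \<le> - \<kappa> < 0\<close> near the origin also yields the a priori estimates that the singular
  behaviour rests on (\<open>pohozaev_negative_bounds\<close>): with \<open>m = 2 / (p - 1)\<close> the function
  \<open>w = r powr m * u\<close> and its logarithmic derivative in \<open>x = ln (1 / r)\<close> are bounded, and \<open>u\<close> is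
  bounded below by a multiple of \<open>r powr (- (N - 2) / 2)\<close>, so the singularity is not removable. In
  the variable \<open>x\<close>, \<open>w\<close> moves like a damped particle in a potential, up to errors \<open>O(exp (- 2 x))\<close>. The
  energy converges, so \<open>w\<close> tends to an equilibrium, which is \<open>L\<close> if \<open>p > N / (N - 2)\<close>
  (\<open>tendsto_equilibrium\<close>). If \<open>p = N / (N - 2)\<close>, the only equilibrium is the degenerate point \<open>0\<close>, and
  \<open>w\<close> approaches it along the slow curve \<open>(N - 2) w' = - w powr p\<close>, which produces the logarithm
  (\<open>log_decay\<close>).
\<close>

section \<open>A singular Volterra equation\<close>

text \<open>
  The solution of \<open>y' + (c / t) y = g\<close> that stays bounded at the origin. Since
  \<open>(s / t) powr c \<le> 1\<close> for \<open>s \<le> t\<close>, it is dominated by the plain integral of \<open>\<bar>g\<bar>\<close>, so the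
  singular coefficient \<open>c / t\<close> does no harm to a Picard iteration. At \<open>t = 0\<close> the convention
  \<open>0 powr (- c) = 0\<close> gives the value \<open>0\<close>, which is the continuous extension.
\<close>

definition weighted_mean :: "real \<Rightarrow> (real \<Rightarrow> real) \<Rightarrow> real \<Rightarrow> real" where
  "weighted_mean c g t = t powr (- c) * integral {0..t} (\<lambda>s. s powr c * g s)"

lemma continuous_on_weight:
  fixes g :: "real \<Rightarrow> real"
  assumes "c > 0" "continuous_on {0..t} g"
  shows "continuous_on {0..t} (\<lambda>s. s powr c * g s)"
  using assms by (intro continuous_intros continuous_on_powr') auto

lemma weighted_mean_mono:
  assumes "c > 0" "continuous_on {0..t} g" "continuous_on {0..t} h"
    and "\<And>s. s \<in> {0..t} \<Longrightarrow> g s \<le> h s"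
  shows "weighted_mean c g t \<le> weighted_mean c h t"
  unfolding weighted_mean_def
  by (intro mult_left_mono integral_le integrable_continuous_interval continuous_on_weight)
     (use assms in \<open>auto intro: mult_left_mono\<close>)

lemma weighted_mean_diff:
  assumes "c > 0" "continuous_on {0..t} g" "continuous_on {0..t} h"
  shows "weighted_mean c (\<lambda>s. g s - h s) t = weighted_mean c g t - weighted_mean c h t"
  unfolding weighted_mean_def right_diff_distrib
  by (subst integral_diff)
     (use assms in \<open>auto intro!: integrable_continuous_interval continuous_on_weight simp: right_diff_distrib\<close>)

lemma weighted_mean_uminus:
  "weighted_mean c (\<lambda>s. - g s) t = - weighted_mean c g t"
  unfolding weighted_mean_def by simp

lemma weighted_mean_le_integral:
  assumes "c > 0" "continuous_on {0..t} h" "\<And>s. s \<in> {0..t} \<Longrightarrow> 0 \<le> h s"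
  shows "weighted_mean c h t \<le> integral {0..t} h"
proof (cases "t > 0")
  case True
  have "integral {0..t} (\<lambda>s. s powr c * h s) \<le> integral {0..t} (\<lambda>s. t powr c * h s)"
    using assms True
    by (intro integral_le integrable_continuous_interval continuous_on_weight continuous_intros)
       (auto intro!: mult_right_mono powr_mono2)
  also have "\<dots> = t powr c * integral {0..t} h" by simp
  finally have "t powr (-c) * integral {0..t} (\<lambda>s. s powr c * h s)
      \<le> t powr (-c) * (t powr c * integral {0..t} h)" by (intro mult_left_mono) auto
  also have "\<dots> = integral {0..t} h" using True by (simp add: powr_minus field_simps)
  finally show ?thesis unfolding weighted_mean_def .
next
  case False
  hence "t = 0 \<or> t < 0" by auto
  thus ?thesis unfolding weighted_mean_def by auto
qed

lemma weighted_mean_le: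
  assumes "c > 0" "t \<ge> 0" "continuous_on {0..t} g" "0 \<le> K" "\<And>s. s \<in> {0..t} \<Longrightarrow> g s \<le> K"
  shows "weighted_mean c g t \<le> K * t"
proof -
  have "weighted_mean c g t \<le> weighted_mean c (\<lambda>_. K) t"
    using assms by (intro weighted_mean_mono) auto
  also have "\<dots> \<le> integral {0..t} (\<lambda>_. K)"
    using assms by (intro weighted_mean_le_integral) auto
  also have "\<dots> = K * t" using assms by simp
  finally show ?thesis .
qed

lemma weighted_mean_abs_le:
  assumes "c > 0" "t \<ge> 0" "continuous_on {0..t} g" "0 \<le> K" "\<And>s. s \<in> {0..t} \<Longrightarrow> \<bar>g s\<bar> \<le> K"
  shows "\<bar>weighted_mean c g t\<bar> \<le> K * t"
proof -
  have "weighted_mean c g t \<le> K * t"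
    by (rule weighted_mean_le) (use assms abs_le_D1 in blast)+
  moreover have "weighted_mean c (\<lambda>s. - g s) t \<le> K * t"
    by (rule weighted_mean_le) (use assms abs_le_D2 in \<open>auto intro!: continuous_intros\<close>)
  ultimately show ?thesis by (auto simp: weighted_mean_uminus abs_le_iff)
qed

lemma weighted_mean_deriv:
  assumes "c > 0" "continuous_on {0..<b} g" "0 < t" "t < b"
  shows "(weighted_mean c g has_real_derivative (g t - c / t * weighted_mean c g t)) (at t)"
proof -
  obtain b' where b': "t < b'" "b' < b" using assms dense by blast
  have cont: "continuous_on {0..b'} (\<lambda>s. s powr c * g s)"
    by (intro continuous_on_weight continuous_on_subset[OF assms(2)]) (use assms b' in auto)
  have "((\<lambda>x. integral {0..x} (\<lambda>s. s powr c * g s)) has_real_derivative t powr c * g t) (at t within {0..b'})"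
    by (rule integral_has_real_derivative[OF cont]) (use assms b' in auto)
  hence I: "((\<lambda>x. integral {0..x} (\<lambda>s. s powr c * g s)) has_real_derivative t powr c * g t) (at t)"
    using assms b' at_within_Icc_at[of 0 t b'] by simp
  have "(weighted_mean c g has_real_derivative
     (-c) * t powr (-c - 1) * integral {0..t} (\<lambda>s. s powr c * g s) + t powr c * g t * t powr (-c)) (at t)"
    unfolding weighted_mean_def[abs_def]
    by (rule DERIV_mult' [THEN DERIV_cong])
       (use assms in \<open>auto intro!: derivative_eq_intros I\<close>)
  moreover have "(-c) * t powr (-c - 1) * integral {0..t} (\<lambda>s. s powr c * g s) + t powr c * g t * t powr (-c)
     = g t - c / t * weighted_mean c g t"
    unfolding weighted_mean_def using assms
    by (simp add: powr_diff powr_minus field_simps)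
  ultimately show ?thesis by simp
qed

lemma weighted_mean_zero [simp]: "weighted_mean c g 0 = 0"
  by (simp add: weighted_mean_def)

lemma weighted_mean_continuous:
  assumes "c > 0" "continuous_on {0..<b} g"
  shows "continuous_on {0..<b} (weighted_mean c g)"
  unfolding continuous_on_eq_continuous_within
proof
  fix t assume t: "t \<in> {0..<b}"
  show "continuous (at t within {0..<b}) (weighted_mean c g)"
  proof (cases "t = 0")
    case False
    with t have "isCont (weighted_mean c g) t"
      using weighted_mean_deriv[OF assms, of t] by (auto intro: DERIV_isCont)
    thus ?thesis by (rule continuous_at_imp_continuous_at_within)
  next
    case True
    define b' where "b' = b / 2"
    have b': "0 < b'" "b' < b" using t True by (auto simp: b'_def)
    have cont: "continuous_on {0..b'} g"
      by (rule continuous_on_subset[OF assms(2)]) (use b' in auto)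
    hence "bounded (g ` {0..b'})" by (intro compact_imp_bounded compact_continuous_image) auto
    then obtain K where K: "K > 0" "\<And>s. s \<in> {0..b'} \<Longrightarrow> \<bar>g s\<bar> \<le> K"
      unfolding bounded_pos by auto
    have "\<forall>\<^sub>F s in at 0 within {0..<b}. norm (weighted_mean c g s) \<le> K * s"
      unfolding eventually_at
    proof (intro exI[of _ b'] conjI ballI impI)
      fix s assume s: "s \<in> {0..<b}" "s \<noteq> 0 \<and> dist s 0 < b'"
      show "norm (weighted_mean c g s) \<le> K * s" unfolding real_norm_def
        by (rule weighted_mean_abs_le)
           (use s K assms in \<open>auto intro: continuous_on_subset[OF cont]\<close>)
    qed (use b' in auto)
    moreover have "((\<lambda>s. K * s) \<longlongrightarrow> 0) (at 0 within {0..<b})"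
      by (rule tendsto_eq_intros refl | simp)+
    ultimately have "(weighted_mean c g \<longlongrightarrow> 0) (at 0 within {0..<b})"
      by (rule Lim_null_comparison)
    thus ?thesis using True by (simp add: continuous_within)
  qed
qed

lemma continuous_on_half_openI:
  fixes f :: "real \<Rightarrow> real"
  assumes "\<And>X. 0 \<le> X \<Longrightarrow> X < b \<Longrightarrow> continuous_on {0..X} f"
  shows "continuous_on {0..<b} f"
  unfolding continuous_on_eq_continuous_within
proof
  fix x assume x: "x \<in> {0..<b}"
  then obtain X where X: "x < X" "X < b" using dense by auto
  have "continuous (at x within {0..X}) f"
    using assms[of X] x X by (simp add: continuous_on_eq_continuous_within)
  moreover have "at x within {0..X} = at x within {0..<b}"
    by (rule at_within_nhd[of x "{..<X}"]) (use X in auto)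
  ultimately show "continuous (at x within {0..<b}) f" by simp
qed

text \<open>
  Picard iteration for \<open>(x powr c * \<phi>')' = x powr c * b x (\<phi> x)\<close>, \<open>\<phi> 0 = \<alpha>\<close>, \<open>\<phi>' 0 = 0\<close>. One
  sequence of iterates serves all compact subintervals of \<open>{0..<1}\<close>: on \<open>{0..X}\<close>, consecutive
  iterates differ by at most \<open>K B\<^sup>n x\<^sup>n / n!\<close>, with \<open>B\<close> the Lipschitz constant of \<open>b\<close> there.

  The upper bound \<open>M\<close> is carried along because the nonlinearity in the application is Lipschitz
  only on bounded sets. As \<open>b s x \<le> M'' s\<close> for \<open>x \<le> M s\<close>, and weighted means are dominated by
  integrals, two integrations show that the iteration map preserves \<open>\<phi> \<le> M\<close>. The iteration starts
  at \<open>M\<close> itself.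
\<close>

lemma singular_volterra_solution:
  fixes b :: "real \<Rightarrow> real \<Rightarrow> real" and M M' M'' :: "real \<Rightarrow> real"
  assumes c: "c > 0"
    and cont: "continuous_on ({0..<1} \<times> UNIV) (\<lambda>(s, x). b s x)"
    and lip: "\<And>X. 0 \<le> X \<Longrightarrow> X < 1 \<Longrightarrow>
      \<exists>B. \<forall>s\<in>{0..X}. \<forall>x y. x \<le> M s \<longrightarrow> y \<le> M s \<longrightarrow> \<bar>b s x - b s y\<bar> \<le> B * \<bar>x - y\<bar>"
    and M: "\<And>x. x \<in> {0..<1} \<Longrightarrow> (M has_real_derivative M' x) (at x)"
           "\<And>x. x \<in> {0..<1} \<Longrightarrow> (M' has_real_derivative M'' x) (at x)"
           "\<And>x. x \<in> {0..<1} \<Longrightarrow> 0 \<le> M'' x" "continuous_on {0..<1} M''"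
    and M0: "0 \<le> M' 0" "\<alpha> \<le> M 0"
    and bM: "\<And>s x. s \<in> {0..<1} \<Longrightarrow> x \<le> M s \<Longrightarrow> b s x \<le> M'' s"
  obtains \<phi> where "continuous_on {0..<1} \<phi>" "\<And>x. x \<in> {0..<1} \<Longrightarrow> \<phi> x \<le> M x"
    "\<And>x. x \<in> {0..<1} \<Longrightarrow>
       \<phi> x = \<alpha> + integral {0..x} (weighted_mean c (\<lambda>s. b s (\<phi> s)))"
proof -
  define T where "T = (\<lambda>g x. \<alpha> + integral {0..x} (weighted_mean c (\<lambda>s. b s (g s))))"
  have contb: "continuous_on {0..<1} (\<lambda>s. b s (g s))" if "continuous_on {0..<1} g" for g
  proof -
    have "continuous_on {0..<1} (\<lambda>s. (\<lambda>(s, x). b s x) (s, g s))"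
      by (rule continuous_on_compose2[OF cont]) (auto intro!: continuous_intros that)
    thus ?thesis by simp
  qed
  have sub: "continuous_on {0..t} g" if "continuous_on {0..<1} g" "t < 1" for g :: "real \<Rightarrow> real" and t
    by (rule continuous_on_subset[OF that(1)]) (use that in auto)
  have contJ: "continuous_on {0..<1} (weighted_mean c (\<lambda>s. b s (g s)))" if "continuous_on {0..<1} g" for g
    by (intro weighted_mean_continuous c contb that)
  have contT: "continuous_on {0..<1} (T g)" if "continuous_on {0..<1} g" for g
    unfolding T_def
    by (intro continuous_on_half_openI continuous_intros indefinite_integral_continuous_1
          integrable_continuous_interval sub[OF contJ[OF that]])
  have invT: "T g x \<le> M x" if g: "continuous_on {0..<1} g" "\<And>s. s \<in> {0..<1} \<Longrightarrow> g s \<le> M s"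
    and x: "x \<in> {0..<1}" for g x
  proof -
    have "weighted_mean c (\<lambda>s. b s (g s)) t \<le> M' t" if t: "t \<in> {0..x}" for t
    proof -
      have "weighted_mean c (\<lambda>s. b s (g s)) t \<le> weighted_mean c M'' t"
        by (intro weighted_mean_mono c sub contb g M) (use t x bM g in auto)
      also have "\<dots> \<le> integral {0..t} M''"
        by (intro weighted_mean_le_integral c sub M) (use t x in auto)
      also have "(M'' has_integral (M' t - M' 0)) {0..t}"
        by (rule fundamental_theorem_of_calculus)
           (use t x M(2) in \<open>auto simp: has_real_derivative_iff_has_vector_derivative
               intro: has_vector_derivative_at_within\<close>)
      hence "integral {0..t} M'' = M' t - M' 0" by (rule integral_unique)
      finally show ?thesis using M0 by simp
    qed
    moreover have MI: "(M' has_integral (M x - M 0)) {0..x}"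
      by (rule fundamental_theorem_of_calculus)
         (use x M(1) in \<open>auto simp: has_real_derivative_iff_has_vector_derivative
               intro: has_vector_derivative_at_within\<close>)
    moreover have "weighted_mean c (\<lambda>s. b s (g s)) integrable_on {0..x}"
      by (intro integrable_continuous_interval sub contJ g) (use x in auto)
    ultimately have "integral {0..x} (weighted_mean c (\<lambda>s. b s (g s))) \<le> M x - M 0"
      using integral_le[of "weighted_mean c (\<lambda>s. b s (g s))" "{0..x}" M']
      by (auto simp: has_integral_iff)
    thus ?thesis using M0 by (simp add: T_def)
  qed
  \<comment> \<open>An error of size \<open>K x\<^sup>j\<close> is reduced to \<open>B K x\<^bsup>j+1\<^esup> / (j + 1)\<close>; the factor \<open>t\<close>
    in the bound for the weighted mean is estimated by \<open>1\<close>.\<close>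
  have Tdiff: "\<bar>T g x - T h x\<bar> \<le> B * K * x ^ Suc j / Suc j"
    if X: "X < 1" and x: "x \<in> {0..X}" and B: "B \<ge> 0" "K \<ge> 0"
      "\<forall>s\<in>{0..X}. \<forall>x y. x \<le> M s \<longrightarrow> y \<le> M s \<longrightarrow> \<bar>b s x - b s y\<bar> \<le> B * \<bar>x - y\<bar>"
      and g: "continuous_on {0..<1} g" "\<And>s. s \<in> {0..<1} \<Longrightarrow> g s \<le> M s"
      and h: "continuous_on {0..<1} h" "\<And>s. s \<in> {0..<1} \<Longrightarrow> h s \<le> M s"
      and gh: "\<And>s. s \<in> {0..X} \<Longrightarrow> \<bar>g s - h s\<bar> \<le> K * s ^ j" for g h X x B K j
  proof -
    let ?d = "\<lambda>s. b s (g s) - b s (h s)"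
    have ptw: "\<bar>weighted_mean c ?d t\<bar> \<le> B * K * t ^ j" if t: "t \<in> {0..x}" for t
    proof -
      have "\<bar>weighted_mean c ?d t\<bar> \<le> (B * (K * t ^ j)) * t"
      proof (rule weighted_mean_abs_le[OF c])
        fix s assume s: "s \<in> {0..t}"
        have "\<bar>?d s\<bar> \<le> B * \<bar>g s - h s\<bar>" using B s t x X g h by auto
        also have "\<dots> \<le> B * (K * s ^ j)" using gh[of s] s t x B by (intro mult_left_mono) auto
        also have "\<dots> \<le> B * (K * t ^ j)" using s B by (intro mult_left_mono power_mono) auto
        finally show "\<bar>?d s\<bar> \<le> B * (K * t ^ j)" .
      qed (use t x X B in \<open>auto intro!: continuous_intros sub contb g h\<close>)
      also have "\<dots> \<le> (B * (K * t ^ j)) * 1" using t x X B by (intro mult_left_mono) auto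
      finally show ?thesis by simp
    qed
    have int: "weighted_mean c (\<lambda>s. b s (k s)) integrable_on {0..x}" if "continuous_on {0..<1} k" for k
      by (intro integrable_continuous_interval sub contJ that) (use x X in auto)
    have "T g x - T h x = integral {0..x} (\<lambda>t. weighted_mean c (\<lambda>s. b s (g s)) t - weighted_mean c (\<lambda>s. b s (h s)) t)"
      unfolding T_def by (subst integral_diff) (use int g h in auto)
    also have "\<dots> = integral {0..x} (weighted_mean c ?d)"
      by (rule integral_cong, subst weighted_mean_diff) (use x X c in \<open>auto intro!: sub contb g h\<close>)
    finally have eq: "T g x - T h x = integral {0..x} (weighted_mean c ?d)" .
    have powI: "((\<lambda>t. B * K * t ^ j) has_integral (B * K * x ^ Suc j / Suc j - B * K * 0 ^ Suc j / Suc j)) {0..x}"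
      by (rule fundamental_theorem_of_calculus)
         (use x in \<open>auto simp: has_real_derivative_iff_has_vector_derivative [symmetric]
               intro!: derivative_eq_intros simp del: of_nat_Suc power_Suc\<close>)
    have "norm (integral {0..x} (weighted_mean c ?d)) \<le> integral {0..x} (\<lambda>t. B * K * t ^ j)"
    proof (rule integral_norm_bound_integral)
      show "weighted_mean c ?d integrable_on {0..x}"
        by (intro integrable_continuous_interval sub weighted_mean_continuous c continuous_intros contb g h)
           (use x X in auto)
      show "(\<lambda>t. B * K * t ^ j) integrable_on {0..x}" using powI by (auto simp: integrable_on_def)
    qed (use ptw in auto)
    thus ?thesis unfolding eq integral_unique[OF powI] by simp
  qed
  define ph where "ph = (\<lambda>n. (T ^^ n) M)"
  have ph_Suc: "ph (Suc n) = T (ph n)" for n by (simp add: ph_def)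
  have contM: "continuous_on {0..<1} M"
    by (rule DERIV_continuous_on[where D = M']) (use M(1) in \<open>auto intro: has_field_derivative_at_within\<close>)
  have ph_cont: "continuous_on {0..<1} (ph n)" for n
    by (induction n) (auto simp: ph_Suc contT, simp add: ph_def contM)
  have ph_M: "x \<in> {0..<1} \<Longrightarrow> ph n x \<le> M x" for n x
    by (induction n arbitrary: x) (auto simp: ph_Suc intro!: invT ph_cont, simp add: ph_def)
  define \<phi> where "\<phi> = (\<lambda>x. lim (\<lambda>n. ph n x))"
  have unif: "uniform_limit {0..X} ph \<phi> sequentially" if X: "0 \<le> X" "X < 1" for X
  proof -
    obtain B0 where B0: "\<forall>s\<in>{0..X}. \<forall>x y. x \<le> M s \<longrightarrow> y \<le> M s \<longrightarrow> \<bar>b s x - b s y\<bar> \<le> B0 * \<bar>x - y\<bar>"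
      using lip[OF X] by blast
    define B where "B = \<bar>B0\<bar>"
    have B: "\<forall>s\<in>{0..X}. \<forall>x y. x \<le> M s \<longrightarrow> y \<le> M s \<longrightarrow> \<bar>b s x - b s y\<bar> \<le> B * \<bar>x - y\<bar>"
      unfolding B_def using B0 by (meson abs_ge_self abs_ge_zero mult_right_mono order_trans)
    have "bounded ((\<lambda>x. ph 1 x - ph 0 x) ` {0..X})"
      by (intro compact_imp_bounded compact_continuous_image continuous_intros sub ph_cont X) auto
    then obtain K where K: "K > 0" "\<And>s. s \<in> {0..X} \<Longrightarrow> \<bar>ph 1 s - ph 0 s\<bar> \<le> K"
      unfolding bounded_pos by auto
    have bd: "x \<in> {0..X} \<Longrightarrow> \<bar>ph (Suc n) x - ph n x\<bar> \<le> K * B ^ n / fact n * x ^ n" for n x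
    proof (induction n arbitrary: x)
      case 0 thus ?case using K by simp
    next
      case (Suc n)
      have "\<bar>T (ph (Suc n)) x - T (ph n) x\<bar> \<le> B * (K * B ^ n / fact n) * x ^ Suc n / Suc n"
        by (rule Tdiff[OF X(2)]) (use Suc B K in \<open>auto simp: B_def intro!: ph_cont ph_M\<close>)
      thus ?case by (simp add: ph_Suc field_simps)
    qed
    have "uniform_limit {0..X} (\<lambda>n x. \<Sum>i<n. ph (Suc i) x - ph i x) (\<lambda>x. \<Sum>i. ph (Suc i) x - ph i x) sequentially"
    proof (rule Weierstrass_m_test)
      fix n x assume x: "x \<in> {0..X}"
      have "K * B ^ n / fact n * x ^ n \<le> K * B ^ n / fact n * 1"
        using x X K by (intro mult_left_mono power_le_one) (auto simp: B_def)
      with bd[OF x, of n] show "norm (ph (Suc n) x - ph n x) \<le> K * (inverse (fact n) * B ^ n)"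
        by (simp add: field_simps)
    qed (intro summable_mult summable_exp)
    hence "uniform_limit {0..X} (\<lambda>n x. ph 0 x + (\<Sum>i<n. ph (Suc i) x - ph i x))
       (\<lambda>x. ph 0 x + (\<Sum>i. ph (Suc i) x - ph i x)) sequentially"
      by (intro uniform_limit_intros)
    hence u: "uniform_limit {0..X} ph (\<lambda>x. ph 0 x + (\<Sum>i. ph (Suc i) x - ph i x)) sequentially"
      by (simp add: sum_lessThan_telescope[where f = "\<lambda>i. ph i x" for x])
    have "\<phi> x = ph 0 x + (\<Sum>i. ph (Suc i) x - ph i x)" if "x \<in> {0..X}" for x
      unfolding \<phi>_def by (rule limI) (rule tendsto_uniform_limitI[OF u that])
    thus ?thesis using uniform_limit_cong'[of "{0..X}" ph ph \<phi>] u by auto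
  qed
  have pt: "(\<lambda>n. ph n x) \<longlonglongrightarrow> \<phi> x" if "x \<in> {0..<1}" for x
    by (rule tendsto_uniform_limitI[OF unif[of x]]) (use that in auto)
  have phi_cont: "continuous_on {0..<1} \<phi>"
  proof (rule continuous_on_half_openI)
    fix X :: real assume "0 \<le> X" "X < 1"
    thus "continuous_on {0..X} \<phi>"
      by (intro uniform_limit_theorem[OF _ unif] always_eventually allI sub[OF ph_cont]) auto
  qed
  have phi_M: "\<phi> x \<le> M x" if "x \<in> {0..<1}" for x
    by (rule LIMSEQ_le_const2[OF pt[OF that]]) (use ph_M that in auto)
  have fix_eq: "\<phi> x = T \<phi> x" if x: "x \<in> {0..<1}" for x
  proof -
    obtain B0 where B0: "\<forall>s\<in>{0..x}. \<forall>x y. x \<le> M s \<longrightarrow> y \<le> M s \<longrightarrow> \<bar>b s x - b s y\<bar> \<le> B0 * \<bar>x - y\<bar>"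
      using lip[of x] x by auto
    define B where "B = \<bar>B0\<bar> + 1"
    have B: "\<forall>s\<in>{0..x}. \<forall>x y. x \<le> M s \<longrightarrow> y \<le> M s \<longrightarrow> \<bar>b s x - b s y\<bar> \<le> B * \<bar>x - y\<bar>"
      unfolding B_def using B0
      by (meson abs_ge_self abs_ge_zero mult_right_mono order_trans less_eq_real_def add_increasing2 zero_le_one)
    have Bpos: "B > 0" by (simp add: B_def)
    have "(\<lambda>n. T (ph n) x) \<longlonglongrightarrow> T \<phi> x"
    proof (rule LIMSEQ_I)
      fix e :: real assume e: "e > 0"
      have "\<forall>\<^sub>F n in sequentially. \<forall>s\<in>{0..x}. dist (ph n s) (\<phi> s) < e / (2 * B)"
        using unif[of x] x e Bpos by (intro uniform_limitD) auto
      then obtain n0 where n0: "\<And>n s. n \<ge> n0 \<Longrightarrow> s \<in> {0..x} \<Longrightarrow> \<bar>ph n s - \<phi> s\<bar> < e / (2 * B)"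
        unfolding eventually_sequentially dist_real_def by blast
      have "norm (T (ph n) x - T \<phi> x) < e" if n: "n \<ge> n0" for n
      proof -
        have "\<bar>T (ph n) x - T \<phi> x\<bar> \<le> B * (e / (2 * B)) * x ^ Suc 0 / Suc 0"
        proof (rule Tdiff[of x])
          fix s assume "s \<in> {0..x}"
          thus "\<bar>ph n s - \<phi> s\<bar> \<le> e / (2 * B) * s ^ 0" using n0[OF n, of s] by simp
        qed (use x B Bpos e in \<open>auto intro: ph_cont ph_M phi_cont phi_M\<close>)
        also have "\<dots> = e / 2 * x" using Bpos by simp
        also have "\<dots> \<le> e / 2 * 1" using e x by (intro mult_left_mono) auto
        also have "\<dots> < e" using e by simp
        finally show ?thesis by simp
      qed
      thus "\<exists>no. \<forall>n\<ge>no. norm (T (ph n) x - T \<phi> x) < e" by blast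
    qed
    moreover have "(\<lambda>n. T (ph n) x) \<longlonglongrightarrow> \<phi> x"
      using LIMSEQ_Suc[OF pt[OF x]] by (simp add: ph_Suc)
    ultimately show ?thesis using LIMSEQ_unique by blast
  qed
  show ?thesis
    by (rule that[of \<phi>]) (use phi_cont phi_M fix_eq in \<open>auto simp: T_def\<close>)
qed

section \<open>Differential inequalities at infinity\<close>

lemma nonincreasing_bounded_converges:
  fixes g g' :: "real \<Rightarrow> real"
  assumes "\<And>x. x \<ge> x0 \<Longrightarrow> (g has_real_derivative g' x) (at x)"
    and "\<And>x. x \<ge> x0 \<Longrightarrow> g' x \<le> 0" and "\<And>x. x \<ge> x0 \<Longrightarrow> K \<le> g x"
  obtains l where "(g \<longlongrightarrow> l) at_top"
proof
  have mono: "g y \<le> g x" if "x0 \<le> x" "x \<le> y" for x y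
    by (rule DERIV_nonpos_imp_nonincreasing[OF that(2)])
       (use assms that in \<open>meson order_trans\<close>)
  have bdd: "bdd_below (g ` {x0..})" using assms(3) by (intro bdd_belowI2[of _ K]) auto
  show "(g \<longlongrightarrow> Inf (g ` {x0..})) at_top"
  proof (rule decreasing_tendsto)
    show "\<forall>\<^sub>F n in at_top. Inf (g ` {x0..}) \<le> g n"
      using eventually_ge_at_top[of x0] by eventually_elim (auto intro!: cInf_lower bdd)
  next
    fix y assume "Inf (g ` {x0..}) < y"
    then obtain x where x: "x \<ge> x0" "g x < y"
      using cInf_lessD[of "g ` {x0..}" y] by auto
    show "\<forall>\<^sub>F n in at_top. g n < y"
      using eventually_ge_at_top[of x]
    proof eventually_elim
      case (elim n)
      with mono[of x n] x show ?case by linarith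
    qed
  qed
qed

text \<open>
  A one-sided form of Barbalat's lemma. Where \<open>h \<ge> \<epsilon>\<close>, the Lipschitz bound keeps \<open>h \<ge> \<epsilon> / 2\<close> on an
  interval of fixed length, over which \<open>g\<close> would rise by a fixed amount; for large arguments the
  convergence of \<open>g\<close> forbids this. The vanishing error \<open>e\<close> admits perturbed equations.
\<close>

lemma lipschitz_minorant_of_derivative_small:
  fixes g g' h e :: "real \<Rightarrow> real"
  assumes g: "(g \<longlongrightarrow> l) at_top"
    and g': "\<And>x. x \<ge> x0 \<Longrightarrow> (g has_real_derivative g' x) (at x)"
    and h: "\<And>x. x \<ge> x0 \<Longrightarrow> h x \<le> g' x + e x"
    and lip: "\<And>x y. x0 \<le> x \<Longrightarrow> x \<le> y \<Longrightarrow> \<bar>h y - h x\<bar> \<le> K * (y - x)"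
    and e: "(e \<longlongrightarrow> 0) at_top" and eps: "\<epsilon> > 0"
  shows "\<forall>\<^sub>F x in at_top. h x < \<epsilon>"
proof -
  define \<delta> where "\<delta> = \<epsilon> / (2 * (\<bar>K\<bar> + 1))"
  have d: "\<delta> > 0" "(\<bar>K\<bar> + 1) * \<delta> = \<epsilon> / 2"
    using eps by (simp_all add: \<delta>_def field_simps add_nonneg_pos)
  have "\<forall>\<^sub>F x in at_top. \<bar>g x - l\<bar> < \<delta> * \<epsilon> / 16"
    using tendstoD[OF g, of "\<delta> * \<epsilon> / 16"] d eps by (simp add: dist_real_def)
  moreover have "\<forall>\<^sub>F x in at_top. \<bar>e x\<bar> < \<epsilon> / 4"
    using tendstoD[OF e, of "\<epsilon> / 4"] eps by (simp add: dist_real_def)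
  ultimately have "\<forall>\<^sub>F x in at_top. \<bar>g x - l\<bar> < \<delta> * \<epsilon> / 16 \<and> \<bar>e x\<bar> < \<epsilon> / 4 \<and> x \<ge> x0"
    using eventually_ge_at_top[of x0] by eventually_elim auto
  then obtain X where X: "\<And>x. x \<ge> X \<Longrightarrow> \<bar>g x - l\<bar> < \<delta> * \<epsilon> / 16 \<and> \<bar>e x\<bar> < \<epsilon> / 4 \<and> x \<ge> x0"
    by (auto simp: eventually_at_top_linorder)
  have "h x < \<epsilon>" if x: "x \<ge> X" for x
  proof (rule ccontr)
    assume hx: "\<not> h x < \<epsilon>"
    have "\<exists>z>x. z < x + \<delta> \<and> g (x + \<delta>) - g x = (x + \<delta> - x) * g' z"
      by (rule MVT2) (use d x X g' in force)+
    then obtain z where z: "z > x" "z < x + \<delta>" "g (x + \<delta>) - g x = \<delta> * g' z" by auto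
    have "\<bar>h z - h x\<bar> \<le> K * (z - x)" using lip[of x z] X[of x] x z by auto
    also have "\<dots> \<le> (\<bar>K\<bar> + 1) * \<delta>" using z by (intro mult_mono) auto
    finally have "h z \<ge> \<epsilon> / 2" using hx d by linarith
    hence "g' z \<ge> \<epsilon> / 4" using h[of z] X[of z] x z by force
    hence "\<delta> * g' z \<ge> \<delta> * (\<epsilon> / 4)" using d by (intro mult_left_mono) auto
    moreover have "\<bar>g x - l\<bar> < \<delta> * \<epsilon> / 16" "\<bar>g (x + \<delta>) - l\<bar> < \<delta> * \<epsilon> / 16"
      using X[of x] X[of "x + \<delta>"] x d by auto
    hence "g (x + \<delta>) - g x < \<delta> * \<epsilon> / 8" by linarith
    moreover have "\<delta> * \<epsilon> > 0" using d eps by simp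
    ultimately show False using z(3) by simp
  qed
  thus ?thesis unfolding eventually_at_top_linorder by blast
qed

text \<open>
  Completing the square gives \<open>(z\<^sup>2)' \<le> - a0 z\<^sup>2 + e\<^sup>2 / a0\<close>, so \<open>z\<^sup>2\<close> is attracted, at the exponential
  rate \<open>a0\<close>, to any level above the limit superior of \<open>e\<^sup>2 / a0\<^sup>2\<close>.
\<close>

lemma damped_linear_tendsto_0:
  fixes z a e :: "real \<Rightarrow> real"
  assumes z: "\<And>x. x \<ge> x0 \<Longrightarrow> (z has_real_derivative (- a x * z x + e x)) (at x)"
    and a: "\<And>x. x \<ge> x0 \<Longrightarrow> a x \<ge> a0" "a0 > 0" and e: "(e \<longlongrightarrow> 0) at_top"
  shows "(z \<longlongrightarrow> 0) at_top"
proof -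
  have "((\<lambda>x. (z x)\<^sup>2) \<longlongrightarrow> 0) at_top"
  proof (rule tendstoI)
    fix \<epsilon> :: real assume eps: "\<epsilon> > 0"
    \<comment> \<open>Chosen such that the level \<open>\<delta> / a0\<^sup>2\<close> enforced by an error \<open>e\<^sup>2 < \<delta>\<close> is \<open>\<epsilon> / 2\<close>.\<close>
    define \<delta> where "\<delta> = \<epsilon> * a0\<^sup>2 / 2"
    have d: "\<delta> > 0" "\<delta> / a0\<^sup>2 = \<epsilon> / 2" using eps a by (simp_all add: \<delta>_def)
    have "((\<lambda>x. (e x)\<^sup>2) \<longlongrightarrow> 0) at_top" using tendsto_power[OF e, of 2] by simp
    from tendstoD[OF this d(1)] have "\<forall>\<^sub>F x in at_top. (e x)\<^sup>2 < \<delta> \<and> x \<ge> x0"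
      using eventually_ge_at_top[of x0] by eventually_elim (auto simp: dist_real_def)
    then obtain X where X: "\<And>x. x \<ge> X \<Longrightarrow> (e x)\<^sup>2 < \<delta> \<and> x \<ge> x0"
      by (auto simp: eventually_at_top_linorder)
    define f where "f = (\<lambda>x. ((z x)\<^sup>2 - \<epsilon> / 2) * exp (a0 * x))"
    have f_mono: "f y \<le> f x" if "X \<le> x" "x \<le> y" for x y
    proof (rule DERIV_nonpos_imp_nonincreasing[OF that(2)])
      fix s assume s: "x \<le> s" "s \<le> y"
      hence s': "s \<ge> X" "s \<ge> x0" using that X by auto
      let ?D = "(2 * z s * (- a s * z s + e s) + a0 * ((z s)\<^sup>2 - \<epsilon> / 2)) * exp (a0 * s)"
      have "(f has_real_derivative ?D) (at s)"
        unfolding f_def by (auto intro!: derivative_eq_intros z s' simp: algebra_simps)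
      moreover have "?D \<le> 0"
      proof -
        have "a0 * (z s)\<^sup>2 \<le> a s * (z s)\<^sup>2" using a(1)[OF s'(2)] by (intro mult_right_mono) auto
        moreover have "0 \<le> (a0 * z s - e s)\<^sup>2 / a0" using a(2) by simp
        hence "2 * z s * e s \<le> a0 * (z s)\<^sup>2 + (e s)\<^sup>2 / a0"
          using a(2) by (simp add: power2_eq_square field_simps)
        moreover have "(e s)\<^sup>2 / a0 \<le> \<delta> / a0" using X[OF s'(1)] a(2) by (intro divide_right_mono) auto
        moreover have "\<delta> / a0 = a0 * (\<epsilon> / 2)" using a(2) by (simp add: \<delta>_def power2_eq_square)
        moreover have "2 * z s * (- a s * z s + e s) + a0 * ((z s)\<^sup>2 - \<epsilon> / 2)
            = - 2 * (a s * (z s)\<^sup>2) + 2 * z s * e s + a0 * (z s)\<^sup>2 - a0 * (\<epsilon> / 2)"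
          by (simp add: algebra_simps power2_eq_square)
        ultimately have "2 * z s * (- a s * z s + e s) + a0 * ((z s)\<^sup>2 - \<epsilon> / 2) \<le> 0"
          by linarith
        thus ?thesis by (simp add: mult_le_0_iff)
      qed
      ultimately show "\<exists>y. (f has_real_derivative y) (at s) \<and> y \<le> 0" by blast
    qed
    have "((\<lambda>x. \<bar>f X\<bar> * exp (- (a0 * x))) \<longlongrightarrow> \<bar>f X\<bar> * 0) at_top"
      using a(2) by real_asymp
    from tendstoD[OF this, of "\<epsilon> / 2"] eps
    have "\<forall>\<^sub>F x in at_top. \<bar>f X\<bar> * exp (- (a0 * x)) < \<epsilon> / 2" by (simp add: dist_real_def abs_mult)
    thus "\<forall>\<^sub>F x in at_top. dist ((z x)\<^sup>2) 0 < \<epsilon>"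
      using eventually_ge_at_top[of X]
    proof eventually_elim
      case (elim x)
      have "f x \<le> \<bar>f X\<bar>" using f_mono[of X x] elim by linarith
      hence "f x * exp (- (a0 * x)) \<le> \<bar>f X\<bar> * exp (- (a0 * x))" by (intro mult_right_mono) auto
      moreover have "f x * exp (- (a0 * x)) = (z x)\<^sup>2 - \<epsilon> / 2"
        by (simp add: f_def exp_minus)
      ultimately show ?case using elim by (simp add: dist_real_def)
    qed
  qed
  hence "((\<lambda>x. sqrt ((z x)\<^sup>2)) \<longlongrightarrow> sqrt 0) at_top" by (rule tendsto_real_sqrt)
  thus ?thesis by (simp add: tendsto_rabs_zero_iff)
qed

text \<open>
  At the first return to the level \<open>\<beta>\<close> the derivative could not be positive.
\<close>

lemma derivative_barrier:
  fixes y y' :: "real \<Rightarrow> real"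
  assumes y: "\<And>x. x \<ge> x1 \<Longrightarrow> (y has_real_derivative y' x) (at x)"
    and bar: "\<And>x. x \<ge> x1 \<Longrightarrow> y x = \<beta> \<Longrightarrow> y' x > 0" and "y x1 > \<beta>" and "x \<ge> x1"
  shows "y x > \<beta>"
proof (rule ccontr)
  assume "\<not> y x > \<beta>"
  define S where "S = {t \<in> {x1..x}. y t \<le> \<beta>}"
  have cont: "continuous_on {x1..t} y" for t
    by (rule DERIV_continuous_on[where D = y']) (use y in \<open>auto intro: has_field_derivative_at_within\<close>)
  have "closed S" unfolding S_def
    by (rule continuous_on_closed_Collect_le[OF cont continuous_on_const]) simp
  have ne: "S \<noteq> {}" "bdd_below S" using \<open>\<not> y x > \<beta>\<close> \<open>x \<ge> x1\<close> by (auto simp: S_def intro: bdd_belowI[of _ x1])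
  define t where "t = Inf S"
  have tS: "t \<in> S" unfolding t_def by (rule closed_contains_Inf) (use ne \<open>closed S\<close> in auto)
  hence t: "x1 < t" "y t \<le> \<beta>" using assms(3) by (auto simp: S_def less_le)
  have below: "y s > \<beta>" if "x1 \<le> s" "s < t" for s
    using that tS cInf_lower[OF _ ne(2), of s] by (force simp: S_def t_def not_less)
  have "y t = \<beta>"
  proof (rule ccontr)
    assume "y t \<noteq> \<beta>"
    hence "y t < \<beta>" using t by auto
    then obtain s where s: "x1 \<le> s" "s \<le> t" "y s = \<beta>"
      using IVT2'[of y t \<beta> x1] assms(3) cont t by force
    with below[of s] \<open>y t \<noteq> \<beta>\<close> show False by (cases "s = t") auto
  qed
  hence "y' t > 0" using bar[of t] t by auto
  from DERIV_pos_inc_left[OF y this] t obtain d where d: "d > 0" "\<And>h. 0 < h \<Longrightarrow> h < d \<Longrightarrow> y (t - h) < y t"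
    by auto
  define h where "h = min (d / 2) (t - x1)"
  have "0 < h" "h < d" "x1 \<le> t - h" using d t by (auto simp: h_def)
  with d(2)[of h] below[of "t - h"] \<open>y t = \<beta>\<close> show False by auto
qed

section \<open>Asymptotics of the perturbed Emden equation\<close>

lemma lipschitz_of_bounded_derivative:
  fixes f f' :: "real \<Rightarrow> real"
  assumes "\<And>x. x \<ge> x0 \<Longrightarrow> (f has_real_derivative f' x) (at x)" "\<And>x. x \<ge> x0 \<Longrightarrow> \<bar>f' x\<bar> \<le> K"
    and "x0 \<le> x" "x \<le> y"
  shows "\<bar>f y - f x\<bar> \<le> K * (y - x)"
proof (cases "x = y")
  case False
  have "\<exists>z>x. z < y \<and> f y - f x = (y - x) * f' z"
    by (rule MVT2) (use False assms in auto)
  then obtain z where z: "z > x" "f y - f x = (y - x) * f' z" by auto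
  have "\<bar>f' z\<bar> * (y - x) \<le> K * (y - x)" using assms z by (intro mult_right_mono) auto
  thus ?thesis using z assms by (simp add: abs_mult mult.commute)
qed auto

text \<open>
  The equation that \<open>w = r powr m * u\<close> satisfies near the singularity in the variable
  \<open>x = ln (1 / r)\<close>. Without \<open>e1\<close> and \<open>e2\<close>, which are \<open>O(r\<^sup>2)\<close>, it describes the motion of a particle
  in the potential \<open>- m (n - m) w\<^sup>2 / 2 + w powr (p + 1) / (p + 1)\<close> with damping \<open>2 m - n\<close>.
  Subcriticality of \<open>p\<close> is the positivity of the damping. The linearisation at the equilibrium \<open>0\<close>
  has the rates \<open>n - m\<close> and \<open>- m\<close>; a trajectory that decays with the rate \<open>- m\<close> comes from a
  removable singularity, and the lower bound \<open>w_ge\<close> excludes it, as \<open>m - n / 2 < m\<close>.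
\<close>

locale perturbed_emden =
  fixes w w1 e1 e2 :: "real \<Rightarrow> real" and p m n C c0 x0 :: real
  assumes p: "p > 1" and m: "0 < m" "m \<le> n" "n < 2 * m" and c0: "c0 > 0" and x0: "x0 \<ge> 0"
    and w: "\<And>x. x \<ge> x0 \<Longrightarrow> (w has_real_derivative w1 x) (at x)"
    and w1: "\<And>x. x \<ge> x0 \<Longrightarrow> (w1 has_real_derivative
       (- (2 * m - n - e1 x) * w1 x + (m * (n - m) + e2 x) * w x - w x powr p)) (at x)"
    and pos: "\<And>x. x \<ge> x0 \<Longrightarrow> w x > 0" and w_le: "\<And>x. x \<ge> x0 \<Longrightarrow> w x \<le> C"
    and w1_le: "\<And>x. x \<ge> x0 \<Longrightarrow> \<bar>w1 x\<bar> \<le> C * w x"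
    and e1_le: "\<And>x. x \<ge> x0 \<Longrightarrow> \<bar>e1 x\<bar> \<le> C * exp (- 2 * x)"
    and e2_le: "\<And>x. x \<ge> x0 \<Longrightarrow> \<bar>e2 x\<bar> \<le> C * exp (- 2 * x)"
    and w_ge: "\<And>x. x \<ge> x0 \<Longrightarrow> w x \<ge> c0 * exp (- (m - n / 2) * x)"
begin

text \<open>
  The damping coefficient, and the number whose power \<open>\<Lambda> powr (1 / (p - 1))\<close> is the positive
  equilibrium when \<open>\<Lambda> > 0\<close>.
\<close>

definition "d = 2 * m - n"
definition "\<Lambda> = m * (n - m)"

lemma d_pos: "d > 0" using m by (simp add: d_def)
lemma Lam_nonneg: "\<Lambda> \<ge> 0" using m by (simp add: \<Lambda>_def)
lemma C_pos: "C > 0" using pos[of x0] w_le[of x0] by simp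

lemma w1': "x \<ge> x0 \<Longrightarrow> (w1 has_real_derivative
       (- (d - e1 x) * w1 x + (\<Lambda> + e2 x) * w x - w x powr p)) (at x)"
  using w1 by (simp add: d_def \<Lambda>_def)

lemma exp_le_one: "x \<ge> x0 \<Longrightarrow> exp (- 2 * x) \<le> 1" using x0 by simp

lemma e1_bd: "x \<ge> x0 \<Longrightarrow> \<bar>e1 x\<bar> \<le> C" and e2_bd: "x \<ge> x0 \<Longrightarrow> \<bar>e2 x\<bar> \<le> C"
  using e1_le[of x] e2_le[of x] exp_le_one[of x] C_pos
    mult_left_mono[of "exp (- 2 * x)" 1 C] by linarith+

lemma w1_bd:
  assumes "x \<ge> x0"
  shows "\<bar>w1 x\<bar> \<le> C\<^sup>2"
proof -
  have "C * w x \<le> C * C" using w_le[OF assms] C_pos by (intro mult_left_mono) auto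
  with w1_le[OF assms] show ?thesis by (simp add: power2_eq_square)
qed

lemma powr_bd: "x \<ge> x0 \<Longrightarrow> q \<ge> 0 \<Longrightarrow> w x powr q \<le> C powr q"
  using pos[of x] w_le[of x] by (intro powr_mono2) auto

lemma tendsto_exp_error: "((\<lambda>x. K * exp (- 2 * x)) \<longlongrightarrow> 0) (at_top :: real filter)"
proof -
  have "((\<lambda>x::real. exp (- 2 * x)) \<longlongrightarrow> 0) at_top" by real_asymp
  from tendsto_mult_left[OF this, of K] show ?thesis by simp
qed

lemma e1_tendsto: "(e1 \<longlongrightarrow> 0) at_top" and e2_tendsto: "(e2 \<longlongrightarrow> 0) at_top"
proof -
  have "\<forall>\<^sub>F x in at_top. norm (e1 x) \<le> C * exp (- 2 * x)"
       "\<forall>\<^sub>F x in at_top. norm (e2 x) \<le> C * exp (- 2 * x)"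
    using eventually_ge_at_top[of x0] by (eventually_elim, use e1_le e2_le in simp)+
  thus "(e1 \<longlongrightarrow> 0) at_top" "(e2 \<longlongrightarrow> 0) at_top"
    using Lim_null_comparison[OF _ tendsto_exp_error] by blast+
qed

lemma w1_deriv_bd:
  assumes "x \<ge> x0"
  shows "\<bar>- (d - e1 x) * w1 x + (\<Lambda> + e2 x) * w x - w x powr p\<bar>
     \<le> (d + C) * C\<^sup>2 + (\<Lambda> + C) * C + C powr p"
proof -
  have "\<bar>(d - e1 x) * w1 x\<bar> \<le> (d + C) * C\<^sup>2"
    unfolding abs_mult using e1_bd[OF assms] w1_bd[OF assms] d_pos C_pos by (intro mult_mono) auto
  moreover have "\<bar>(\<Lambda> + e2 x) * w x\<bar> \<le> (\<Lambda> + C) * C"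
    unfolding abs_mult using e2_bd[OF assms] w_le[OF assms] pos[OF assms] Lam_nonneg C_pos
    by (intro mult_mono) auto
  moreover have "w x powr p \<le> C powr p" "w x powr p \<ge> 0" using powr_bd[OF assms, of p] p by auto
  ultimately show ?thesis by linarith
qed

lemma powr_Suc: "x \<ge> x0 \<Longrightarrow> w x powr (q + 1) = w x powr q * w x"
  using pos[of x] by (simp add: powr_add)

definition "energy x = (w1 x)\<^sup>2 / 2 - \<Lambda> * (w x)\<^sup>2 / 2 + w x powr (p + 1) / (p + 1)"
definition "energy_deriv x = - (d - e1 x) * (w1 x)\<^sup>2 + e2 x * w x * w1 x"

lemma energy_has_derivative:
  assumes "x \<ge> x0"
  shows "(energy has_real_derivative energy_deriv x) (at x)"
proof -
  let ?w2 = "- (d - e1 x) * w1 x + (\<Lambda> + e2 x) * w x - w x powr p"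
  have P: "((\<lambda>x. w x powr (p + 1) / (p + 1)) has_real_derivative w x powr p * w1 x) (at x)"
    using DERIV_cdivide[OF DERIV_chain2[OF has_real_derivative_powr[OF pos[OF assms], of "p + 1"] w[OF assms]], of "p + 1"] p
    by simp
  have Q: "((\<lambda>x. (w1 x)\<^sup>2 / 2 - \<Lambda> * (w x)\<^sup>2 / 2) has_real_derivative w1 x * ?w2 - \<Lambda> * w x * w1 x) (at x)"
    by (auto intro!: derivative_eq_intros w[OF assms] w1'[OF assms])
  show ?thesis
    using DERIV_add[OF Q P] unfolding energy_def[abs_def]
    by (rule DERIV_cong) (simp add: energy_deriv_def algebra_simps power2_eq_square)
qed

lemma energy_deriv_estimate:
  assumes "x \<ge> x0"
  shows "\<bar>energy_deriv x + d * (w1 x)\<^sup>2\<bar> \<le> (C ^ 5 + C ^ 4) * exp (- 2 * x)"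
proof -
  have "\<bar>e1 x * (w1 x)\<^sup>2\<bar> \<le> (C * exp (- 2 * x)) * (C\<^sup>2)\<^sup>2"
    unfolding abs_mult using e1_le[OF assms] power_mono[OF w1_bd[OF assms], of 2] C_pos
    by (intro mult_mono) auto
  moreover have "\<bar>e2 x * w x * w1 x\<bar> \<le> ((C * exp (- 2 * x)) * C) * C\<^sup>2"
    unfolding abs_mult using e2_le[OF assms] w1_bd[OF assms] w_le[OF assms] pos[OF assms] C_pos
    by (intro mult_mono) auto
  moreover have "energy_deriv x + d * (w1 x)\<^sup>2 = e1 x * (w1 x)\<^sup>2 + e2 x * w x * w1 x"
    by (simp add: energy_deriv_def algebra_simps)
  moreover have "(C * exp (- 2 * x)) * (C\<^sup>2)\<^sup>2 + ((C * exp (- 2 * x)) * C) * C\<^sup>2 = (C ^ 5 + C ^ 4) * exp (- 2 * x)"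
    by (simp add: eval_nat_numeral algebra_simps)
  ultimately show ?thesis by linarith
qed

text \<open>
  Friction dissipates energy, and the perturbation feeds in at most a multiple of \<open>exp (- 2 x)\<close>.
  Half of that multiple, added to the energy, therefore makes it nonincreasing.
\<close>

lemma energy_converges: "\<exists>l. (energy \<longlongrightarrow> l) at_top"
proof -
  define C3 where "C3 = C ^ 5 + C ^ 4"
  have C3: "C3 > 0" using C_pos by (simp add: C3_def add_pos_pos)
  have der: "((\<lambda>x. energy x + C3 / 2 * exp (- 2 * x)) has_real_derivative
        energy_deriv x - C3 * exp (- 2 * x)) (at x)" if "x \<ge> x0" for x
    by (auto intro!: derivative_eq_intros energy_has_derivative[OF that])
  have "energy_deriv x - C3 * exp (- 2 * x) \<le> 0" if "x \<ge> x0" for x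
  proof -
    have "d * (w1 x)\<^sup>2 \<ge> 0" using d_pos by simp
    with energy_deriv_estimate[OF that] show ?thesis unfolding C3_def[symmetric] by linarith
  qed
  moreover have "- (\<Lambda> * C\<^sup>2 / 2) \<le> energy x + C3 / 2 * exp (- 2 * x)" if "x \<ge> x0" for x
  proof -
    have "\<Lambda> * (w x)\<^sup>2 \<le> \<Lambda> * C\<^sup>2"
      using pos[OF that] w_le[OF that] Lam_nonneg by (intro mult_left_mono power_mono) auto
    moreover have "(w1 x)\<^sup>2 \<ge> 0" "w x powr (p + 1) / (p + 1) \<ge> 0" "C3 / 2 * exp (- 2 * x) \<ge> 0"
      using p C3 by auto
    ultimately show ?thesis unfolding energy_def by linarith
  qed
  ultimately obtain l where "((\<lambda>x. energy x + C3 / 2 * exp (- 2 * x)) \<longlongrightarrow> l) at_top"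
    using nonincreasing_bounded_converges[OF der] by blast
  from tendsto_diff[OF this tendsto_exp_error[of "C3 / 2"]] show ?thesis by auto
qed

text \<open>
  The dissipation \<open>d * (w1 x)\<^sup>2\<close> is, up to the perturbation, the rate at which the convergent energy
  decreases, and it is Lipschitz because the equation bounds the second derivative of \<open>w\<close>.
\<close>

lemma w1_tendsto_0: "(w1 \<longlongrightarrow> 0) at_top"
proof (rule tendstoI)
  fix \<epsilon> :: real assume eps: "\<epsilon> > 0"
  obtain l where l: "(energy \<longlongrightarrow> l) at_top" using energy_converges by blast
  define D where "D = (d + C) * C\<^sup>2 + (\<Lambda> + C) * C + C powr p"
  have "\<forall>\<^sub>F x in at_top. d * (w1 x)\<^sup>2 < d * \<epsilon>\<^sup>2"
  proof (rule lipschitz_minorant_of_derivative_small)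
    show "((\<lambda>x. - energy x) \<longlongrightarrow> - l) at_top" by (intro tendsto_intros l)
    fix x y assume xy: "x0 \<le> x" "x \<le> y"
    show "\<bar>d * (w1 y)\<^sup>2 - d * (w1 x)\<^sup>2\<bar> \<le> (2 * d * C\<^sup>2 * D) * (y - x)"
    proof (rule lipschitz_of_bounded_derivative[OF _ _ xy])
      fix x assume x: "x \<ge> x0"
      let ?w2 = "- (d - e1 x) * w1 x + (\<Lambda> + e2 x) * w x - w x powr p"
      show "((\<lambda>x. d * (w1 x)\<^sup>2) has_real_derivative (2 * d * w1 x * ?w2)) (at x)"
        by (auto intro!: derivative_eq_intros w1'[OF x] simp: field_simps)
      show "\<bar>2 * d * w1 x * ?w2\<bar> \<le> 2 * d * C\<^sup>2 * D"
        unfolding abs_mult using w1_bd[OF x] w1_deriv_bd[OF x] d_pos C_pos Lam_nonneg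
        by (intro mult_mono) (auto simp: D_def)
    qed
  next
    fix x assume x: "x \<ge> x0"
    show "((\<lambda>x. - energy x) has_real_derivative (- energy_deriv x)) (at x)"
      by (auto intro!: derivative_eq_intros energy_has_derivative[OF x])
    show "d * (w1 x)\<^sup>2 \<le> - energy_deriv x + (C ^ 5 + C ^ 4) * exp (- 2 * x)"
      using energy_deriv_estimate[OF x] by linarith
  qed (use eps d_pos tendsto_exp_error in auto)
  thus "\<forall>\<^sub>F x in at_top. dist (w1 x) 0 < \<epsilon>"
  proof eventually_elim
    case (elim x)
    hence "\<bar>w1 x\<bar>\<^sup>2 < \<epsilon>\<^sup>2" using d_pos by simp
    hence "\<bar>w1 x\<bar> < \<epsilon>" by (rule power2_less_imp_less) (use eps in simp)
    thus ?case by (simp add: dist_real_def)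
  qed
qed

definition "force x = \<Lambda> * w x - w x powr p"

lemma force_lipschitz:
  assumes "x0 \<le> x" "x \<le> y"
  shows "\<bar>force y - force x\<bar> \<le> (\<Lambda> + p * C powr (p - 1)) * C\<^sup>2 * (y - x)"
proof (rule lipschitz_of_bounded_derivative[OF _ _ assms])
  fix x assume x: "x \<ge> x0"
  show "(force has_real_derivative ((\<Lambda> - p * w x powr (p - 1)) * w1 x)) (at x)"
    unfolding force_def[abs_def] using pos[OF x]
    by (auto intro!: derivative_eq_intros w[OF x] simp: field_simps)
  have "\<bar>\<Lambda> - p * w x powr (p - 1)\<bar> \<le> \<Lambda> + p * C powr (p - 1)"
  proof -
    have "p * w x powr (p - 1) \<le> p * C powr (p - 1)" "0 \<le> p * w x powr (p - 1)"
      using powr_bd[OF x, of "p - 1"] p by (auto intro!: mult_left_mono)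
    thus ?thesis using Lam_nonneg by linarith
  qed
  thus "\<bar>(\<Lambda> - p * w x powr (p - 1)) * w1 x\<bar> \<le> (\<Lambda> + p * C powr (p - 1)) * C\<^sup>2"
    unfolding abs_mult using w1_bd[OF x] p Lam_nonneg by (intro mult_mono) auto
qed

text \<open>
  Once the velocity \<open>w1\<close> vanishes in the limit, the equation says that the force is, up to vanishing
  terms, the derivative of \<open>w1\<close>; the one-sided Barbalat lemma applies to \<open>w1\<close> and to \<open>- w1\<close>.
\<close>

lemma force_tendsto_0: "(force \<longlongrightarrow> 0) at_top"
proof -
  define e where "e = (\<lambda>x. (d - e1 x) * w1 x - e2 x * w x)"
  have e: "(e \<longlongrightarrow> 0) at_top"
  proof -
    have "((\<lambda>x. C * \<bar>e2 x\<bar>) \<longlongrightarrow> C * 0) at_top" by (intro tendsto_intros tendsto_rabs_zero e2_tendsto)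
    hence "((\<lambda>x. e2 x * w x) \<longlongrightarrow> 0) at_top"
    proof (rule Lim_null_comparison[rotated, OF tendsto_eq_rhs])
      show "\<forall>\<^sub>F x in at_top. norm (e2 x * w x) \<le> C * \<bar>e2 x\<bar>"
        using eventually_ge_at_top[of x0]
      proof eventually_elim
        case (elim x)
        have "\<bar>e2 x\<bar> * w x \<le> \<bar>e2 x\<bar> * C" using w_le[OF elim] by (intro mult_left_mono) auto
        thus ?case using pos[OF elim] by (simp add: abs_mult mult.commute)
      qed
    qed simp
    moreover have "((\<lambda>x. (d - e1 x) * w1 x) \<longlongrightarrow> (d - 0) * 0) at_top"
      by (intro tendsto_intros e1_tendsto w1_tendsto_0)
    ultimately show ?thesis unfolding e_def using tendsto_diff by fastforce
  qed
  have up: "\<forall>\<^sub>F x in at_top. force x < \<epsilon>" if eps: "\<epsilon> > 0" for \<epsilon>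
  proof (rule lipschitz_minorant_of_derivative_small[OF w1_tendsto_0 w1' _ force_lipschitz e eps])
    fix x assume "x \<ge> x0"
    show "force x \<le> - (d - e1 x) * w1 x + (\<Lambda> + e2 x) * w x - w x powr p + e x"
      by (simp add: force_def e_def algebra_simps)
  qed
  have lo: "\<forall>\<^sub>F x in at_top. - force x < \<epsilon>" if eps: "\<epsilon> > 0" for \<epsilon>
  proof (rule lipschitz_minorant_of_derivative_small[OF _ _ _ _ _ eps])
    show "((\<lambda>x. - w1 x) \<longlongrightarrow> - 0) at_top" "((\<lambda>x. - e x) \<longlongrightarrow> 0) at_top"
      using tendsto_minus[OF e] tendsto_minus[OF w1_tendsto_0] by simp_all
    fix x assume x: "x \<ge> x0"
    show "((\<lambda>x. - w1 x) has_real_derivative - (- (d - e1 x) * w1 x + (\<Lambda> + e2 x) * w x - w x powr p)) (at x)"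
      by (intro DERIV_minus w1' x)
    show "- force x \<le> - (- (d - e1 x) * w1 x + (\<Lambda> + e2 x) * w x - w x powr p) + - e x"
      by (simp add: force_def e_def algebra_simps)
    fix y assume "x \<le> y"
    with x show "\<bar>- force y - - force x\<bar> \<le> (\<Lambda> + p * C powr (p - 1)) * C\<^sup>2 * (y - x)"
      using force_lipschitz[of x y] by (simp add: abs_minus_commute)
  qed
  show ?thesis
  proof (rule tendstoI)
    fix \<epsilon> :: real assume "\<epsilon> > 0"
    from up[OF this] lo[OF this] show "\<forall>\<^sub>F x in at_top. dist (force x) 0 < \<epsilon>"
      by eventually_elim (auto simp: dist_real_def)
  qed
qed

lemma w_continuous: "continuous_on {x0..} w"
  by (rule DERIV_continuous_on[where D = w1]) (use w in \<open>auto intro: has_field_derivative_at_within\<close>)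

lemma force_eq: "x \<ge> x0 \<Longrightarrow> force x = w x * (\<Lambda> - w x powr (p - 1))"
  using powr_Suc[of x "p - 1"] by (simp add: force_def algebra_simps)

text \<open>
  The force \<open>w (\<Lambda> - w powr (p - 1))\<close> tends to \<open>0\<close> and \<open>w\<close> is bounded, so \<open>w\<close> accumulates only at
  equilibria. For \<open>\<Lambda> > 0\<close> it cannot oscillate between the two, because it would cross half of the
  positive equilibrium, where the force is a fixed positive number.
\<close>

lemma w_dichotomy:
  "(w \<longlongrightarrow> 0) at_top \<or> (\<Lambda> > 0 \<and> (w \<longlongrightarrow> \<Lambda> powr (1 / (p - 1))) at_top)"
proof (cases "\<Lambda> = 0")
  case True
  have "((\<lambda>x. (- force x) powr (1 / p)) \<longlongrightarrow> (- 0) powr (1 / p)) at_top"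
    by (rule tendsto_powr'[OF tendsto_minus[OF force_tendsto_0] tendsto_const]) (use p True in \<open>auto simp: force_def\<close>)
  moreover have "\<forall>\<^sub>F x in at_top. (- force x) powr (1 / p) = w x"
    using eventually_ge_at_top[of x0]
    by eventually_elim (use pos p True in \<open>auto simp: force_def powr_powr less_imp_le\<close>)
  ultimately have "(w \<longlongrightarrow> (- 0) powr (1 / p)) at_top" by (rule Lim_transform_eventually)
  thus ?thesis by simp
next
  case False
  hence L: "\<Lambda> > 0" using Lam_nonneg by simp
  \<comment> \<open>\<open>h\<close> is the positive equilibrium and \<open>\<eta>\<close> the force at \<open>h / 2\<close>.\<close>
  define h where "h = \<Lambda> powr (1 / (p - 1))"
  have h: "h > 0" "h powr (p - 1) = \<Lambda>" using L p by (auto simp: h_def powr_powr)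
  define q where "q = (1/2::real) powr (p - 1)"
  have q: "0 < q" "q < 1" using p powr_less_mono2[of "p - 1" "1/2" 1] by (auto simp: q_def)
  have hq: "(h / 2) powr (p - 1) = \<Lambda> * q" using h by (simp add: q_def powr_divide powr_mult)
  define \<eta> where "\<eta> = h / 2 * (\<Lambda> * (1 - q))"
  have eta: "\<eta> > 0" using h L q by (simp add: \<eta>_def)
  obtain X where X: "\<And>x. x \<ge> X \<Longrightarrow> x \<ge> x0 \<and> \<bar>force x\<bar> < \<eta>"
  proof -
    have "\<forall>\<^sub>F x in at_top. x \<ge> x0 \<and> \<bar>force x\<bar> < \<eta>"
      using tendstoD[OF force_tendsto_0 eta] eventually_ge_at_top[of x0]
      by eventually_elim (auto simp: dist_real_def)
    thus ?thesis using that by (auto simp: eventually_at_top_linorder)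
  qed
  have ne: "w x \<noteq> h / 2" if "x \<ge> X" for x
  proof
    assume eq: "w x = h / 2"
    have "force x = w x * (\<Lambda> - w x powr (p - 1))" using force_eq X that by blast
    hence "force x = h / 2 * (\<Lambda> - (h / 2) powr (p - 1))" unfolding eq .
    also have "\<dots> = \<eta>" by (simp add: hq \<eta>_def algebra_simps)
    finally have "force x = \<eta>" .
    with X[OF that] show False by auto
  qed
  have cont: "continuous_on {a..b} w" if "a \<ge> X" for a b
    by (rule continuous_on_subset[OF w_continuous]) (use that X in force)
  show ?thesis
  proof (cases "w X < h / 2")
    case True
    have small: "w x < h / 2" if "x \<ge> X" for x
      using IVT'[of w X "h / 2" x] True cont[of X x] ne that by force
    have "((\<lambda>x. force x / (\<Lambda> * (1 - q))) \<longlongrightarrow> 0 / (\<Lambda> * (1 - q))) at_top"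
      by (intro tendsto_intros force_tendsto_0) (use L q in auto)
    hence "((\<lambda>x. force x / (\<Lambda> * (1 - q))) \<longlongrightarrow> 0) at_top" by simp
    hence "(w \<longlongrightarrow> 0) at_top"
    proof (rule Lim_null_comparison[rotated])
      show "\<forall>\<^sub>F x in at_top. norm (w x) \<le> force x / (\<Lambda> * (1 - q))"
        using eventually_ge_at_top[of X]
      proof eventually_elim
        case (elim x)
        hence x: "x \<ge> x0" using X by auto
        have "w x powr (p - 1) \<le> (h / 2) powr (p - 1)"
          using small[OF elim] pos[OF x] p by (intro powr_mono2) auto
        hence "\<Lambda> * (1 - q) \<le> \<Lambda> - w x powr (p - 1)" by (simp add: hq algebra_simps)
        hence "w x * (\<Lambda> * (1 - q)) \<le> force x"
          unfolding force_eq[OF x] using pos[OF x] by (intro mult_left_mono) auto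
        thus ?case using L q pos[OF x] by (simp add: field_simps)
      qed
    qed
    thus ?thesis ..
  next
    case False
    hence big0: "w X > h / 2" using ne[of X] by force
    have big: "w x > h / 2" if "x \<ge> X" for x
      using IVT2'[of w x "h / 2" X] big0 cont[of X x] ne that by force
    have "((\<lambda>x. \<bar>force x\<bar> / (h / 2)) \<longlongrightarrow> \<bar>0\<bar> / (h / 2)) at_top"
      by (intro tendsto_intros force_tendsto_0) (use h in auto)
    hence "((\<lambda>x. \<bar>force x\<bar> / (h / 2)) \<longlongrightarrow> 0) at_top" by simp
    hence "((\<lambda>x. \<Lambda> - w x powr (p - 1)) \<longlongrightarrow> 0) at_top"
    proof (rule Lim_null_comparison[rotated])
      show "\<forall>\<^sub>F x in at_top. norm (\<Lambda> - w x powr (p - 1)) \<le> \<bar>force x\<bar> / (h / 2)"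
        using eventually_ge_at_top[of X]
      proof eventually_elim
        case (elim x)
        hence x: "x \<ge> x0" using X by auto
        have "h / 2 * \<bar>\<Lambda> - w x powr (p - 1)\<bar> \<le> w x * \<bar>\<Lambda> - w x powr (p - 1)\<bar>"
          using big[OF elim] by (intro mult_right_mono) auto
        also have "\<dots> = \<bar>force x\<bar>" using force_eq[OF x] pos[OF x] by (simp add: abs_mult)
        finally show ?case using h by (simp add: field_simps)
      qed
    qed
    from tendsto_diff[OF tendsto_const[of \<Lambda>] this]
    have "((\<lambda>x. w x powr (p - 1)) \<longlongrightarrow> \<Lambda>) at_top" by simp
    from tendsto_powr[OF this tendsto_const, of "1 / (p - 1)"] L
    have "((\<lambda>x. (w x powr (p - 1)) powr (1 / (p - 1))) \<longlongrightarrow> h) at_top" by (simp add: h_def)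
    moreover have "\<forall>\<^sub>F x in at_top. (w x powr (p - 1)) powr (1 / (p - 1)) = w x"
      using eventually_ge_at_top[of x0]
      by eventually_elim (use pos p in \<open>auto simp: powr_powr less_imp_le\<close>)
    ultimately have "(w \<longlongrightarrow> h) at_top" by (rule Lim_transform_eventually)
    thus ?thesis using L by (simp add: h_def)
  qed
qed

definition "logd x = w1 x / w x"

lemma logd_bd: "x \<ge> x0 \<Longrightarrow> \<bar>logd x\<bar> \<le> C"
  using w1_le[of x] pos[of x] by (simp add: logd_def abs_mult field_simps)

text \<open>
  When \<open>w\<close> tends to \<open>0\<close>, this is an autonomous Riccati equation up to vanishing terms; its rest points
  \<open>- m\<close> and \<open>n - m\<close> are repelling and attracting, respectively.
\<close>

lemma logd_has_derivative:
  assumes "x \<ge> x0"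
  shows "(logd has_real_derivative
     (- (logd x + m) * (logd x - (n - m)) + (e1 x * logd x + e2 x - w x powr (p - 1)))) (at x)"
proof -
  let ?w2 = "- (d - e1 x) * w1 x + (\<Lambda> + e2 x) * w x - w x powr p"
  have "(logd has_real_derivative (?w2 * w x - w1 x * w1 x) / (w x * w x)) (at x)"
    unfolding logd_def[abs_def] using pos[OF assms]
    by (intro DERIV_divide w w1' assms) auto
  moreover have "(?w2 * w x - w1 x * w1 x) / (w x * w x) =
     - (logd x + m) * (logd x - (n - m)) + (e1 x * logd x + e2 x - w x powr (p - 1))"
    using pos[OF assms] powr_Suc[OF assms, of "p - 1"]
    by (simp add: logd_def d_def \<Lambda>_def divide_simps) (simp add: algebra_simps)
  ultimately show ?thesis by simp
qed

lemma exp_lower_of_logd_ge: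
  assumes X: "X \<ge> x0" and b: "\<And>x. x \<ge> X \<Longrightarrow> logd x \<ge> \<beta>" and x: "x \<ge> X"
  shows "w x \<ge> w X * exp (\<beta> * (x - X))"
proof -
  have "(\<lambda>x. w x * exp (- \<beta> * (x - X))) X \<le> (\<lambda>x. w x * exp (- \<beta> * (x - X))) x"
  proof (rule DERIV_nonneg_imp_nondecreasing[OF x])
    fix t assume t: "X \<le> t" "t \<le> x"
    have "((\<lambda>x. w x * exp (- \<beta> * (x - X))) has_real_derivative
        (w1 t - \<beta> * w t) * exp (- \<beta> * (t - X))) (at t)"
      by (auto intro!: derivative_eq_intros w simp: algebra_simps) (use X t in simp)
    moreover have "w1 t - \<beta> * w t \<ge> 0"
      using b[OF t(1)] pos[of t] X t by (simp add: logd_def field_simps)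
    ultimately show "\<exists>y. ((\<lambda>x. w x * exp (- \<beta> * (x - X))) has_real_derivative y) (at t) \<and> 0 \<le> y"
      by (auto intro: exI[of _ "(w1 t - \<beta> * w t) * exp (- \<beta> * (t - X))"])
  qed
  hence "w X * exp (\<beta> * (x - X)) \<le> w x * exp (- \<beta> * (x - X)) * exp (\<beta> * (x - X))"
    by (intro mult_right_mono) auto
  also have "\<dots> = w x" by (simp add: mult.assoc exp_add[symmetric])
  finally show ?thesis .
qed

lemma exp_upper_of_logd_le:
  assumes X: "X \<ge> x0" and b: "\<And>x. x \<ge> X \<Longrightarrow> logd x \<le> \<beta>" and x: "x \<ge> X"
  shows "w x \<le> w X * exp (\<beta> * (x - X))"
proof -
  have "(\<lambda>x. w x * exp (- \<beta> * (x - X))) X \<ge> (\<lambda>x. w x * exp (- \<beta> * (x - X))) x"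
  proof (rule DERIV_nonpos_imp_nonincreasing[OF x])
    fix t assume t: "X \<le> t" "t \<le> x"
    have "((\<lambda>x. w x * exp (- \<beta> * (x - X))) has_real_derivative
        (w1 t - \<beta> * w t) * exp (- \<beta> * (t - X))) (at t)"
      by (auto intro!: derivative_eq_intros w simp: algebra_simps) (use X t in simp)
    moreover have "w1 t - \<beta> * w t \<le> 0"
      using b[OF t(1)] pos[of t] X t by (simp add: logd_def field_simps)
    hence "(w1 t - \<beta> * w t) * exp (- \<beta> * (t - X)) \<le> 0" by (simp add: mult_le_0_iff)
    ultimately show "\<exists>y. ((\<lambda>x. w x * exp (- \<beta> * (x - X))) has_real_derivative y) (at t) \<and> y \<le> 0"
      by blast
  qed
  hence "w x * exp (- \<beta> * (x - X)) * exp (\<beta> * (x - X)) \<le> w X * exp (\<beta> * (x - X))"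
    by (intro mult_right_mono) auto
  also have "w x * exp (- \<beta> * (x - X)) * exp (\<beta> * (x - X)) = w x" by (simp add: mult.assoc exp_add[symmetric])
  finally show ?thesis .
qed

lemma eventually_nonneg: "\<forall>\<^sub>F x in at_top. 0 \<le> w x"
  using eventually_ge_at_top[of x0] by eventually_elim (simp add: pos less_imp_le)

text \<open>
  If the logarithmic derivative stayed below \<open>- m + n / 4\<close>, then \<open>w\<close> would decay like
  \<open>exp (- (m - n / 4) x)\<close>, faster than its lower bound \<open>exp (- (m - n / 2) x)\<close>. So it is above this
  level at some late time, and it remains there because the Riccati field has the value
  \<open>3 n\<^sup>2 / 16 > 0\<close> at this level. From then on its distance to \<open>n - m\<close> is damped at least at the rate
  \<open>n / 4\<close>.
\<close>

lemma logd_tendsto: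
  assumes w0: "(w \<longlongrightarrow> 0) at_top"
  shows "(logd \<longlongrightarrow> n - m) at_top"
proof -
  define e where "e = (\<lambda>x. e1 x * logd x + e2 x - w x powr (p - 1))"
  have n: "n > 0" using m by auto
  have e: "(e \<longlongrightarrow> 0) at_top"
  proof -
    have "((\<lambda>x. C * \<bar>e1 x\<bar>) \<longlongrightarrow> C * 0) at_top" by (intro tendsto_intros tendsto_rabs_zero e1_tendsto)
    hence "((\<lambda>x. e1 x * logd x) \<longlongrightarrow> 0) at_top"
    proof (rule Lim_null_comparison[rotated, OF tendsto_eq_rhs])
      show "\<forall>\<^sub>F x in at_top. norm (e1 x * logd x) \<le> C * \<bar>e1 x\<bar>"
        using eventually_ge_at_top[of x0]
      proof eventually_elim
        case (elim x)
        have "\<bar>e1 x\<bar> * \<bar>logd x\<bar> \<le> \<bar>e1 x\<bar> * C" using logd_bd[OF elim] by (intro mult_left_mono) auto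
        thus ?case by (simp add: abs_mult mult.commute)
      qed
    qed simp
    moreover have P: "((\<lambda>x. w x powr (p - 1)) \<longlongrightarrow> 0 powr (p - 1)) at_top"
      using p eventually_nonneg by (intro tendsto_powr'[OF w0 tendsto_const]) auto
    ultimately have "(e \<longlongrightarrow> 0 + 0 - 0 powr (p - 1)) at_top"
      unfolding e_def by (intro tendsto_diff tendsto_add e2_tendsto)
    thus ?thesis by simp
  qed
  define \<beta> where "\<beta> = - m + n / 4"
  have "3 * n\<^sup>2 / 16 > 0" using n by simp
  from tendstoD[OF e this] have "\<forall>\<^sub>F x in at_top. x \<ge> x0 \<and> \<bar>e x\<bar> < 3 * n\<^sup>2 / 16"
    using eventually_ge_at_top[of x0] by eventually_elim (auto simp: dist_real_def)
  then obtain X where X: "\<And>x. x \<ge> X \<Longrightarrow> x \<ge> x0 \<and> \<bar>e x\<bar> < 3 * n\<^sup>2 / 16"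
    by (auto simp: eventually_at_top_linorder)
  have "\<exists>x1\<ge>X. logd x1 > \<beta>"
  proof (rule ccontr)
    assume "\<not> ?thesis"
    hence le: "\<And>x. x \<ge> X \<Longrightarrow> logd x \<le> \<beta>" by (meson not_le)
    define c2 where "c2 = w X * exp (- \<beta> * X)"
    have bd: "c0 * exp (n / 4 * x) \<le> c2" if x: "x \<ge> X" for x
    proof -
      have "c0 * exp (- (m - n / 2) * x) \<le> w X * exp (\<beta> * (x - X))"
        using exp_upper_of_logd_le[OF _ le x] w_ge[of x] X[of X] X[of x] x by auto
      hence "c0 * exp (- (m - n / 2) * x) * exp (- \<beta> * x) \<le> w X * exp (\<beta> * (x - X)) * exp (- \<beta> * x)"
        by (intro mult_right_mono) auto
      moreover have "exp (- (m - n / 2) * x) * exp (- \<beta> * x) = exp (n / 4 * x)"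
        unfolding exp_add[symmetric] by (simp add: \<beta>_def field_simps)
      moreover have "exp (\<beta> * (x - X)) * exp (- \<beta> * x) = exp (- \<beta> * X)"
        unfolding exp_add[symmetric] by (simp add: algebra_simps)
      ultimately show ?thesis by (simp only: mult.assoc c2_def)
    qed
    have "filterlim (\<lambda>x. c0 * exp (n / 4 * x)) at_top at_top"
      using c0 n by real_asymp
    hence "\<forall>\<^sub>F x in at_top. c0 * exp (n / 4 * x) > c2" by (simp add: filterlim_at_top_dense)
    hence "\<forall>\<^sub>F x::real in at_top. False"
      using eventually_ge_at_top[of X]
    proof eventually_elim
      case (elim x)
      thus ?case using bd[of x] by linarith
    qed
    thus False by simp
  qed
  then obtain x1 where x1: "x1 \<ge> X" "logd x1 > \<beta>" by blast
  have stay: "logd x > \<beta>" if "x \<ge> x1" for x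
  proof (rule derivative_barrier[where y = logd and x = x and \<beta> = \<beta> and y' = "\<lambda>x. - (logd x + m) * (logd x - (n - m)) + e x" and ?x1.0 = x1])
    fix x assume x: "x1 \<le> x"
    show "(logd has_real_derivative - (logd x + m) * (logd x - (n - m)) + e x) (at x)"
      using logd_has_derivative[of x] X[of x] x x1 by (simp add: e_def)
    assume eq: "logd x = \<beta>"
    have "- (logd x + m) * (logd x - (n - m)) = 3 * n\<^sup>2 / 16"
      unfolding eq by (simp add: \<beta>_def power2_eq_square field_simps)
    thus "0 < - (logd x + m) * (logd x - (n - m)) + e x" using X[of x] x x1 by auto
  qed (use that x1 in auto)
  have "((\<lambda>x. logd x - (n - m)) \<longlongrightarrow> 0) at_top"
  proof (rule damped_linear_tendsto_0[OF _ _ _ e])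
    fix x assume x: "x1 \<le> x"
    show "((\<lambda>x. logd x - (n - m)) has_real_derivative - (logd x + m) * (logd x - (n - m)) + e x) (at x)"
      using logd_has_derivative[of x] X[of x] x x1
      by (auto simp: e_def intro!: derivative_eq_intros)
    show "n / 4 \<le> logd x + m" using stay[OF x] by (simp add: \<beta>_def)
  qed (use n in simp)
  thus ?thesis by (rule LIM_zero_cancel)
qed

text \<open>
  A trajectory with limit \<open>0\<close> would have a logarithmic derivative with limit \<open>n - m > 0\<close>, hence would
  increase eventually.
\<close>

theorem tendsto_equilibrium:
  assumes "m < n"
  shows "(w \<longlongrightarrow> (m * (n - m)) powr (1 / (p - 1))) at_top"
proof -
  have "\<not> (w \<longlongrightarrow> 0) at_top"
  proof
    assume w0: "(w \<longlongrightarrow> 0) at_top"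
    have "\<forall>\<^sub>F x in at_top. logd x > 0"
      using order_tendstoD(1)[OF logd_tendsto[OF w0], of 0] assms by simp
    hence "\<forall>\<^sub>F x in at_top. logd x \<ge> 0 \<and> x \<ge> x0"
      using eventually_ge_at_top[of x0] by eventually_elim auto
    then obtain X where X: "\<And>x. x \<ge> X \<Longrightarrow> logd x \<ge> 0 \<and> x \<ge> x0"
      by (auto simp: eventually_at_top_linorder)
    have "\<forall>\<^sub>F x in at_top. w x \<ge> w X"
      using eventually_ge_at_top[of X]
      by eventually_elim (use exp_lower_of_logd_ge[of X 0] X in auto)
    hence "0 \<ge> w X" using tendsto_lowerbound[OF w0] by simp
    thus False using pos[of X] X[of X] by simp
  qed
  thus ?thesis using w_dichotomy by (simp add: \<Lambda>_def)
qed

text \<open>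
  For \<open>m = n\<close> the equilibrium \<open>0\<close> is degenerate: \<open>w\<close> drifts to \<open>0\<close> along the slow curve on which
  friction balances the force, \<open>n w1 = - w powr p\<close>. Indeed \<open>\<theta> = w1 / w powr p\<close> solves a damped
  linear equation with forcing \<open>- 1 + o(1)\<close>, so \<open>\<theta>\<close> tends to \<open>- 1 / n\<close>. As
  \<open>(w powr (- (p - 1)))' = - (p - 1) \<theta>\<close>, l'Hospital's rule yields the growth of
  \<open>w powr (- (p - 1))\<close>.
\<close>

theorem log_decay:
  assumes "m = n"
  shows "((\<lambda>x. w x * x powr (1 / (p - 1))) \<longlongrightarrow> (n / (p - 1)) powr (1 / (p - 1))) at_top"
proof -
  have n: "n > 0" using m by auto
  have dn: "d = n" "\<Lambda> = 0" unfolding d_def \<Lambda>_def using assms by simp_all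
  have w0: "(w \<longlongrightarrow> 0) at_top" using w_dichotomy dn(2) by simp
  have l0: "(logd \<longlongrightarrow> 0) at_top" using logd_tendsto[OF w0] assms by simp
  define \<theta> where "\<theta> = (\<lambda>x. w1 x / w x powr p)"
  define \<rho> where "\<rho> = (\<lambda>x. e2 x * w x powr (- (p - 1)))"
  \<comment> \<open>Since the logarithmic derivative tends to \<open>0\<close>, \<open>w powr (- (p - 1))\<close> grows at most like \<open>exp x\<close>,
    which the factor \<open>exp (- 2 x)\<close> in \<open>e2\<close> outweighs.\<close>
  have rho: "(\<rho> \<longlongrightarrow> 0) at_top"
  proof -
    have "\<forall>\<^sub>F x in at_top. logd x > - 1 / (p - 1)"
      using order_tendstoD(1)[OF l0, of "- 1 / (p - 1)"] p by simp
    hence "\<forall>\<^sub>F x in at_top. logd x \<ge> - 1 / (p - 1) \<and> x \<ge> x0"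
      using eventually_ge_at_top[of x0] by eventually_elim auto
    then obtain X where X: "\<And>x. x \<ge> X \<Longrightarrow> logd x \<ge> - 1 / (p - 1) \<and> x \<ge> x0"
      by (auto simp: eventually_at_top_linorder)
    define K where "K = w X powr (- (p - 1)) * exp (- X)"
    have K: "\<bar>\<rho> x\<bar> \<le> (C * K) * exp (- x)" if x: "x \<ge> X" for x
    proof -
      have "w x \<ge> w X * exp (- 1 / (p - 1) * (x - X))"
        by (rule exp_lower_of_logd_ge) (use X x in auto)
      moreover have "w X * exp (- 1 / (p - 1) * (x - X)) > 0" using pos[of X] X[of X] by simp
      ultimately have "w x powr (- (p - 1)) \<le> (w X * exp (- 1 / (p - 1) * (x - X))) powr (- (p - 1))"
        using p by (intro powr_mono2') auto
      also have "\<dots> = w X powr (- (p - 1)) * exp (- 1 / (p - 1) * (x - X) * (- (p - 1)))"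
        using pos[of X] X[of X] by (simp add: powr_mult exp_powr_real)
      also have "- 1 / (p - 1) * (x - X) * (- (p - 1)) = x - X" using p by (simp add: field_simps)
      also have "w X powr (- (p - 1)) * exp (x - X) = K * exp x" by (simp add: K_def exp_diff exp_minus field_simps)
      finally have 1: "w x powr (- (p - 1)) \<le> K * exp x" .
      have "\<bar>\<rho> x\<bar> \<le> (C * exp (- 2 * x)) * (K * exp x)"
        unfolding \<rho>_def abs_mult using e2_le[of x] 1 X[OF x] C_pos by (intro mult_mono) auto
      also have "\<dots> = (C * K) * (exp (- 2 * x) * exp x)" by (simp only: mult_ac)
      also have "exp (- 2 * x) * exp x = exp (- x)" by (simp add: exp_add[symmetric])
      finally show ?thesis .
    qed
    have "((\<lambda>x::real. exp (- x)) \<longlongrightarrow> 0) at_top" by real_asymp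
    from tendsto_mult_left[OF this, of "C * K"]
    have lim: "((\<lambda>x. (C * K) * exp (- x)) \<longlongrightarrow> 0) at_top" by simp
    have "\<forall>\<^sub>F x in at_top. norm (\<rho> x) \<le> (C * K) * exp (- x)"
      using eventually_ge_at_top[of X] by eventually_elim (use K in simp)
    thus ?thesis by (rule Lim_null_comparison[OF _ lim])
  qed
  have th': "(\<theta> has_real_derivative (- (n - e1 x + p * logd x) * \<theta> x - 1 + \<rho> x)) (at x)" if x: "x \<ge> x0" for x
  proof -
    let ?w2 = "- (d - e1 x) * w1 x + (\<Lambda> + e2 x) * w x - w x powr p"
    have P: "((\<lambda>x. w x powr (- p)) has_real_derivative - p * w x powr (- p - 1) * w1 x) (at x)"
      by (rule DERIV_chain2[OF has_real_derivative_powr[OF pos[OF x], of "- p"] w[OF x]])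
    have "((\<lambda>x. w1 x * w x powr (- p)) has_real_derivative
       (- p * w x powr (- p - 1) * w1 x) * w1 x + ?w2 * w x powr (- p)) (at x)"
      using DERIV_mult'[OF w1'[OF x] P] by (simp add: algebra_simps)
    moreover have "(\<lambda>x. w1 x * w x powr (- p)) = \<theta>"
      by (auto simp: \<theta>_def powr_minus field_simps)
    moreover have "(- p * w x powr (- p - 1) * w1 x) * w1 x + ?w2 * w x powr (- p)
       = - (n - e1 x + p * logd x) * \<theta> x - 1 + \<rho> x"
    proof -
      have "w x powr (- p - 1) = w x powr (- p) / w x" "w x powr (- (p - 1)) = w x powr (- p) * w x"
           "\<theta> x = w1 x * w x powr (- p)" "w x powr p * w x powr (- p) = 1"
        using pos[OF x] powr_add[of "w x" "-p" 1]
        by (simp_all add: powr_diff \<theta>_def powr_minus field_simps)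
      thus ?thesis using pos[OF x] by (simp add: logd_def \<rho>_def dn field_simps)
    qed
    ultimately show ?thesis by simp
  qed
  define e where "e = (\<lambda>x. (- e1 x + p * logd x) / n + \<rho> x)"
  have e: "(e \<longlongrightarrow> 0) at_top"
  proof -
    have "(e \<longlongrightarrow> (- 0 + p * 0) / n + 0) at_top"
      unfolding e_def using n by (intro tendsto_intros e1_tendsto l0 rho) auto
    thus ?thesis by simp
  qed
  have "((\<lambda>x. n - e1 x + p * logd x) \<longlongrightarrow> n - 0 + p * 0) at_top"
    by (intro tendsto_intros e1_tendsto l0)
  from order_tendstoD(1)[OF this, of "n / 2"] n
  have "\<forall>\<^sub>F x in at_top. x \<ge> x0 \<and> n - e1 x + p * logd x \<ge> n / 2"
    using eventually_ge_at_top[of x0] by (auto elim!: eventually_elim2)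
  then obtain X where X: "\<And>x. x \<ge> X \<Longrightarrow> x \<ge> x0 \<and> n - e1 x + p * logd x \<ge> n / 2"
    by (auto simp: eventually_at_top_linorder)
  have "((\<lambda>x. \<theta> x + 1 / n) \<longlongrightarrow> 0) at_top"
  proof (rule damped_linear_tendsto_0[OF _ _ _ e])
    fix x assume x: "X \<le> x"
    show "((\<lambda>x. \<theta> x + 1 / n) has_real_derivative - (n - e1 x + p * logd x) * (\<theta> x + 1 / n) + e x) (at x)"
      using th'[of x] X[OF x] n
      by (auto intro!: derivative_eq_intros simp: e_def field_simps)
    show "n / 2 \<le> n - e1 x + p * logd x" using X[OF x] by simp
  qed (use n in simp)
  from tendsto_diff[OF this tendsto_const[of "1 / n"]]
  have th: "(\<theta> \<longlongrightarrow> - 1 / n) at_top" by simp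
  define g where "g = (\<lambda>x. w x powr (- (p - 1)))"
  have "((\<lambda>x. g x / x) \<longlongrightarrow> (p - 1) / n) at_top"
  proof (rule lhospital_at_top_at_top[where f' = "\<lambda>x. - (p - 1) * \<theta> x" and g' = "\<lambda>_. 1"])
    show "\<forall>\<^sub>F x in at_top. (g has_real_derivative - (p - 1) * \<theta> x) (at x)"
      using eventually_ge_at_top[of x0]
    proof eventually_elim
      case (elim x)
      have "w x powr (- (p - 1) - 1) = w x powr (- p)" by simp
      thus ?case
        using DERIV_chain2[OF has_real_derivative_powr[OF pos[OF elim], of "- (p - 1)"] w[OF elim]]
        by (simp add: g_def \<theta>_def powr_minus field_simps)
    qed
    have "((\<lambda>x. - (p - 1) * \<theta> x / 1) \<longlongrightarrow> - (p - 1) * (- 1 / n) / 1) at_top"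
      by (intro tendsto_intros th) auto
    moreover have "- (p - 1) * (- 1 / n) / 1 = (p - 1) / n" using n by (simp add: field_simps)
    ultimately show "((\<lambda>x. - (p - 1) * \<theta> x / 1) \<longlongrightarrow> (p - 1) / n) at_top" by (simp only:)
  qed (auto intro: filterlim_ident)
  from tendsto_powr[OF this tendsto_const, of "- 1 / (p - 1)"] p n
  have "((\<lambda>x. (g x / x) powr (- 1 / (p - 1))) \<longlongrightarrow> ((p - 1) / n) powr (- 1 / (p - 1))) at_top" by simp
  moreover have "\<forall>\<^sub>F x in at_top. (g x / x) powr (- 1 / (p - 1)) = w x * x powr (1 / (p - 1))"
    using eventually_ge_at_top[of x0] eventually_gt_at_top[of 0]
  proof eventually_elim
    case (elim x)
    have "(g x / x) powr (- 1 / (p - 1)) = (w x powr (- (p - 1))) powr (- 1 / (p - 1)) / x powr (- 1 / (p - 1))"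
      by (simp add: g_def powr_divide)
    also have "(w x powr (- (p - 1))) powr (- 1 / (p - 1)) = w x"
    proof -
      have "- (p - 1) * (- 1 / (p - 1)) = 1" using p by (simp add: field_simps)
      thus ?thesis using pos[OF elim(1)] unfolding powr_powr by simp
    qed
    also have "w x / x powr (- 1 / (p - 1)) = w x * x powr (1 / (p - 1))"
      using elim by (simp add: powr_minus field_simps)
    finally show ?case .
  qed
  ultimately have "((\<lambda>x. w x * x powr (1 / (p - 1))) \<longlongrightarrow> ((p - 1) / n) powr (- 1 / (p - 1))) at_top"
    by (rule Lim_transform_eventually)
  moreover have "((p - 1) / n) powr (- 1 / (p - 1)) = (n / (p - 1)) powr (1 / (p - 1))"
    using p n by (simp add: powr_minus powr_divide field_simps)
  ultimately show ?thesis by simp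
qed

end

section \<open>Solutions with prescribed fast decay\<close>

lemma powr_lipschitz:
  fixes x y K p :: real
  assumes "0 \<le> x" "x \<le> K" "0 \<le> y" "y \<le> K" "p > 1"
  shows "\<bar>x powr p - y powr p\<bar> \<le> p * K powr (p - 1) * \<bar>x - y\<bar>"
proof -
  have *: "b powr p - a powr p \<le> p * K powr (p - 1) * (b - a)" if ab: "0 \<le> a" "a < b" "b \<le> K" for a b :: real
  proof -
    have "continuous_on {a..b} (\<lambda>x. x powr p)"
      using ab assms by (intro continuous_on_powr') (auto intro!: continuous_intros)
    moreover have "((\<lambda>x. x powr p) has_derivative (*) (p * z powr (p - 1))) (at z)" if "a < z" for z
      using has_real_derivative_powr[of z p] that ab by (simp add: has_field_derivative_def)
    ultimately obtain z where z: "a < z" "z < b" "b powr p - a powr p = p * z powr (p - 1) * (b - a)"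
      using mvt[OF ab(2), of "\<lambda>x. x powr p" "\<lambda>z. (*) (p * z powr (p - 1))"] by blast
    have "p * z powr (p - 1) \<le> p * K powr (p - 1)"
      using z ab assms by (intro mult_left_mono powr_mono2) auto
    thus ?thesis using z(3) ab mult_left_mono[of "p * z powr (p - 1)" "p * K powr (p - 1)" "b - a"]
      by (simp add: mult.commute)
  qed
  have mono: "a powr p \<le> b powr p" if "0 \<le> a" "a \<le> b" for a b :: real
    using that assms by (intro powr_mono2) auto
  show ?thesis
  proof (cases x y rule: linorder_cases)
    case less
    thus ?thesis using *[of x y] mono[of x y] assms by auto
  next
    case greater
    thus ?thesis using *[of y x] mono[of y x] assms by auto
  qed auto
qed

lemma continuous_on_compact_bounded_above:
  fixes f :: "real \<Rightarrow> real"
  assumes "continuous_on {a..b} f"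
  shows "\<exists>K>0. \<forall>x\<in>{a..b}. \<bar>f x\<bar> \<le> K"
proof -
  have "bounded (f ` {a..b})" by (intro compact_imp_bounded compact_continuous_image assms) auto
  thus ?thesis unfolding bounded_pos by auto
qed

text \<open>
  Here \<open>k = N - 1\<close> and \<open>\<sigma>\<^sup>2 = k\<^sup>2 / 4 - \<lambda>\<close>. The substitution
  \<open>u = sinh r powr (- k / 2) * exp (- \<sigma> r) * \<Phi> r\<close> turns the radial equation into
  \<open>\<Phi>'' = 2 \<sigma> \<Phi>' + pot \<Phi> - coef \<Phi>\<^sup>p\<close>, and fast decay of \<open>u\<close> into convergence of \<open>\<Phi>\<close> to a positive
  limit \<open>\<alpha>\<close>. The last assumption, a consequence of \<open>p \<ge> N / (N - 2)\<close>, makes \<open>coef\<close> non-integrable at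
  \<open>0\<close> and of order at most \<open>exp (- q r)\<close> with \<open>q > 1\<close> at infinity.
\<close>

locale hyperbolic_emden =
  fixes k \<sigma> p :: real
  assumes k: "k \<ge> 2" and \<sigma>: "\<sigma> \<ge> 0" and p: "p > 1" and q_gt: "k * (p - 1) / 2 > 1"
begin

definition "q = k * (p - 1) / 2"
definition "\<omega> = k * (k - 2) / 4"
definition "pot r = \<omega> / (sinh r)\<^sup>2"
definition "coef r = sinh r powr (- q) * exp (- ((p - 1) * \<sigma> * r))"

text \<open>
  The variable \<open>s = exp (- r / 2)\<close> moves infinity to the regular singular point \<open>s = 0\<close>. The two
  coefficients, multiplied by the factor \<open>4 / s\<^sup>2\<close> that comes from the second derivative, stay
  continuous at \<open>s = 0\<close>: \<open>pot\<close> is of order \<open>s\<^sup>4\<close>, and \<open>coef\<close> of order at most \<open>s powr (2 q)\<close> with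
  \<open>q > 1\<close>. The exponent \<open>J\<close> makes \<open>\<alpha> / (1 - s) ^ J\<close> a supersolution of the linear equation, because
  its second derivative produces the factor \<open>J (J + 1) \<ge> 16 \<omega>\<close>.
\<close>

definition "compact_pot s = 16 * \<omega> * s\<^sup>2 / (1 - s ^ 4)\<^sup>2"
definition "compact_coef s = 4 * (2 / (1 - s ^ 4)) powr q * s powr (2 * q + 2 * (p - 1) * \<sigma> - 2)"
definition "J = nat \<lceil>16 * \<omega>\<rceil>"

lemma q_gt_1: "q > 1" using q_gt by (simp add: q_def)
lemma \<omega>_nonneg: "\<omega> \<ge> 0" using k by (simp add: \<omega>_def)
lemma J_bound: "real J * (real J + 1) \<ge> 16 * \<omega>"
proof -
  have "real J \<ge> 16 * \<omega>" unfolding J_def using \<omega>_nonneg by linarith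
  moreover have "real J * real J \<ge> 0" by simp
  ultimately show ?thesis unfolding distrib_left mult_1_right by linarith
qed

lemma power4_bounds:
  fixes s :: real
  assumes "s \<in> {0..<1}" shows "s ^ 4 < 1" "1 - s ^ 4 \<ge> 1 - s" "1 - s ^ 4 > 0"
proof -
  have "s ^ 4 \<le> s ^ 1" using assms by (intro power_decreasing) auto
  thus "s ^ 4 < 1" "1 - s ^ 4 \<ge> 1 - s" "1 - s ^ 4 > 0" using assms by auto
qed

lemma compact_pot_continuous: "continuous_on {0..<1} compact_pot"
proof -
  have "1 - s ^ 4 \<noteq> 0" if "s \<in> {0..<1}" for s :: real using power4_bounds(3)[OF that] by linarith
  thus ?thesis unfolding compact_pot_def[abs_def] by (intro continuous_intros) auto
qed

lemma compact_coef_continuous: "continuous_on {0..<1} compact_coef"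
proof -
  have "1 - s ^ 4 \<noteq> 0" "1 - s ^ 4 > 0" if "s \<in> {0..<1}" for s :: real
    using power4_bounds(3)[OF that] by auto
  hence A: "continuous_on {0..<1} (\<lambda>s::real. 4 * (2 / (1 - s ^ 4)) powr q)"
    by (intro continuous_on_mult continuous_on_powr continuous_on_divide continuous_intros) force+
  have "2 * (p - 1) * \<sigma> \<ge> 0" using p \<sigma> by simp
  hence "2 * q + 2 * (p - 1) * \<sigma> - 2 > 0" using q_gt_1 by linarith
  hence B: "continuous_on {0..<1} (\<lambda>s::real. s powr (2 * q + 2 * (p - 1) * \<sigma> - 2))"
    by (intro continuous_on_powr') (auto intro!: continuous_intros)
  show ?thesis unfolding compact_coef_def[abs_def] by (intro continuous_on_mult A B)
qed

lemma compact_pot_nonneg: "compact_pot s \<ge> 0" and compact_coef_nonneg: "compact_coef s \<ge> 0"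
  using \<omega>_nonneg by (auto simp: compact_pot_def compact_coef_def)

lemma pot_eq:
  fixes r :: real
  assumes "r > 0"
  defines "s \<equiv> exp (- r / 2)"
  shows "s\<^sup>2 / 4 * compact_pot s = pot r" "s\<^sup>2 / 4 * compact_coef s = coef r"
proof -
  have s: "s \<in> {0..<1}" "s > 0" using assms by auto
  have s2: "s\<^sup>2 = exp (- r)" and s4e: "s ^ 4 = exp (- r) * exp (- r)"
    by (simp_all add: s_def exp_of_nat_mult[symmetric] exp_add[symmetric])
  have sinh: "sinh r = (1 - s ^ 4) / (2 * s\<^sup>2)"
    unfolding s2 s4e sinh_field_def by (simp add: exp_minus field_simps)
  have pos: "1 - s ^ 4 > 0" using power4_bounds[OF s(1)] by simp
  show "s\<^sup>2 / 4 * compact_pot s = pot r"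
    unfolding compact_pot_def pot_def sinh using s(2) pos by (simp add: field_simps power2_eq_square)
  have "sinh r powr (- q) = (2 * s\<^sup>2 / (1 - s ^ 4)) powr q"
    unfolding sinh using s(2) pos by (simp add: powr_minus powr_divide powr_mult field_simps)
  also have "\<dots> = (2 / (1 - s ^ 4)) powr q * s powr (2 * q)"
  proof -
    have "s\<^sup>2 powr q = (s powr 2) powr q" using s(2) by (simp add: powr_numeral)
    also have "\<dots> = s powr (2 * q)" by (rule powr_powr)
    finally have "s\<^sup>2 powr q = s powr (2 * q)" .
    thus ?thesis using s(2) pos by (simp add: powr_mult powr_divide)
  qed
  finally have 1: "sinh r powr (- q) = (2 / (1 - s ^ 4)) powr q * s powr (2 * q)" .
  have 2: "exp (- ((p - 1) * \<sigma> * r)) = s powr (2 * (p - 1) * \<sigma>)"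
    by (simp add: s_def exp_powr_real mult_ac)
  have "s powr (2 * q + 2 * (p - 1) * \<sigma> - 2) * s\<^sup>2 = s powr (2 * q) * s powr (2 * (p - 1) * \<sigma>)"
    using s(2) by (simp add: powr_diff powr_add)
  thus "s\<^sup>2 / 4 * compact_coef s = coef r"
    unfolding compact_coef_def coef_def 1 2 by (simp add: mult_ac)
qed

definition majorant :: "real \<Rightarrow> real" where "majorant r = 1 / (1 - exp (- r / 2)) ^ J"

text \<open>
  The nonlinearity is cut off at \<open>0\<close>, so that a solution on all of \<open>{0<..}\<close> exists before its
  positivity is known. In the last clause \<open>\<Phi>\<close> falls below its limit only by a term of higher order
  in \<open>\<alpha>\<close>: the potential is repulsive, and only the nonlinearity pulls the solution down.
\<close>

definition "fast_decay D \<alpha> \<Phi> \<Phi>' \<longleftrightarrow>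
     (\<forall>r>0. (\<Phi> has_real_derivative \<Phi>' r) (at r)) \<and>
     (\<forall>r>0. (\<Phi>' has_real_derivative
        (2 * \<sigma> * \<Phi>' r + pot r * max (\<Phi> r) 0 - coef r * max (\<Phi> r) 0 powr p)) (at r)) \<and>
     (\<forall>r>0. \<Phi> r \<le> \<alpha> * majorant r) \<and>
     (\<Phi> \<longlongrightarrow> \<alpha>) at_top \<and>
     (\<exists>B. \<forall>r\<ge>1. \<bar>\<Phi>' r\<bar> \<le> B * exp (- r)) \<and>
     (\<forall>r0>0. \<forall>r\<ge>r0. \<Phi> r \<ge> \<alpha> - D r0 * \<alpha> powr p)"

text \<open>
  The Volterra lemma in the variable \<open>s = exp (- r / 2)\<close>; \<open>c = 1 + 4 \<sigma>\<close> is the coefficient that the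
  chain rule produces from \<open>\<Phi>'' - 2 \<sigma> \<Phi>'\<close>. The function \<open>D\<close> serves all \<open>\<alpha>\<close> at once: \<open>D r0\<close> bounds
  \<open>compact_coef\<close> times the \<open>p\<close>-th power of the supersolution with \<open>\<alpha> = 1\<close> on the interval that
  corresponds to \<open>{r0..}\<close>.
\<close>

lemma fast_decay_family:
  "\<exists>D. \<forall>\<alpha>>0. \<exists>\<Phi> \<Phi>'. fast_decay D \<alpha> \<Phi> \<Phi>'"
proof -
  have "\<exists>K>0. \<forall>s\<in>{0..X}. \<bar>compact_coef s * (1 / (1 - s) ^ J) powr p\<bar> \<le> K" if "X < 1" for X
  proof (rule continuous_on_compact_bounded_above)
    have "continuous_on {0..X} compact_coef" by (rule continuous_on_subset[OF compact_coef_continuous]) (use that in auto)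
    thus "continuous_on {0..X} (\<lambda>s. compact_coef s * (1 / (1 - s) ^ J) powr p)"
      using that by (intro continuous_intros) auto
  qed
  hence "\<forall>r0\<in>{0<..}. \<exists>K>0. \<forall>s\<in>{0..exp (- r0 / 2)}. \<bar>compact_coef s * (1 / (1 - s) ^ J) powr p\<bar> \<le> K" by simp
  then obtain D where D: "\<And>r0. r0 > 0 \<Longrightarrow> D r0 > 0"
    "\<And>r0 s. r0 > 0 \<Longrightarrow> s \<in> {0..exp (- r0 / 2)} \<Longrightarrow> \<bar>compact_coef s * (1 / (1 - s) ^ J) powr p\<bar> \<le> D r0"
    unfolding bchoice_iff greaterThan_iff Ball_def by metis
  show ?thesis
  proof (rule exI[of _ D], intro allI impI)
    fix \<alpha> :: real assume \<alpha>: "\<alpha> > 0"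
    define b where "b = (\<lambda>s x. compact_pot s * max x 0 - compact_coef s * max x 0 powr p)"
    define c where "c = 1 + 4 * \<sigma>"
    define M where "M = (\<lambda>s::real. \<alpha> / (1 - s) ^ J)"
    define M' where "M' = (\<lambda>s::real. \<alpha> * J / (1 - s) ^ (J + 1))"
    define M'' where "M'' = (\<lambda>s::real. \<alpha> * real J * (real J + 1) / (1 - s) ^ (J + 2))"
    have c: "c > 0" using \<sigma> by (simp add: c_def)
    have Mpos: "M s > 0" if "s \<in> {0..<1}" for s using that \<alpha> by (simp add: M_def)
    have contb: "continuous_on ({0..<1} \<times> UNIV) (\<lambda>(s, x). b s x)"
    proof -
      have A: "continuous_on ({0..<1} \<times> (UNIV :: real set)) (\<lambda>z. compact_pot (fst z))"
        by (rule continuous_on_compose2[OF compact_pot_continuous]) (auto intro!: continuous_intros)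
      have B: "continuous_on ({0..<1} \<times> (UNIV :: real set)) (\<lambda>z. compact_coef (fst z))"
        by (rule continuous_on_compose2[OF compact_coef_continuous]) (auto intro!: continuous_intros)
      have P: "continuous_on ({0..<1::real} \<times> (UNIV :: real set)) (\<lambda>z. max (snd z) 0 powr p)"
        using p by (intro continuous_on_powr') (auto intro!: continuous_intros)
      have "continuous_on ({0..<1} \<times> UNIV) (\<lambda>z. compact_pot (fst z) * max (snd z) 0 - compact_coef (fst z) * max (snd z) 0 powr p)"
        by (intro continuous_on_diff continuous_on_mult A B P continuous_on_max continuous_on_snd
              continuous_on_id continuous_on_const)
      thus ?thesis by (simp add: b_def case_prod_beta')
    qed
    have b_le: "b s x \<le> M'' s" if s: "s \<in> {0..<1}" and x: "x \<le> M s" for s x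
    proof -
      have sp: "1 - s > 0" using s by simp
      have "compact_coef s * max x 0 powr p \<ge> 0" using compact_coef_nonneg by simp
      hence "b s x \<le> compact_pot s * max x 0" unfolding b_def by simp
      also have "\<dots> \<le> compact_pot s * M s" using x Mpos[OF s] compact_pot_nonneg by (intro mult_left_mono) auto
      also have "\<dots> \<le> (real J * (real J + 1) / (1 - s)\<^sup>2) * M s"
      proof (rule mult_right_mono)
        have "s\<^sup>2 \<le> 1" using s by (simp add: power_le_one)
        hence "16 * \<omega> * s\<^sup>2 \<le> 16 * \<omega> * 1" using \<omega>_nonneg by (intro mult_left_mono) auto
        moreover have "(1 - s)\<^sup>2 \<le> (1 - s ^ 4)\<^sup>2" using power4_bounds[OF s] sp by (intro power_mono) auto
        ultimately show "compact_pot s \<le> real J * (real J + 1) / (1 - s)\<^sup>2"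
          unfolding compact_pot_def using J_bound sp \<omega>_nonneg by (intro frac_le) auto
      qed (use Mpos[OF s] in simp)
      also have "\<dots> = M'' s" using sp by (simp add: M_def M''_def power_add power2_eq_square field_simps)
      finally show ?thesis .
    qed
    have lip: "\<exists>B. \<forall>s\<in>{0..X}. \<forall>x y. x \<le> M s \<longrightarrow> y \<le> M s \<longrightarrow> \<bar>b s x - b s y\<bar> \<le> B * \<bar>x - y\<bar>"
      if X: "0 \<le> X" "X < 1" for X
    proof -
      have sub: "{0..X} \<subseteq> {0..<1}" using X by auto
      have contM: "continuous_on {0..X} M" unfolding M_def using X by (intro continuous_intros) auto
      obtain K1 where K1: "\<And>s. s \<in> {0..X} \<Longrightarrow> \<bar>compact_pot s\<bar> \<le> K1"
        using continuous_on_compact_bounded_above[OF continuous_on_subset[OF compact_pot_continuous sub]] by blast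
      obtain K2 where K2: "K2 > 0" "\<And>s. s \<in> {0..X} \<Longrightarrow> \<bar>compact_coef s\<bar> \<le> K2"
        using continuous_on_compact_bounded_above[OF continuous_on_subset[OF compact_coef_continuous sub]] by blast
      obtain K3 where K3: "\<And>s. s \<in> {0..X} \<Longrightarrow> \<bar>M s\<bar> \<le> K3"
        using continuous_on_compact_bounded_above[OF contM] by blast
      show ?thesis
      proof (intro exI[of _ "K1 + K2 * (p * K3 powr (p - 1))"] ballI allI impI)
        fix s x y assume s: "s \<in> {0..X}" and xy: "x \<le> M s" "y \<le> M s"
        have m: "\<bar>max x 0 - max y 0\<bar> \<le> \<bar>x - y\<bar>" by auto
        have K3': "M s \<le> K3" "0 < M s" using K3[OF s] Mpos[of s] s X by auto
        have "\<bar>max x 0 powr p - max y 0 powr p\<bar> \<le> p * K3 powr (p - 1) * \<bar>max x 0 - max y 0\<bar>"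
          by (rule powr_lipschitz) (use xy K3' p in auto)
        also have "\<dots> \<le> p * K3 powr (p - 1) * \<bar>x - y\<bar>" using m p by (intro mult_left_mono) auto
        finally have P: "\<bar>max x 0 powr p - max y 0 powr p\<bar> \<le> p * K3 powr (p - 1) * \<bar>x - y\<bar>" .
        have "\<bar>b s x - b s y\<bar> = \<bar>compact_pot s * (max x 0 - max y 0) - compact_coef s * (max x 0 powr p - max y 0 powr p)\<bar>"
          by (simp add: b_def algebra_simps)
        also have "\<dots> \<le> \<bar>compact_pot s\<bar> * \<bar>max x 0 - max y 0\<bar> + \<bar>compact_coef s\<bar> * \<bar>max x 0 powr p - max y 0 powr p\<bar>"
          unfolding abs_mult[symmetric] by (rule abs_triangle_ineq4)
        also have "\<dots> \<le> K1 * \<bar>x - y\<bar> + K2 * (p * K3 powr (p - 1) * \<bar>x - y\<bar>)"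
          using K1[OF s] K2(2)[OF s] m P
            order_trans[OF abs_ge_zero K1[OF s]] order_trans[OF abs_ge_zero K2(2)[OF s]]
          by (intro add_mono mult_mono) auto
        finally show "\<bar>b s x - b s y\<bar> \<le> (K1 + K2 * (p * K3 powr (p - 1))) * \<bar>x - y\<bar>"
          by (simp add: algebra_simps)
      qed
    qed
    have dM: "(M has_real_derivative M' s) (at s)" "(M' has_real_derivative M'' s) (at s)"
      if s: "s \<in> {0..<1}" for s
    proof -
      have inv: "((\<lambda>s. A / (1 - s) ^ j) has_real_derivative A * j / (1 - s) ^ (j + 1)) (at s)" for A :: real and j :: nat
      proof (cases j)
        case (Suc i)
        have y: "1 - s \<noteq> 0" using s by simp
        have pw: "((\<lambda>s. (1 - s) ^ Suc i) has_real_derivative - (real (Suc i) * (1 - s) ^ i)) (at s)"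
          by (auto intro!: derivative_eq_intros simp del: power_Suc)
        have "((\<lambda>s. A / (1 - s) ^ Suc i) has_real_derivative
            (0 * (1 - s) ^ Suc i - A * - (real (Suc i) * (1 - s) ^ i)) / ((1 - s) ^ Suc i * (1 - s) ^ Suc i)) (at s)"
          by (intro DERIV_divide DERIV_const pw) (use y in simp)
        moreover have "(0 * Y ^ Suc i - A * - (real (Suc i) * Y ^ i)) / (Y ^ Suc i * Y ^ Suc i)
            = A * real (Suc i) / Y ^ (Suc i + 1)" if "Y \<noteq> 0" for Y :: real
          using that by (simp add: divide_simps)
        ultimately show ?thesis unfolding Suc using y by metis
      qed (auto intro!: derivative_eq_intros)
      show "(M has_real_derivative M' s) (at s)" unfolding M_def M'_def by (rule inv)
      show "(M' has_real_derivative M'' s) (at s)"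
        unfolding M'_def M''_def using inv[of "\<alpha> * J" "J + 1"] by (simp add: add.commute)
    qed
    obtain \<phi> where \<phi>: "continuous_on {0..<1} \<phi>" "\<And>x. x \<in> {0..<1} \<Longrightarrow> \<phi> x \<le> M x"
      "\<And>x. x \<in> {0..<1} \<Longrightarrow> \<phi> x = \<alpha> + integral {0..x} (weighted_mean c (\<lambda>s. b s (\<phi> s)))"
    proof (rule singular_volterra_solution[OF c contb lip dM(1) dM(2) _ _ _ _ b_le, of \<alpha>])
      show "continuous_on {0..<1} M''" unfolding M''_def by (intro continuous_intros) auto
    qed (use \<alpha> in \<open>auto simp: M''_def M'_def M_def\<close>)
    define g where "g = (\<lambda>s. b s (\<phi> s))"
    define \<psi> where "\<psi> = weighted_mean c g"
    have g_cont: "continuous_on {0..<1} g"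
    proof -
      have "continuous_on {0..<1} (\<lambda>s. (\<lambda>(s, x). b s x) (s, \<phi> s))"
        by (rule continuous_on_compose2[OF contb]) (auto intro!: continuous_intros \<phi>)
      thus ?thesis by (simp add: g_def)
    qed
    have \<psi>_cont: "continuous_on {0..<1} \<psi>"
      unfolding \<psi>_def by (rule weighted_mean_continuous[OF c g_cont])
    have sub: "continuous_on {0..t} f" if "continuous_on {0..<1} f" "t < 1" for f :: "real \<Rightarrow> real" and t
      by (rule continuous_on_subset[OF that(1)]) (use that in auto)
    have \<phi>_eq: "\<phi> x = \<alpha> + integral {0..x} \<psi>" if "x \<in> {0..<1}" for x
      using \<phi>(3)[OF that] by (simp add: \<psi>_def g_def)
    have \<phi>': "(\<phi> has_real_derivative \<psi> s) (at s)" if s: "0 < s" "s < 1" for s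
    proof -
      obtain t where t: "s < t" "t < 1" using dense s by blast
      have "((\<lambda>x. integral {0..x} \<psi>) has_real_derivative \<psi> s) (at s within {0..t})"
        by (rule integral_has_real_derivative[OF sub[OF \<psi>_cont]]) (use s t in auto)
      hence "((\<lambda>x. integral {0..x} \<psi>) has_real_derivative \<psi> s) (at s)"
        using s t at_within_Icc_at[of 0 s t] by simp
      hence "((\<lambda>x. \<alpha> + integral {0..x} \<psi>) has_real_derivative \<psi> s) (at s)"
        by (auto intro!: derivative_eq_intros)
      thus ?thesis
        by (rule DERIV_cong_ev[THEN iffD1, rotated -1])
           (use s \<phi>_eq in \<open>auto intro!: eventually_mono[OF eventually_nhds_in_open[of "{0<..<1}"]]\<close>)
    qed
    have \<psi>': "(\<psi> has_real_derivative (g s - c / s * \<psi> s)) (at s)" if s: "0 < s" "s < 1" for s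
      unfolding \<psi>_def by (rule weighted_mean_deriv[OF c g_cont s])
    define \<Phi> where "\<Phi> = (\<lambda>r::real. \<phi> (exp (- r / 2)))"
    define \<Phi>' where "\<Phi>' = (\<lambda>r::real. - (exp (- r / 2) / 2) * \<psi> (exp (- r / 2)))"
    have in01: "exp (- r / 2) \<in> {0..<1}" "0 < exp (- r / 2)" "exp (- r / 2) < 1" if "r > 0" for r :: real
      using that by auto
    have dexp: "((\<lambda>r. exp (- r / 2)) has_real_derivative - (exp (- r / 2) / 2)) (at r)" for r :: real
      by (auto intro!: derivative_eq_intros)
    have 1: "(\<Phi> has_real_derivative \<Phi>' r) (at r)" if r: "r > 0" for r
      unfolding \<Phi>_def \<Phi>'_def
      using DERIV_chain2[OF \<phi>'[OF in01(2,3)[OF r]] dexp] by (simp add: mult.commute)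
    have 2: "(\<Phi>' has_real_derivative
        (2 * \<sigma> * \<Phi>' r + pot r * max (\<Phi> r) 0 - coef r * max (\<Phi> r) 0 powr p)) (at r)" if r: "r > 0" for r
    proof -
      let ?s = "exp (- r / 2)"
      have d: "((\<lambda>r. \<psi> (exp (- r / 2))) has_real_derivative (g ?s - c / ?s * \<psi> ?s) * - (?s / 2)) (at r)"
        by (rule DERIV_chain2[OF \<psi>'[OF in01(2,3)[OF r]] dexp])
      have "(\<Phi>' has_real_derivative
          (?s / 4 * \<psi> ?s + (g ?s - c / ?s * \<psi> ?s) * - (?s / 2) * - (?s / 2))) (at r)"
        unfolding \<Phi>'_def
        by (rule DERIV_mult[OF _ d]) (auto intro!: derivative_eq_intros)
      moreover have "?s / 4 * \<psi> ?s + (g ?s - c / ?s * \<psi> ?s) * - (?s / 2) * - (?s / 2)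
          = 2 * \<sigma> * \<Phi>' r + ?s\<^sup>2 / 4 * g ?s"
        by (simp add: \<Phi>'_def c_def field_simps power2_eq_square)
      moreover have "?s\<^sup>2 / 4 * g ?s = (?s\<^sup>2 / 4 * compact_pot ?s) * max (\<Phi> r) 0 - (?s\<^sup>2 / 4 * compact_coef ?s) * max (\<Phi> r) 0 powr p"
        by (simp add: g_def b_def \<Phi>_def algebra_simps)
      ultimately show ?thesis unfolding pot_eq[OF r] by (simp only: add_diff_eq)
    qed
    have 3: "\<Phi> r \<le> \<alpha> * majorant r" if r: "r > 0" for r
      using \<phi>(2)[OF in01(1)[OF r]] by (simp add: \<Phi>_def majorant_def M_def)
    have 4: "(\<Phi> \<longlongrightarrow> \<alpha>) at_top"
    proof -
      have "(\<phi> \<longlongrightarrow> \<phi> 0) (at 0 within {0..<1})" using \<phi>(1) by (auto simp: continuous_on_def)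
      moreover have "\<phi> 0 = \<alpha>" using \<phi>_eq[of 0] by simp
      moreover have "filterlim (\<lambda>r::real. exp (- r / 2)) (at 0 within {0..<1}) at_top"
      unfolding filterlim_at
      proof
        show "((\<lambda>r::real. exp (- r / 2)) \<longlongrightarrow> 0) at_top" by real_asymp
        show "\<forall>\<^sub>F r in at_top. exp (- r / 2) \<in> {0..<1} \<and> exp (- r / 2) \<noteq> (0::real)"
          using eventually_gt_at_top[of 0] by eventually_elim auto
      qed
      ultimately show ?thesis unfolding \<Phi>_def using filterlim_compose by blast
    qed
    have 5: "\<exists>B. \<forall>r\<ge>1. \<bar>\<Phi>' r\<bar> \<le> B * exp (- r)"
    proof -
      define X where "X = exp (- 1 / 2 :: real)"
      have X: "0 < X" "X < 1" by (auto simp: X_def)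
      obtain K where K: "K > 0" "\<And>s. s \<in> {0..X} \<Longrightarrow> \<bar>g s\<bar> \<le> K"
        using continuous_on_compact_bounded_above[OF sub[OF g_cont X(2)]] by blast
      show ?thesis
      proof (intro exI[of _ "K / 2"] allI impI)
        fix r :: real assume r: "r \<ge> 1"
        let ?s = "exp (- r / 2)"
        have sX: "?s \<le> X" using r by (simp add: X_def)
        have "\<bar>\<psi> ?s\<bar> \<le> K * ?s" unfolding \<psi>_def
          by (rule weighted_mean_abs_le[OF c]) (use sX X K r in \<open>auto intro!: sub[OF g_cont]\<close>)
        hence "\<bar>\<Phi>' r\<bar> \<le> ?s / 2 * (K * ?s)"
          unfolding \<Phi>'_def abs_mult by (intro mult_mono) auto
        also have "\<dots> = K / 2 * (?s * ?s)" by simp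
        also have "?s * ?s = exp (- r)" by (simp add: exp_add[symmetric])
        finally show "\<bar>\<Phi>' r\<bar> \<le> K / 2 * exp (- r)" .
      qed
    qed
    have 6: "\<Phi> r \<ge> \<alpha> - D r0 * \<alpha> powr p" if r: "r0 > 0" "r \<ge> r0" for r0 r
    proof -
      let ?s = "exp (- r / 2)"
      have sX: "?s \<le> exp (- r0 / 2)" "exp (- r0 / 2) < 1" using r by auto
      have s1: "?s < 1" "?s \<in> {0..<1}" using sX by auto
      have g_ge: "- g t \<le> D r0 * \<alpha> powr p" if t: "t \<in> {0..?s}" for t
      proof -
        have "0 \<le> t" "t \<le> ?s" using t by auto
        with sX have "0 \<le> t" "t < 1" "t \<le> exp (- r0 / 2)" by linarith+
        hence t': "t \<in> {0..<1}" "t \<in> {0..exp (- r0 / 2)}" by auto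
        have "compact_pot t * max (\<phi> t) 0 \<ge> 0" using compact_pot_nonneg by simp
        hence "- g t \<le> compact_coef t * max (\<phi> t) 0 powr p" by (simp add: g_def b_def)
        also have "\<dots> \<le> compact_coef t * M t powr p"
          using \<phi>(2)[OF t'(1)] Mpos[OF t'(1)] p compact_coef_nonneg by (intro mult_left_mono powr_mono2) auto
        also have "M t powr p = \<alpha> powr p * (1 / (1 - t) ^ J) powr p"
          using \<alpha> t'(1) powr_mult[of \<alpha> "1 / (1 - t) ^ J" p] by (simp add: M_def)
        also have "compact_coef t * (\<alpha> powr p * (1 / (1 - t) ^ J) powr p) = (compact_coef t * (1 / (1 - t) ^ J) powr p) * \<alpha> powr p"
          by simp
        also have "\<dots> \<le> D r0 * \<alpha> powr p"
          using D(2)[OF r(1) t'(2)] by (intro mult_right_mono) auto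
        finally show ?thesis .
      qed
      have Dp: "D r0 * \<alpha> powr p \<ge> 0" using D(1)[OF r(1)] by simp
      have psi_ge: "- \<psi> t \<le> D r0 * \<alpha> powr p" if t: "t \<in> {0..?s}" for t
      proof -
        have t': "0 \<le> t" "t \<le> ?s" using t by auto
        with s1 have t1: "t < 1" by linarith
        have "weighted_mean c (\<lambda>s. - g s) t \<le> D r0 * \<alpha> powr p * t"
        proof (rule weighted_mean_le[OF c t'(1) _ Dp g_ge])
          show "continuous_on {0..t} (\<lambda>s. - g s)" by (intro continuous_intros sub[OF g_cont] t1)
        qed (use t'(2) order_trans in auto)
        also have "\<dots> \<le> D r0 * \<alpha> powr p * 1" using t1 Dp by (intro mult_left_mono) auto
        finally show ?thesis by (simp add: \<psi>_def weighted_mean_uminus)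
      qed
      have "integral {0..?s} (\<lambda>t. - \<psi> t) \<le> integral {0..?s} (\<lambda>t. D r0 * \<alpha> powr p)"
        by (intro integral_le integrable_continuous_interval continuous_intros sub[OF \<psi>_cont] s1 psi_ge) auto
      also have "\<dots> = D r0 * \<alpha> powr p * ?s" by simp
      also have "\<dots> \<le> D r0 * \<alpha> powr p * 1" using s1 Dp by (intro mult_left_mono) auto
      finally show ?thesis unfolding \<Phi>_def \<phi>_eq[OF s1(2)] by simp
    qed
    show "\<exists>\<Phi> \<Phi>'. fast_decay D \<alpha> \<Phi> \<Phi>'"
      unfolding fast_decay_def using 1 2 3 4 5 6 by blast
  qed
qed

end

section \<open>The Pohozaev identity\<close>

lemma sinh_le_mult_cosh:
  fixes r :: real
  assumes "r \<ge> 0"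
  shows "sinh r \<le> r * cosh r"
proof -
  have "(\<lambda>r. r * cosh r - sinh r) 0 \<le> (\<lambda>r. r * cosh r - sinh r) r"
  proof (rule DERIV_nonneg_imp_nondecreasing[OF assms])
    fix x :: real assume x: "0 \<le> x"
    have "((\<lambda>r. r * cosh r - sinh r) has_real_derivative x * sinh x) (at x)"
      by (auto intro!: derivative_eq_intros)
    thus "\<exists>y. ((\<lambda>r. r * cosh r - sinh r) has_real_derivative y) (at x) \<and> 0 \<le> y" using x by auto
  qed
  thus ?thesis by simp
qed

lemma le_sinh:
  fixes r :: real
  assumes "r \<ge> 0"
  shows "r \<le> sinh r"
proof -
  have "(\<lambda>r. sinh r - r) 0 \<le> (\<lambda>r. sinh r - r) r"
  proof (rule DERIV_nonneg_imp_nondecreasing[OF assms])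
    fix x :: real assume x: "0 \<le> x"
    have "((\<lambda>r. sinh r - r) has_real_derivative cosh x - 1) (at x)"
      by (auto intro!: derivative_eq_intros)
    thus "\<exists>y. ((\<lambda>r. sinh r - r) has_real_derivative y) (at x) \<and> 0 \<le> y"
      using cosh_real_ge_1[of x] by auto
  qed
  thus ?thesis by simp
qed

context hyperbolic_emden begin

text \<open>
  The multiplier \<open>dilation\<close> of the Pohozaev identity is the primitive of \<open>damp\<close> that vanishes at
  \<open>0\<close>. For \<open>\<sigma> = 0\<close> it is the Euclidean multiplier \<open>r\<close>.
\<close>

definition "damp r = exp (- (2 * \<sigma> * r))"
definition "dilation r = (if \<sigma> = 0 then r else (1 - damp r) / (2 * \<sigma>))"

lemma dilation_0: "\<sigma> = 0 \<Longrightarrow> dilation r = r" and damp_0: "\<sigma> = 0 \<Longrightarrow> damp r = 1"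
  unfolding dilation_def damp_def by auto

lemma damp_has_derivative: "(damp has_real_derivative - 2 * \<sigma> * damp r) (at r)"
  unfolding damp_def[abs_def] by (auto intro!: derivative_eq_intros)

lemma dilation_has_derivative: "(dilation has_real_derivative damp r) (at r)"
proof (cases "\<sigma> = 0")
  case True
  have "dilation = (\<lambda>r. r)" using dilation_0[OF True] by (rule ext)
  thus ?thesis using DERIV_ident damp_0[OF True] by simp
next
  case False
  hence "dilation = (\<lambda>r. (1 - damp r) / (2 * \<sigma>))" by (auto simp: dilation_def)
  thus ?thesis using False by (auto intro!: derivative_eq_intros damp_has_derivative)
qed

lemma dilation_damp: "2 * \<sigma> * dilation r = 1 - damp r"
  by (auto simp: dilation_def damp_def)

lemma dilation_le: "dilation r \<le> r"
proof (cases "\<sigma> = 0")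
  case False
  have "1 - damp r \<le> 2 * \<sigma> * r" using exp_ge_add_one_self[of "- (2 * \<sigma> * r)"] by (simp add: damp_def)
  thus ?thesis using False \<sigma> by (simp add: dilation_def field_simps)
next
  case True
  show ?thesis unfolding dilation_0[OF True] by simp
qed

lemma dilation_ge: "dilation r \<ge> r * damp r"
proof (cases "\<sigma> = 0")
  case False
  have "(1 + 2 * \<sigma> * r) * damp r \<le> exp (2 * \<sigma> * r) * damp r"
    by (intro mult_right_mono) (auto simp: damp_def exp_ge_add_one_self)
  also have "\<dots> = 1" by (simp add: damp_def exp_add[symmetric])
  finally have "2 * \<sigma> * (r * damp r) \<le> 1 - damp r" by (simp add: algebra_simps)
  thus ?thesis using False \<sigma> by (simp add: dilation_def field_simps)
next
  case True
  show ?thesis unfolding dilation_0[OF True] damp_0[OF True] by simp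
qed

lemma damp_pos: "damp r > 0" and damp_le_1: "r \<ge> 0 \<Longrightarrow> damp r \<le> 1"
  using \<sigma> by (auto simp: damp_def)

lemma dilation_pos: "r > 0 \<Longrightarrow> dilation r > 0"
  using dilation_ge[of r] damp_pos[of r] mult_pos_pos[of r "damp r"] by linarith

lemma pot_nonneg: "pot r \<ge> 0" and coef_nonneg: "coef r \<ge> 0"
  using \<omega>_nonneg by (auto simp: pot_def coef_def)

lemma pot_has_derivative:
  "r > 0 \<Longrightarrow> (pot has_real_derivative - 2 * \<omega> * cosh r / sinh r ^ 3) (at r)"
  unfolding pot_def[abs_def]
  by (auto intro!: derivative_eq_intros simp: power2_eq_square power3_eq_cube field_simps)

lemma coef_has_derivative:
  assumes "r > 0"
  shows "(coef has_real_derivative - coef r * (q * (cosh r / sinh r) + (p - 1) * \<sigma>)) (at r)"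
proof -
  have s: "sinh r > 0" using assms by simp
  have 1: "((\<lambda>r. sinh r powr (- q)) has_real_derivative - q * sinh r powr (- q - 1) * cosh r) (at r)"
    by (rule DERIV_chain2[where f = "\<lambda>z. z powr (- q)" and g = sinh, OF has_real_derivative_powr[OF s]])
       (auto intro!: derivative_eq_intros)
  have 2: "((\<lambda>r. exp (- ((p - 1) * \<sigma> * r))) has_real_derivative - ((p - 1) * \<sigma>) * exp (- ((p - 1) * \<sigma> * r))) (at r)"
    by (auto intro!: derivative_eq_intros)
  have 3: "sinh r powr (- q - 1) = sinh r powr (- q) / sinh r" using s by (simp add: powr_diff)
  show ?thesis unfolding coef_def[abs_def]
    using DERIV_mult[OF 1 2] unfolding 3 by (rule DERIV_cong) (use s in \<open>simp add: field_simps\<close>)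
qed

text \<open>
  In terms of \<open>y = exp (- \<sigma> r) * \<Phi>\<close>, which solves \<open>y'' = (\<sigma>\<^sup>2 + pot) y - \<dots>\<close>, and with
  \<open>a = dilation\<close>, this is the classical expression
  \<open>a (y'\<^sup>2 / 2 - (\<sigma>\<^sup>2 + pot) y\<^sup>2 / 2 + \<dots>) - a' y y' / 2 + a'' y\<^sup>2 / 4\<close>, where the dots stand for the
  nonlinear term. The function \<open>\<beta>\<close> is the coefficient of the nonlinear term in its derivative; its
  limit at \<open>0\<close> is \<open>(p + 3) / 2 - q\<close>, positive exactly for subcritical \<open>p\<close>.
\<close>

definition "pohozaev \<Phi> \<Phi>' r =
  damp r * (dilation r * ((\<Phi>' r)\<^sup>2 / 2 - pot r * (\<Phi> r)\<^sup>2 / 2 + coef r * \<Phi> r powr (p + 1) / (p + 1))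
            - \<Phi> r * \<Phi>' r / 2)"

definition "\<beta> r = 2 * damp r - 1 + (p + 1) / 2 - dilation r * (q * (cosh r / sinh r) + (p - 1) * \<sigma>)"

text \<open>
  The third derivative of \<open>a = dilation\<close> is \<open>4 \<sigma>\<^sup>2 a'\<close>. Therefore the constant \<open>\<sigma>\<^sup>2\<close> of the
  potential contributes nothing to the quadratic terms, and, up to the factor \<open>damp\<close>, only
  \<open>- (damp * pot + dilation * pot' / 2) \<Phi>\<^sup>2\<close> is left. After the elimination of \<open>damp\<close> by
  \<open>damp = 1 - 2 \<sigma> dilation\<close> the identity is one of polynomials.
\<close>

lemma pohozaev_has_derivative:
  assumes r: "r > 0" and pos: "\<Phi> r > 0"
    and d1: "(\<Phi> has_real_derivative \<Phi>' r) (at r)"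
    and d2: "(\<Phi>' has_real_derivative (2 * \<sigma> * \<Phi>' r + pot r * \<Phi> r - coef r * \<Phi> r powr p)) (at r)"
  shows "(pohozaev \<Phi> \<Phi>' has_real_derivative
     damp r * (\<omega> / sinh r ^ 3 * (dilation r * cosh r - damp r * sinh r) * (\<Phi> r)\<^sup>2
               + coef r * \<beta> r * \<Phi> r powr (p + 1) / (p + 1))) (at r)"
proof -
  define a E W h X y z ct where abbr: "a = dilation r" "E = damp r" "W = pot r" "h = coef r" "X = \<Phi> r powr p"
    "y = \<Phi> r" "z = \<Phi>' r" "ct = cosh r / sinh r"
  define W' where "W' = - 2 * \<omega> * cosh r / sinh r ^ 3"
  define z' where "z' = 2 * \<sigma> * z + W * y - h * X"
  define h' where "h' = - h * (q * ct + (p - 1) * \<sigma>)"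
  have P: "((\<lambda>r. \<Phi> r powr (p + 1) / (p + 1)) has_real_derivative X * z) (at r)"
    using DERIV_cdivide[OF DERIV_chain2[OF has_real_derivative_powr[OF pos, of "p + 1"] d1], of "p + 1"] p
    by (simp add: abbr)
  have powS: "\<Phi> r powr (p + 1) = X * y" using pos by (simp add: abbr powr_add)
  have s: "sinh r > 0" using r by simp
  have 1: "((\<lambda>r. (\<Phi>' r)\<^sup>2 / 2) has_real_derivative z * z') (at r)"
    using d2 by (auto intro!: derivative_eq_intros simp: abbr z'_def)
  have 2: "((\<lambda>r. pot r * (\<Phi> r)\<^sup>2 / 2) has_real_derivative W' * y\<^sup>2 / 2 + W * y * z) (at r)"
    by (auto intro!: derivative_eq_intros d1 pot_has_derivative[OF r] simp: abbr W'_def)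
  have 3: "((\<lambda>r. coef r * (\<Phi> r powr (p + 1) / (p + 1))) has_real_derivative h' * (X * y / (p + 1)) + h * (X * z)) (at r)"
    using DERIV_mult[OF coef_has_derivative[OF r] P]
    by (rule DERIV_cong) (simp add: powS h'_def abbr)
  have 4: "((\<lambda>r. \<Phi> r * \<Phi>' r / 2) has_real_derivative (z * z + y * z') / 2) (at r)"
    using DERIV_cdivide[OF DERIV_mult[OF d1 d2], of 2]
    by (rule DERIV_cong) (simp add: abbr z'_def algebra_simps)
  have "((\<lambda>r. damp r * (dilation r * ((\<Phi>' r)\<^sup>2 / 2 - pot r * (\<Phi> r)\<^sup>2 / 2 + coef r * (\<Phi> r powr (p + 1) / (p + 1)))
            - \<Phi> r * \<Phi>' r / 2)) has_real_derivative
      - 2 * \<sigma> * E * (a * (z\<^sup>2 / 2 - W * y\<^sup>2 / 2 + h * (X * y / (p + 1))) - y * z / 2)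
      + (E * (z\<^sup>2 / 2 - W * y\<^sup>2 / 2 + h * (X * y / (p + 1)))
         + (z * z' - (W' * y\<^sup>2 / 2 + W * y * z) + (h' * (X * y / (p + 1)) + h * (X * z))) * a
         - (z * z + y * z') / 2) * E) (at r)"
    using DERIV_mult[OF damp_has_derivative[of r]
      DERIV_diff[OF DERIV_mult[OF dilation_has_derivative[of r] DERIV_add[OF DERIV_diff[OF 1 2] 3]] 4]]
    by (rule DERIV_cong) (simp add: abbr powS)
  moreover have "(\<lambda>r. damp r * (dilation r * ((\<Phi>' r)\<^sup>2 / 2 - pot r * (\<Phi> r)\<^sup>2 / 2 + coef r * (\<Phi> r powr (p + 1) / (p + 1)))
            - \<Phi> r * \<Phi>' r / 2)) = pohozaev \<Phi> \<Phi>'"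
    by (auto simp: pohozaev_def)
  moreover have "- 2 * \<sigma> * E * (a * (z\<^sup>2 / 2 - W * y\<^sup>2 / 2 + h * (X * y / (p + 1))) - y * z / 2)
      + (E * (z\<^sup>2 / 2 - W * y\<^sup>2 / 2 + h * (X * y / (p + 1)))
         + (z * z' - (W' * y\<^sup>2 / 2 + W * y * z) + (h' * (X * y / (p + 1)) + h * (X * z))) * a
         - (z * z + y * z') / 2) * E
     = E * ((- E * W - a * W' / 2) * y\<^sup>2 + h * \<beta> r * (X * y) / (p + 1))"
  proof -
    define Y where "Y = X * y / (p + 1)"
    have Xy: "X * y = (p + 1) * Y" using p by (simp add: Y_def)
    have E: "E = 1 - 2 * \<sigma> * a" using dilation_damp[of r] by (simp add: abbr)
    have b: "\<beta> r = 2 * E - 1 + (p + 1) / 2 - a * (q * ct + (p - 1) * \<sigma>)"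
      by (simp add: \<beta>_def abbr)
    have rhs: "h * \<beta> r * (X * y) / (p + 1) = h * \<beta> r * Y" by (simp add: Y_def)
    have yX: "y * (h * X) = h * ((p + 1) * Y)" using Xy by (simp add: mult_ac)
    have yz': "y * z' = 2 * \<sigma> * y * z + W * y\<^sup>2 - h * ((p + 1) * Y)"
      unfolding z'_def right_diff_distrib yX by (simp add: algebra_simps power2_eq_square)
    have zz': "z * z' = 2 * \<sigma> * z\<^sup>2 + W * y * z - h * (X * z)"
      unfolding z'_def by (simp add: algebra_simps power2_eq_square)
    show ?thesis unfolding rhs unfolding Y_def[symmetric] unfolding yz' zz' b h'_def unfolding E
      by (simp add: field_simps power2_eq_square)
  qed
  moreover have "- E * W - a * W' / 2 = \<omega> / sinh r ^ 3 * (dilation r * cosh r - damp r * sinh r)"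
    using s unfolding abbr W'_def pot_def by (simp add: field_simps power2_eq_square power3_eq_cube)
  ultimately show ?thesis by (simp add: powS abbr)
qed

text \<open>
  This is \<open>tanh r \<le> r \<le> dilation r / damp r\<close>; it makes the quadratic part of the derivative of the
  Pohozaev functional nonnegative.
\<close>

lemma dilation_cosh_ge:
  assumes "r > 0"
  shows "dilation r * cosh r - damp r * sinh r \<ge> 0"
proof -
  have "damp r * sinh r \<le> damp r * (r * cosh r)"
    using sinh_le_mult_cosh[of r] assms damp_pos[of r] by (intro mult_left_mono) auto
  also have "\<dots> = (r * damp r) * cosh r" by simp
  also have "\<dots> \<le> dilation r * cosh r" using dilation_ge[of r] by (intro mult_right_mono) auto
  finally show ?thesis by simp
qed

lemma pohozaev_deriv_ge:
  assumes "r > 0"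
  shows "damp r * (\<omega> / sinh r ^ 3 * (dilation r * cosh r - damp r * sinh r) * y\<^sup>2
               + coef r * \<beta> r * Z / (p + 1)) \<ge> damp r * (coef r * \<beta> r * Z / (p + 1))"
  using dilation_cosh_ge[OF assms] \<omega>_nonneg assms damp_pos[of r]
  by (intro mult_left_mono) auto

lemma coef_decay:
  assumes r1: "r1 > 0"
  shows "\<exists>K>0. \<forall>r\<ge>r1. r * coef r \<le> K * exp (- r)"
proof -
  define s0 where "s0 = (1 - exp (- 2 * r1)) / 2"
  have s0: "s0 > 0" using r1 by (simp add: s0_def)
  show ?thesis
  proof (intro exI[of _ "s0 powr (- q) / (q - 1)"] conjI allI impI)
    show "s0 powr (- q) / (q - 1) > 0" using s0 q_gt_1 by simp
    fix r assume r: "r \<ge> r1"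
    have "exp (- 2 * r) \<le> exp (- 2 * r1)" using r by simp
    hence "s0 \<le> (1 - exp (- 2 * r)) / 2" by (simp add: s0_def)
    hence "s0 * exp r \<le> (1 - exp (- 2 * r)) / 2 * exp r" by (intro mult_right_mono) auto
    also have "\<dots> = sinh r" by (simp add: sinh_field_def left_diff_distrib exp_add[symmetric])
    finally have "sinh r powr (- q) \<le> (s0 * exp r) powr (- q)"
      using s0 q_gt_1 by (intro powr_mono2') auto
    also have "\<dots> = s0 powr (- q) * (exp (- (q - 1) * r) * exp (- r))"
      using s0 by (simp add: powr_mult exp_powr_real exp_add[symmetric] algebra_simps)
    finally have 1: "sinh r powr (- q) \<le> s0 powr (- q) * (exp (- (q - 1) * r) * exp (- r))" .
    have "exp (- ((p - 1) * \<sigma> * r)) \<le> 1" using p \<sigma> r r1 by simp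
    hence "coef r \<le> (s0 powr (- q) * (exp (- (q - 1) * r) * exp (- r))) * 1"
      unfolding coef_def using 1 by (intro mult_mono) auto
    hence "r * coef r \<le> r * (s0 powr (- q) * (exp (- (q - 1) * r) * exp (- r)))"
      using r r1 by (intro mult_left_mono) auto
    also have "\<dots> = s0 powr (- q) * exp (- r) * (r * exp (- (q - 1) * r))" by (simp only: mult_ac)
    also have "\<dots> \<le> s0 powr (- q) * exp (- r) * (1 / (q - 1))"
    proof (rule mult_left_mono)
      have "(q - 1) * r \<le> exp ((q - 1) * r)" using exp_ge_add_one_self[of "(q - 1) * r"] by linarith
      hence "(q - 1) * r * exp (- (q - 1) * r) \<le> exp ((q - 1) * r) * exp (- (q - 1) * r)"
        by (intro mult_right_mono) auto
      also have "\<dots> = 1" unfolding exp_add[symmetric] by (simp add: algebra_simps)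
      finally show "r * exp (- (q - 1) * r) \<le> 1 / (q - 1)" using q_gt_1 by (simp add: field_simps)
    qed auto
    finally show "r * coef r \<le> s0 powr (- q) / (q - 1) * exp (- r)" by (simp add: mult_ac)
  qed
qed

text \<open>
  The multiplier grows at most linearly, and \<open>\<Phi>'\<close>, \<open>pot\<close> and \<open>coef\<close> decay exponentially.
\<close>

lemma pohozaev_tendsto_0:
  assumes lim: "(\<Phi> \<longlongrightarrow> \<alpha>) at_top" and pos: "\<And>r. r \<ge> 1 \<Longrightarrow> \<Phi> r \<ge> 0" and "\<alpha> > 0"
    and B: "\<And>r. r \<ge> 1 \<Longrightarrow> \<bar>\<Phi>' r\<bar> \<le> B * exp (- r)"
  shows "(pohozaev \<Phi> \<Phi>' \<longlongrightarrow> 0) at_top"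
proof -
  obtain K where K: "K > 0" "\<And>r. r \<ge> 1 \<Longrightarrow> r * coef r \<le> K * exp (- r)"
    using coef_decay[of 1] by auto
  define R where "R = (\<lambda>r. B\<^sup>2 * (r * exp (- 2 * r)) / 2 + (r * pot r) * (\<Phi> r)\<^sup>2 / 2
     + (K * exp (- r)) * \<Phi> r powr (p + 1) / (p + 1) + \<Phi> r * (B * exp (- r)) / 2)"
  have e1: "((\<lambda>r::real. exp (- r)) \<longlongrightarrow> 0) at_top" by real_asymp
  have e2: "((\<lambda>r::real. r * exp (- 2 * r)) \<longlongrightarrow> 0) at_top" by real_asymp
  have e3: "((\<lambda>r. r * pot r) \<longlongrightarrow> 0) at_top"
  proof -
    have "((\<lambda>r::real. r / (sinh r)\<^sup>2) \<longlongrightarrow> 0) at_top" by real_asymp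
    from tendsto_mult_left[OF this, of \<omega>] show ?thesis by (simp add: pot_def mult_ac)
  qed
  have "(R \<longlongrightarrow> B\<^sup>2 * 0 / 2 + 0 * \<alpha>\<^sup>2 / 2 + (K * 0) * \<alpha> powr (p + 1) / (p + 1) + \<alpha> * (B * 0) / 2) at_top"
    unfolding R_def using p \<open>\<alpha> > 0\<close> by (intro tendsto_intros e1 e2 e3 lim) auto
  hence R: "(R \<longlongrightarrow> 0) at_top" by simp
  show ?thesis
  proof (rule Lim_null_comparison[OF _ R])
    show "\<forall>\<^sub>F r in at_top. norm (pohozaev \<Phi> \<Phi>' r) \<le> R r"
      using eventually_ge_at_top[of 1]
    proof eventually_elim
      case (elim r)
      have a: "0 \<le> dilation r" "dilation r \<le> r" using dilation_pos[of r] dilation_le[of r] elim by auto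
      have "(\<Phi>' r)\<^sup>2 \<le> (B * exp (- r))\<^sup>2" using B[OF elim] by (metis abs_le_square_iff abs_ge_self order_trans power2_abs power_mono abs_ge_zero)
      also have "\<dots> = B\<^sup>2 * exp (- 2 * r)" by (simp add: power_mult_distrib exp_of_nat_mult[symmetric])
      finally have 1: "dilation r * (\<Phi>' r)\<^sup>2 \<le> r * (B\<^sup>2 * exp (- 2 * r))"
        using a by (intro mult_mono) auto
      have 2: "dilation r * (pot r * (\<Phi> r)\<^sup>2) \<le> r * (pot r * (\<Phi> r)\<^sup>2)"
        using a pot_nonneg by (intro mult_right_mono) auto
      have "dilation r * (coef r * \<Phi> r powr (p + 1)) \<le> r * (coef r * \<Phi> r powr (p + 1))"
        using a coef_nonneg by (intro mult_right_mono) auto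
      also have "\<dots> = r * coef r * \<Phi> r powr (p + 1)" by simp
      also have "\<dots> \<le> (K * exp (- r)) * \<Phi> r powr (p + 1)" using K(2)[OF elim] by (intro mult_right_mono) auto
      finally have 3: "dilation r * (coef r * \<Phi> r powr (p + 1)) / (p + 1) \<le> (K * exp (- r)) * \<Phi> r powr (p + 1) / (p + 1)"
        using p by (intro divide_right_mono) auto
      have 4: "\<bar>\<Phi> r * \<Phi>' r\<bar> \<le> \<Phi> r * (B * exp (- r))"
        unfolding abs_mult using B[OF elim] pos[OF elim] by (intro mult_mono) auto
      have n: "0 \<le> dilation r * (\<Phi>' r)\<^sup>2" "0 \<le> dilation r * (pot r * (\<Phi> r)\<^sup>2)" "0 \<le> dilation r * (coef r * \<Phi> r powr (p + 1)) / (p + 1)"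
        using a pot_nonneg coef_nonneg p by auto
      let ?I = "dilation r * ((\<Phi>' r)\<^sup>2 / 2 - pot r * (\<Phi> r)\<^sup>2 / 2 + coef r * \<Phi> r powr (p + 1) / (p + 1)) - \<Phi> r * \<Phi>' r / 2"
      have I: "?I = dilation r * (\<Phi>' r)\<^sup>2 / 2 - dilation r * (pot r * (\<Phi> r)\<^sup>2) / 2
          + dilation r * (coef r * \<Phi> r powr (p + 1)) / (p + 1) - \<Phi> r * \<Phi>' r / 2"
        by (simp add: algebra_simps)
      have "\<bar>?I\<bar> \<le> R r" unfolding I R_def using 1 2 3 4 n
        unfolding mult.assoc mult.left_commute[of r "B\<^sup>2"] by linarith
      moreover have "damp r * \<bar>?I\<bar> \<le> 1 * \<bar>?I\<bar>" using damp_le_1[of r] elim by (intro mult_right_mono) auto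
      ultimately show ?case using damp_pos[of r] by (simp add: pohozaev_def abs_mult)
    qed
  qed
qed

end

section \<open>Positivity of small solutions\<close>

text \<open>
  For \<open>k = N - 1\<close>, the assumption is \<open>p < (N + 2) / (N - 2)\<close>.
\<close>

locale subcritical_emden = hyperbolic_emden +
  assumes sub: "k * (p - 1) < p + 3"
begin

lemma \<beta>_positive_near_0: "\<exists>r1 \<beta>0. 0 < r1 \<and> r1 \<le> 1 \<and> 0 < \<beta>0 \<and> (\<forall>r. 0 < r \<and> r \<le> r1 \<longrightarrow> \<beta> r \<ge> \<beta>0)"
proof -
  define \<beta>0 where "\<beta>0 = ((p + 3) / 2 - q) / 2"
  have b0: "\<beta>0 > 0" using sub by (simp add: \<beta>0_def q_def)
  have "((\<lambda>r::real. r * (cosh r / sinh r)) \<longlongrightarrow> 1) (at_right 0)" by real_asymp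
  moreover have "((\<lambda>r::real. exp (- (2 * \<sigma> * r))) \<longlongrightarrow> exp (- (2 * \<sigma> * 0))) (at_right 0)"
    by (intro tendsto_intros)
  hence "(damp \<longlongrightarrow> 1) (at_right 0)" by (simp add: damp_def[abs_def])
  ultimately have "((\<lambda>r. 2 * damp r - 1 + (p + 1) / 2 - (q * (r * (cosh r / sinh r)) + r * ((p - 1) * \<sigma>)))
       \<longlongrightarrow> 2 * 1 - 1 + (p + 1) / 2 - (q * 1 + 0 * ((p - 1) * \<sigma>))) (at_right 0)"
    by (intro tendsto_intros)
  moreover have "\<beta>0 < 2 * 1 - 1 + (p + 1) / 2 - (q * 1 + 0 * ((p - 1) * \<sigma>))"
    using b0 by (simp add: \<beta>0_def field_simps)
  ultimately have "\<forall>\<^sub>F r in at_right 0. \<beta>0 < 2 * damp r - 1 + (p + 1) / 2 - (q * (r * (cosh r / sinh r)) + r * ((p - 1) * \<sigma>))"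
    by (rule order_tendstoD(1))
  then obtain r2 where r2: "r2 > 0" "\<And>r. 0 < r \<Longrightarrow> r < r2 \<Longrightarrow>
      \<beta>0 < 2 * damp r - 1 + (p + 1) / 2 - (q * (r * (cosh r / sinh r)) + r * ((p - 1) * \<sigma>))"
    by (auto simp: eventually_at_right_field)
  have "\<beta> r \<ge> \<beta>0" if r: "0 < r" "r \<le> min 1 (r2 / 2)" for r
  proof -
    have "q * (cosh r / sinh r) + (p - 1) * \<sigma> \<ge> 0" using q_gt_1 p \<sigma> r by simp
    hence "dilation r * (q * (cosh r / sinh r) + (p - 1) * \<sigma>) \<le> r * (q * (cosh r / sinh r) + (p - 1) * \<sigma>)"
      using dilation_le[of r] by (intro mult_right_mono) auto
    also have "\<dots> = q * (r * (cosh r / sinh r)) + r * ((p - 1) * \<sigma>)" by (simp add: algebra_simps)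
    finally show ?thesis using r2(2)[of r] r r2(1) unfolding \<beta>_def by simp
  qed
  thus ?thesis using b0 r2(1) by (intro exI[of _ "min 1 (r2 / 2)"] exI[of _ \<beta>0]) auto
qed

text \<open>
  Far from the origin the nonlinear term of the Pohozaev identity may have the wrong sign, but its
  coefficient is at most of linear size, which the exponential decay of \<open>coef\<close> absorbs.
\<close>

lemma \<beta>_lower_bound:
  assumes r1: "r1 > 0"
  shows "\<exists>b>0. \<forall>r\<ge>r1. \<beta> r \<ge> - b * r"
proof (intro exI[of _ "1 / r1 + q * (1 + 1 / r1) + (p - 1) * \<sigma>"] conjI allI impI)
  show "1 / r1 + q * (1 + 1 / r1) + (p - 1) * \<sigma> > 0"
    using r1 q_gt_1 p \<sigma> by (intro add_pos_nonneg mult_nonneg_nonneg) auto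
  fix r assume r: "r \<ge> r1"
  have s: "sinh r \<ge> r1" using le_sinh[of r] r r1 by linarith
  have "cosh r = sinh r + exp (- r)" using cosh_minus_sinh[of r] by linarith
  moreover have "exp (- r) \<le> 1" using r r1 by simp
  ultimately have "cosh r / sinh r \<le> (sinh r + 1) / sinh r" using s r1 by (intro divide_right_mono) auto
  also have "\<dots> = 1 + 1 / sinh r" using r r1 by (simp add: add_divide_distrib)
  also have "\<dots> \<le> 1 + 1 / r1" using s r r1 by (intro add_left_mono divide_left_mono mult_pos_pos) auto
  finally have ct: "cosh r / sinh r \<le> 1 + 1 / r1" .
  have ct0: "cosh r / sinh r \<ge> 0" using r r1 by simp
  have "dilation r * (q * (cosh r / sinh r) + (p - 1) * \<sigma>) \<le> r * (q * (1 + 1 / r1) + (p - 1) * \<sigma>)"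
    using dilation_le[of r] ct ct0 q_gt_1 p \<sigma> r r1 by (intro mult_mono add_mono mult_left_mono add_nonneg_nonneg) auto
  moreover have "r * (1 / r1) \<ge> 1" using r r1 by (simp add: field_simps)
  moreover have "2 * damp r + (p + 1) / 2 \<ge> 0" using damp_pos[of r] p by simp
  moreover have "- (1 / r1 + q * (1 + 1 / r1) + (p - 1) * \<sigma>) * r = - (r * (1 / r1)) - r * (q * (1 + 1 / r1) + (p - 1) * \<sigma>)"
    by (simp add: algebra_simps)
  ultimately show "- (1 / r1 + q * (1 + 1 / r1) + (p - 1) * \<sigma>) * r \<le> \<beta> r"
    unfolding \<beta>_def by linarith
qed

text \<open>
  The bound is not integrable at \<open>0\<close>. This is what drives the Pohozaev functional below any multiple
  of \<open>\<alpha> powr (p + 1)\<close>.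
\<close>

lemma coef_near_0:
  assumes r: "0 < r" "r \<le> 1"
  shows "coef r \<ge> exp (- ((p - 1) * \<sigma>)) * cosh 1 powr (- q) / r"
proof -
  have "sinh r \<le> r * cosh 1"
  proof -
    have "cosh r \<le> cosh 1" using r by (simp add: cosh_real_nonneg_le_iff)
    hence "r * cosh r \<le> r * cosh 1" using r by (intro mult_left_mono) auto
    with sinh_le_mult_cosh[of r] r show ?thesis by linarith
  qed
  hence "sinh r powr (- q) \<ge> (r * cosh 1) powr (- q)"
    using r q_gt_1 by (intro powr_mono2') auto
  also have "(r * cosh 1) powr (- q) = cosh 1 powr (- q) * r powr (- q)"
    using r by (simp add: powr_mult mult.commute)
  finally have 1: "cosh 1 powr (- q) * r powr (- q) \<le> sinh r powr (- q)" .
  have "r powr (- q) \<ge> r powr (- 1)" using r q_gt_1 by (intro powr_mono') auto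
  hence "cosh 1 powr (- q) * r powr (- 1) \<le> cosh 1 powr (- q) * r powr (- q)" by (intro mult_left_mono) auto
  with 1 have "cosh 1 powr (- q) * r powr (- 1) \<le> sinh r powr (- q)" by linarith
  moreover have "r powr (- 1) = 1 / r" using r by (simp add: powr_minus_divide)
  ultimately have 2: "cosh 1 powr (- q) / r \<le> sinh r powr (- q)" by simp
  have "(p - 1) * \<sigma> * r \<le> (p - 1) * \<sigma> * 1" using r p \<sigma> by (intro mult_left_mono) auto
  hence "exp (- ((p - 1) * \<sigma>)) \<le> exp (- ((p - 1) * \<sigma> * r))" by simp
  hence "exp (- ((p - 1) * \<sigma>)) * (cosh 1 powr (- q) / r) \<le> exp (- ((p - 1) * \<sigma> * r)) * sinh r powr (- q)"
    using 2 r by (intro mult_mono) auto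
  thus ?thesis by (simp add: coef_def mult.commute)
qed

lemma majorant_decreasing:
  assumes "0 < r" "r \<le> s"
  shows "majorant s \<le> majorant r" "majorant r > 0"
proof -
  have "exp (- s / 2) \<le> exp (- r / 2)" "exp (- r / 2) < 1" using assms by auto
  hence "(1 - exp (- r / 2)) ^ J \<le> (1 - exp (- s / 2)) ^ J" "(1 - exp (- r / 2)) ^ J > 0"
    by (auto intro!: power_mono)
  thus "majorant s \<le> majorant r" "majorant r > 0" unfolding majorant_def
    by (auto intro!: divide_left_mono)
qed

text \<open>
  The negative upper bound for the Pohozaev functional is the trace of the singularity: for a
  solution \<open>u\<close> that extends smoothly to \<open>r = 0\<close> the functional would tend to \<open>0\<close>.
\<close>

definition "positive_fast_decay \<alpha> \<Phi> \<Phi>' \<longleftrightarrow>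
     (\<forall>r>0. (\<Phi> has_real_derivative \<Phi>' r) (at r)) \<and>
     (\<forall>r>0. (\<Phi>' has_real_derivative
        (2 * \<sigma> * \<Phi>' r + pot r * \<Phi> r - coef r * \<Phi> r powr p)) (at r)) \<and>
     (\<forall>r>0. \<Phi> r > 0) \<and> (\<Phi> \<longlongrightarrow> \<alpha>) at_top \<and>
     (\<exists>r0 \<kappa>. 0 < r0 \<and> 0 < \<kappa> \<and> (\<forall>r. 0 < r \<and> r \<le> r0 \<longrightarrow> pohozaev \<Phi> \<Phi>' r \<le> - \<kappa>))"

text \<open>
  Write \<open>F\<close> for the Pohozaev functional, which tends to \<open>0\<close> at infinity, and \<open>A = \<alpha> powr (p + 1)\<close>. In
  the far region its derivative is at least \<open>- C A exp (- r)\<close>, so \<open>F r1 \<le> C A\<close>. On \<open>{r0..r1}\<close>, where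
  \<open>\<Phi> \<ge> \<alpha> / 2\<close> and \<open>\<beta> > 0\<close>, its derivative is at least \<open>c A / r\<close>, so \<open>F r0 \<le> - A\<close> for \<open>r0\<close> small. The
  constants \<open>C\<close>, \<open>c\<close> and \<open>r0\<close> do not depend on \<open>\<alpha>\<close>, which is afterwards taken so small that
  \<open>\<Phi> \<ge> \<alpha> / 2\<close> does hold on \<open>{r0..}\<close>. To the left of \<open>r0\<close>, \<open>F\<close> is monotone as long as \<open>\<Phi>\<close> is positive,
  so \<open>F \<le> - A\<close> there; but at a zero of \<open>\<Phi>\<close> only the term with \<open>\<Phi>'\<^sup>2\<close> survives and \<open>F \<ge> 0\<close>. Hence
  \<open>\<Phi>\<close> has no zero.
\<close>

theorem positive_fast_decay_solutions:
  "\<exists>\<alpha>0>0. \<forall>\<alpha>. 0 < \<alpha> \<and> \<alpha> < \<alpha>0 \<longrightarrow> (\<exists>\<Phi> \<Phi>'. positive_fast_decay \<alpha> \<Phi> \<Phi>')"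
proof -
  obtain r1 \<beta>0 where r1: "0 < r1" "r1 \<le> 1" and \<beta>0: "0 < \<beta>0" "\<And>r. 0 < r \<Longrightarrow> r \<le> r1 \<Longrightarrow> \<beta> r \<ge> \<beta>0"
    using \<beta>_positive_near_0 by blast
  obtain b where b: "b > 0" "\<And>r. r \<ge> r1 \<Longrightarrow> \<beta> r \<ge> - b * r" using \<beta>_lower_bound[OF r1(1)] by blast
  obtain K where K: "K > 0" "\<And>r. r \<ge> r1 \<Longrightarrow> r * coef r \<le> K * exp (- r)"
    using coef_decay[OF r1(1)] by blast
  define C where "C = b * K * majorant r1 powr (p + 1) / (p + 1)"
  define c where "c = exp (- (2 * \<sigma>)) * (exp (- ((p - 1) * \<sigma>)) * cosh 1 powr (- q)) * \<beta>0 * (1 / 2) powr (p + 1) / (p + 1)"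
  have C: "C \<ge> 0" using b K p by (simp add: C_def)
  have c: "c > 0" using \<beta>0 p by (simp add: c_def)
  \<comment> \<open>Chosen such that \<open>c * ln (r1 / r0) = C + 1\<close>.\<close>
  define r0 where "r0 = r1 * exp (- (C + 1) / c)"
  have "exp (- (C + 1) / c) \<le> 1" using C c by (simp add: divide_nonpos_pos)
  hence r0: "0 < r0" "r0 \<le> r1" using r1 mult_left_mono[of "exp (- (C + 1) / c)" 1 r1]
    by (auto simp: r0_def)
  obtain D where D: "\<And>\<alpha>. \<alpha> > 0 \<Longrightarrow> \<exists>\<Phi> \<Phi>'. fast_decay D \<alpha> \<Phi> \<Phi>'"
    using fast_decay_family by blast
  define d where "d = \<bar>D r0\<bar> + 1"
  have d: "d > 0" "D r0 \<le> d" by (auto simp: d_def)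
  \<comment> \<open>Chosen such that \<open>d * \<alpha> powr p \<le> \<alpha> / 2\<close> for \<open>\<alpha> < \<alpha>0\<close>.\<close>
  define \<alpha>0 where "\<alpha>0 = (1 / (2 * d)) powr (1 / (p - 1))"
  show ?thesis
  proof (rule exI[of _ \<alpha>0], intro conjI allI impI)
    show "\<alpha>0 > 0" using d by (simp add: \<alpha>0_def)
    fix \<alpha> assume \<alpha>: "0 < \<alpha> \<and> \<alpha> < \<alpha>0"
    have small: "d * \<alpha> powr p \<le> \<alpha> / 2"
    proof -
      have "\<alpha> powr (p - 1) \<le> \<alpha>0 powr (p - 1)" using \<alpha> p by (intro powr_mono2) auto
      also have "\<dots> = 1 / (2 * d)" using p d by (simp add: \<alpha>0_def powr_powr)
      finally have "d * (\<alpha> powr (p - 1) * \<alpha>) \<le> d * (1 / (2 * d) * \<alpha>)"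
        using d \<alpha> by (intro mult_left_mono mult_right_mono) auto
      moreover have "\<alpha> powr p = \<alpha> powr (p - 1) * \<alpha>" using \<alpha> powr_add[of \<alpha> "p - 1" 1] by simp
      ultimately show ?thesis using d by simp
    qed
    from D[of \<alpha>] \<alpha> obtain \<Phi> \<Phi>' B where
      d1: "\<And>r. r > 0 \<Longrightarrow> (\<Phi> has_real_derivative \<Phi>' r) (at r)" and
      d2': "\<And>r. r > 0 \<Longrightarrow> (\<Phi>' has_real_derivative
        (2 * \<sigma> * \<Phi>' r + pot r * max (\<Phi> r) 0 - coef r * max (\<Phi> r) 0 powr p)) (at r)" and
      le: "\<And>r. r > 0 \<Longrightarrow> \<Phi> r \<le> \<alpha> * majorant r" and lim: "(\<Phi> \<longlongrightarrow> \<alpha>) at_top" and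
      B: "\<And>r. r \<ge> 1 \<Longrightarrow> \<bar>\<Phi>' r\<bar> \<le> B * exp (- r)" and
      ge: "\<And>r. r \<ge> r0 \<Longrightarrow> \<Phi> r \<ge> \<alpha> - D r0 * \<alpha> powr p"
      using r0(1) unfolding fast_decay_def by metis
    have half: "\<Phi> r \<ge> \<alpha> / 2" if "r \<ge> r0" for r
    proof -
      have "D r0 * \<alpha> powr p \<le> d * \<alpha> powr p" using d by (intro mult_right_mono) auto
      with ge[OF that] small show ?thesis by linarith
    qed
    have d2: "(\<Phi>' has_real_derivative (2 * \<sigma> * \<Phi>' r + pot r * \<Phi> r - coef r * \<Phi> r powr p)) (at r)"
      if "r > 0" "\<Phi> r > 0" for r
      using d2'[OF that(1)] that(2) by (simp add: max_def)
    let ?F = "pohozaev \<Phi> \<Phi>'"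
    let ?F' = "\<lambda>r. damp r * (\<omega> / sinh r ^ 3 * (dilation r * cosh r - damp r * sinh r) * (\<Phi> r)\<^sup>2
               + coef r * \<beta> r * \<Phi> r powr (p + 1) / (p + 1))"
    have F': "(?F has_real_derivative ?F' r) (at r)" if "r > 0" "\<Phi> r > 0" for r
      by (rule pohozaev_has_derivative) (use that d1 d2 in auto)
    have F'_ge: "?F' r \<ge> damp r * (coef r * \<beta> r * \<Phi> r powr (p + 1) / (p + 1))" if "r > 0" for r
      by (rule pohozaev_deriv_ge[OF that])
    have F'_nonneg: "?F' r \<ge> 0" if "0 < r" "r \<le> r1" for r
    proof -
      have "damp r * (coef r * \<beta> r * \<Phi> r powr (p + 1) / (p + 1)) \<ge> 0"
        using \<beta>0(1) \<beta>0(2)[OF that] p damp_pos[of r] coef_nonneg[of r] by (intro mult_nonneg_nonneg divide_nonneg_nonneg) auto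
      thus ?thesis using F'_ge[OF that(1)] by linarith
    qed
    define A where "A = \<alpha> powr (p + 1)"
    have A: "A > 0" using \<alpha> by (simp add: A_def)
    have pos_far: "\<Phi> r > 0" if "r \<ge> r0" for r using half[OF that] \<alpha> by linarith
    have far: "?F r1 \<le> C * A"
    proof -
      define G where "G = (\<lambda>r. ?F r - C * A * exp (- r))"
      have G_mono: "G r1 \<le> G r" if r: "r \<ge> r1" for r
      proof (rule DERIV_nonneg_imp_nondecreasing[OF r])
        fix t assume t: "r1 \<le> t" "t \<le> r"
        have t0: "t > 0" "\<Phi> t > 0" using t r1 r0 pos_far[of t] by auto
        have "(G has_real_derivative ?F' t + C * A * exp (- t)) (at t)"
          unfolding G_def by (rule derivative_eq_intros F'[OF t0] refl | simp)+
        moreover have "?F' t + C * A * exp (- t) \<ge> 0"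
        proof -
          have "\<Phi> t \<le> \<alpha> * majorant r1"
            using le[OF t0(1)] mult_left_mono[OF majorant_decreasing(1)[OF r1(1) t(1)], of \<alpha>] \<alpha> by linarith
          hence "\<Phi> t powr (p + 1) \<le> (\<alpha> * majorant r1) powr (p + 1)"
            using t0 p by (intro powr_mono2) auto
          also have "\<dots> = A * majorant r1 powr (p + 1)"
            using \<alpha> majorant_decreasing(2)[OF r1(1) order_refl] by (simp add: A_def powr_mult)
          finally have Z: "\<Phi> t powr (p + 1) \<le> A * majorant r1 powr (p + 1)" .
          have "- (coef t * \<beta> t) \<le> coef t * (b * t)"
            using mult_left_mono[OF b(2)[OF t(1)] coef_nonneg[of t]] by simp
          also have "\<dots> = b * (t * coef t)" by simp
          also have "\<dots> \<le> b * (K * exp (- t))" using K(2)[OF t(1)] b by (intro mult_left_mono) auto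
          finally have 1: "- (coef t * \<beta> t) \<le> b * (K * exp (- t))" .
          have "- (coef t * \<beta> t) * \<Phi> t powr (p + 1) \<le> b * (K * exp (- t)) * \<Phi> t powr (p + 1)"
            using 1 by (intro mult_right_mono) auto
          also have "\<dots> \<le> b * (K * exp (- t)) * (A * majorant r1 powr (p + 1))"
            using Z b K by (intro mult_left_mono) auto
          finally have "- (coef t * \<beta> t) * \<Phi> t powr (p + 1) / (p + 1)
              \<le> b * (K * exp (- t)) * (A * majorant r1 powr (p + 1)) / (p + 1)"
            using p by (intro divide_right_mono) auto
          also have "\<dots> = C * A * exp (- t)" by (simp add: C_def)
          finally have 2: "- (coef t * \<beta> t * \<Phi> t powr (p + 1) / (p + 1)) \<le> C * A * exp (- t)" by simp
          have "damp t * - (coef t * \<beta> t * \<Phi> t powr (p + 1) / (p + 1)) \<le> damp t * (C * A * exp (- t))"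
            using 2 damp_pos[of t] by (intro mult_left_mono) auto
          also have "\<dots> \<le> 1 * (C * A * exp (- t))"
            using damp_le_1[of t] t0 C A by (intro mult_right_mono) auto
          finally show ?thesis using F'_ge[OF t0(1)] by simp
        qed
        ultimately show "\<exists>y. (G has_real_derivative y) (at t) \<and> 0 \<le> y" by blast
      qed
      have G_lim: "(G \<longlongrightarrow> 0) at_top"
      proof -
        have "\<Phi> r \<ge> 0" if "r \<ge> 1" for r using pos_far[of r] r0 r1 that by linarith
        hence "(?F \<longlongrightarrow> 0) at_top" using \<alpha> by (intro pohozaev_tendsto_0[OF lim _ _ B]) auto
        moreover have "((\<lambda>r::real. exp (- r)) \<longlongrightarrow> 0) at_top" by real_asymp
        from tendsto_mult_left[OF this, of "C * A"] have "((\<lambda>r. C * A * exp (- r)) \<longlongrightarrow> 0) at_top" by simp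
        ultimately show ?thesis unfolding G_def using tendsto_diff by fastforce
      qed
      have "\<forall>\<^sub>F r in at_top. G r1 \<le> G r"
        using eventually_ge_at_top[of r1] by eventually_elim (rule G_mono)
      hence "G r1 \<le> 0" by (rule tendsto_lowerbound[OF G_lim]) simp
      moreover have "C * A * exp (- r1) \<le> C * A * 1" using C A r1 by (intro mult_left_mono) auto
      ultimately show ?thesis by (simp add: G_def)
    qed
    have near: "?F r0 \<le> - A"
    proof -
      define G where "G = (\<lambda>r. ?F r - c * A * ln r)"
      have "G r0 \<le> G r1"
      proof (rule DERIV_nonneg_imp_nondecreasing[OF r0(2)])
        fix t assume t: "r0 \<le> t" "t \<le> r1"
        have t0: "t > 0" "\<Phi> t > 0" "t \<le> 1" using t r1 r0 pos_far[of t] by auto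
        have "(G has_real_derivative ?F' t - c * A * (1 / t)) (at t)"
          unfolding G_def using t0 by (auto intro!: derivative_eq_intros F')
        moreover have "?F' t \<ge> c * A * (1 / t)"
        proof -
          have "\<sigma> * t \<le> \<sigma> * 1" using t0 \<sigma> by (intro mult_left_mono) auto
          hence 1: "damp t \<ge> exp (- (2 * \<sigma>))" by (simp add: damp_def)
          have 2: "coef t \<ge> exp (- ((p - 1) * \<sigma>)) * cosh 1 powr (- q) / t" using coef_near_0 t0 by simp
          have 3: "\<beta> t \<ge> \<beta>0" using \<beta>0(2) t0 t by simp
          have "(\<alpha> / 2) powr (p + 1) \<le> \<Phi> t powr (p + 1)"
            using half[OF t(1)] \<alpha> p by (intro powr_mono2) auto
          moreover have "(\<alpha> / 2) powr (p + 1) = A * (1 / 2) powr (p + 1)"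
            using \<alpha> powr_mult[of \<alpha> "1/2" "p + 1"] by (simp add: A_def)
          ultimately have 4: "A * (1 / 2) powr (p + 1) \<le> \<Phi> t powr (p + 1)" by simp
          have "exp (- (2 * \<sigma>)) * ((exp (- ((p - 1) * \<sigma>)) * cosh 1 powr (- q) / t) * \<beta>0 * (A * (1 / 2) powr (p + 1)) / (p + 1))
             \<le> damp t * (coef t * \<beta> t * \<Phi> t powr (p + 1) / (p + 1))"
            using 1 2 3 4 \<beta>0(1) A p t0 coef_nonneg[of t] damp_pos[of t]
            by (intro mult_mono divide_right_mono) auto
          also have "\<dots> \<le> ?F' t" by (rule F'_ge[OF t0(1)])
          finally show ?thesis by (simp add: c_def mult_ac)
        qed
        ultimately show "\<exists>y. (G has_real_derivative y) (at t) \<and> 0 \<le> y"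
          by (intro exI[of _ "?F' t - c * A * (1 / t)"]) auto
      qed
      moreover have "c * A * ln r0 = c * A * ln r1 - (C + 1) * A"
      proof -
      have "ln r0 = ln r1 + - (C + 1) / c" using r1 by (simp add: r0_def ln_mult)
      hence X: "c * ln r0 = c * ln r1 - (C + 1)" using c by (simp add: field_simps)
      have "c * A * ln r0 = A * (c * ln r0)" by simp
      also have "\<dots> = c * A * ln r1 - (C + 1) * A" unfolding X by (simp add: algebra_simps)
      finally show ?thesis .
      qed
      ultimately have "?F r0 \<le> ?F r1 - (C + 1) * A" by (simp add: G_def)
      thus ?thesis using far by (simp add: algebra_simps)
    qed
    have mono: "?F s \<le> ?F r0" if s: "0 < s" "s \<le> r0" "\<Phi> s \<ge> 0" "\<And>t. s < t \<Longrightarrow> t \<le> r0 \<Longrightarrow> \<Phi> t > 0" for s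
    proof (rule DERIV_nonneg_imp_increasing_open[OF s(2)])
      fix t assume t: "s < t" "t < r0"
      show "\<exists>y. (?F has_real_derivative y) (at t) \<and> 0 \<le> y"
        using F'[of t] F'_nonneg[of t] s t r0 by (intro exI[of _ "?F' t"]) auto
    next
      have cont: "continuous_on {s..r0} f"
        if "\<And>r. r > 0 \<Longrightarrow> (f has_real_derivative f' r) (at r)" for f f' :: "real \<Rightarrow> real"
        by (rule DERIV_continuous_on[where D = f']) (use that s in \<open>auto intro: has_field_derivative_at_within\<close>)
      have nn: "\<Phi> t \<ge> 0" if "t \<in> {s..r0}" for t using s(3) s(4)[of t] that by (cases "t = s") auto
      have P: "continuous_on {s..r0} (\<lambda>t. \<Phi> t powr (p + 1))"
        using nn p by (intro continuous_on_powr' cont[OF d1] continuous_on_const) auto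
      have "continuous_on {s..r0} (\<lambda>r. damp r * (dilation r * ((\<Phi>' r)\<^sup>2 / 2 - pot r * (\<Phi> r)\<^sup>2 / 2
           + coef r * \<Phi> r powr (p + 1) / (p + 1)) - \<Phi> r * \<Phi>' r / 2))"
        using p by (intro continuous_on_mult continuous_on_diff continuous_on_add continuous_on_divide
            continuous_on_power continuous_on_const cont[OF d1] cont[OF d2'] cont[OF damp_has_derivative]
            cont[OF dilation_has_derivative] cont[OF pot_has_derivative] cont[OF coef_has_derivative] P) auto
      thus "continuous_on {s..r0} ?F" by (simp add: pohozaev_def[abs_def])
    qed
    have pos: "\<Phi> r > 0" if r: "r > 0" for r
    proof (rule ccontr)
      assume neg: "\<not> \<Phi> r > 0"
      hence rr0: "r < r0" using pos_far[of r] by force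
      have cont: "continuous_on {a..r0} \<Phi>" if "a > 0" for a
        by (rule DERIV_continuous_on[where D = \<Phi>']) (use that d1 in \<open>auto intro: has_field_derivative_at_within\<close>)
      define S where "S = {t \<in> {r..r0}. \<Phi> t \<le> 0}"
      have "closed S" unfolding S_def
        by (rule continuous_on_closed_Collect_le[OF cont[OF r] continuous_on_const]) simp
      have "r \<in> S" using neg rr0 by (simp add: S_def not_less)
      hence ne: "S \<noteq> {}" "bdd_above S" by (auto simp: S_def intro: bdd_aboveI[of _ r0])
      define t where "t = Sup S"
      have tS: "t \<in> S" unfolding t_def by (rule closed_contains_Sup) (use ne \<open>closed S\<close> in auto)
      hence t: "r \<le> t" "t \<le> r0" "\<Phi> t \<le> 0" by (auto simp: S_def)
      have above: "\<Phi> s > 0" if "t < s" "s \<le> r0" for s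
        using that tS cSup_upper[OF _ ne(2), of s] t by (force simp: S_def t_def not_less)
      \<comment> \<open>\<open>t\<close> is the largest point of \<open>{r..r0}\<close> at which \<open>\<Phi>\<close> is not positive.\<close>
      have "\<Phi> t = 0"
      proof (rule ccontr)
        assume "\<Phi> t \<noteq> 0"
        hence "\<Phi> t < 0" using t by auto
        then obtain s where s: "t \<le> s" "s \<le> r0" "\<Phi> s = 0"
          using IVT'[of \<Phi> t 0 r0] pos_far[of r0] cont[of t] t r by force
        with above[of s] \<open>\<Phi> t \<noteq> 0\<close> show False by (cases "s = t") auto
      qed
      hence "?F t \<ge> 0" using damp_pos[of t] dilation_pos[of t] t r p
        by (simp add: pohozaev_def)
      moreover have "?F t \<le> ?F r0" by (rule mono) (use t r \<open>\<Phi> t = 0\<close> above in auto)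
      ultimately show False using near A by linarith
    qed
    show "\<exists>\<Phi> \<Phi>'. positive_fast_decay \<alpha> \<Phi> \<Phi>'"
      unfolding positive_fast_decay_def
    proof (rule exI[of _ \<Phi>], rule exI[of _ \<Phi>'], intro conjI allI impI)
      show "\<exists>r0 \<kappa>. 0 < r0 \<and> 0 < \<kappa> \<and> (\<forall>r. 0 < r \<and> r \<le> r0 \<longrightarrow> pohozaev \<Phi> \<Phi>' r \<le> - \<kappa>)"
      proof (rule exI[of _ r0], rule exI[of _ A], intro conjI allI impI r0(1) A)
        fix r assume r: "0 < r \<and> r \<le> r0"
        have "?F r \<le> ?F r0" by (rule mono) (use r pos less_imp_le in auto)
        thus "?F r \<le> - A" using near by simp
      qed
    qed (use d1 d2 pos lim in auto)
  qed
qed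

end

section \<open>Return to the radial equation\<close>

context hyperbolic_emden begin

text \<open>
  The factor that leads from \<open>\<Phi>\<close> back to \<open>u = rad \<Phi>\<close>, and minus its logarithmic derivative.
\<close>

definition weight :: "real \<Rightarrow> real" where "weight r = sinh r powr (- (k / 2)) * exp (- (\<sigma> * r))"
definition "drift r = \<sigma> + k / 2 * (cosh r / sinh r)"

lemma weight_pos: "r > 0 \<Longrightarrow> weight r > 0" by (simp add: weight_def)

text \<open>
  Consequently \<open>coef * \<Phi> powr (p - 1) = u powr (p - 1)\<close>, by which bounds for \<open>\<Phi>\<close> become bounds for
  \<open>u\<close>.
\<close>

lemma weight_powr:
  assumes "r > 0"
  shows "weight r powr (p - 1) = coef r"
proof -
  have "weight r powr (p - 1) = (sinh r powr (- (k / 2))) powr (p - 1) * exp (- (\<sigma> * r)) powr (p - 1)"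
    unfolding weight_def by (simp add: powr_mult)
  also have "\<dots> = sinh r powr (- q) * exp (- ((p - 1) * \<sigma> * r))"
    by (simp add: powr_powr exp_powr_real q_def mult_ac)
  finally show ?thesis by (simp add: coef_def)
qed

lemma weight_has_derivative:
  assumes "r > 0"
  shows "(weight has_real_derivative - weight r * drift r) (at r)"
proof -
  have s: "sinh r > 0" using assms by simp
  have 1: "((\<lambda>r. sinh r powr (- (k / 2))) has_real_derivative - (k / 2) * sinh r powr (- (k / 2) - 1) * cosh r) (at r)"
    by (rule DERIV_chain2[where f = "\<lambda>z. z powr (- (k / 2))" and g = sinh, OF has_real_derivative_powr[OF s]])
       (auto intro!: derivative_eq_intros)
  have 2: "((\<lambda>r. exp (- (\<sigma> * r))) has_real_derivative - \<sigma> * exp (- (\<sigma> * r))) (at r)"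
    by (auto intro!: derivative_eq_intros)
  have 3: "sinh r powr (- (k / 2) - 1) = sinh r powr (- (k / 2)) / sinh r" using s by (simp add: powr_diff)
  show ?thesis unfolding weight_def[abs_def]
    using DERIV_mult[OF 1 2] unfolding 3
    by (rule DERIV_cong) (use s in \<open>simp add: drift_def field_simps\<close>)
qed

lemma drift_has_derivative:
  assumes "r > 0"
  shows "(drift has_real_derivative - (k / 2) / (sinh r)\<^sup>2) (at r)"
proof -
  have s: "sinh r \<noteq> 0" using assms by simp
  have "((\<lambda>r. cosh r / sinh r) has_real_derivative (sinh r * sinh r - cosh r * cosh r) / (sinh r * sinh r)) (at r)"
    by (rule DERIV_divide) (use s in \<open>auto intro!: derivative_eq_intros\<close>)
  moreover have "(sinh r * sinh r - cosh r * cosh r) / (sinh r * sinh r) = - 1 / (sinh r)\<^sup>2"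
    using cosh_square_eq[of r] by (simp add: power2_eq_square)
  ultimately have 1: "((\<lambda>r. cosh r / sinh r) has_real_derivative - 1 / (sinh r)\<^sup>2) (at r)" by simp
  have "((\<lambda>r. \<sigma> + k / 2 * (cosh r / sinh r)) has_real_derivative 0 + k / 2 * (- 1 / (sinh r)\<^sup>2)) (at r)"
    by (intro DERIV_add DERIV_const DERIV_cmult 1)
  thus ?thesis unfolding drift_def[abs_def] by simp
qed

definition "rad \<Phi> r = weight r * \<Phi> r"
definition "rad_deriv \<Phi> \<Phi>' r = weight r * (\<Phi>' r - drift r * \<Phi> r)"

lemma rad_has_derivative:
  assumes r: "r > 0" and d1: "(\<Phi> has_real_derivative \<Phi>' r) (at r)"
  shows "(rad \<Phi> has_real_derivative rad_deriv \<Phi> \<Phi>' r) (at r)"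
  unfolding rad_def[abs_def]
  using DERIV_mult[OF weight_has_derivative[OF r] d1]
  by (rule DERIV_cong) (simp add: rad_deriv_def algebra_simps)

text \<open>
  The exponent \<open>k / 2\<close> in the weight cancels the first-order term \<open>k * coth r\<close>; what it leaves behind,
  \<open>k\<^sup>2 / 4 * coth\<^sup>2 r - k / 2 / sinh\<^sup>2 r = k\<^sup>2 / 4 + pot r\<close>, is the origin of the potential.
\<close>

lemma rad_deriv_has_derivative:
  assumes r: "r > 0" and pos: "\<Phi> r > 0"
    and d1: "(\<Phi> has_real_derivative \<Phi>' r) (at r)"
    and d2: "(\<Phi>' has_real_derivative (2 * \<sigma> * \<Phi>' r + pot r * \<Phi> r - coef r * \<Phi> r powr p)) (at r)"
  shows "(rad_deriv \<Phi> \<Phi>' has_real_derivative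
     (- (k * (cosh r / sinh r) * rad_deriv \<Phi> \<Phi>' r) - (k\<^sup>2 / 4 - \<sigma>\<^sup>2) * rad \<Phi> r - rad \<Phi> r powr p)) (at r)"
proof -
  let ?z' = "2 * \<sigma> * \<Phi>' r + pot r * \<Phi> r - coef r * \<Phi> r powr p"
  define ct is2 where "ct = cosh r / sinh r" and "is2 = 1 / (sinh r)\<^sup>2"
  have s: "sinh r > 0" using r by simp
  have ct2: "ct\<^sup>2 = 1 + is2"
    using s cosh_square_eq[of r] by (simp add: ct_def is2_def power_divide field_simps)
  have g: "drift r = \<sigma> + k / 2 * ct" by (simp add: drift_def ct_def)
  have g2: "(drift r)\<^sup>2 = \<sigma>\<^sup>2 + \<sigma> * k * ct + k\<^sup>2 / 4 * (1 + is2)"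
    unfolding g ct2[symmetric] by (simp add: power2_eq_square field_simps)
  have gct: "k * ct * drift r = \<sigma> * k * ct + k\<^sup>2 / 2 * (1 + is2)"
    unfolding g ct2[symmetric] by (simp add: power2_eq_square field_simps)
  have pot: "pot r = (k\<^sup>2 / 4 - k / 2) * is2"
    by (simp add: pot_def \<omega>_def is2_def power2_eq_square field_simps)
  have up: "rad \<Phi> r powr p = weight r * (coef r * \<Phi> r powr p)"
  proof -
    have "weight r powr p = weight r powr (p - 1) * weight r"
      using weight_pos[OF r] powr_add[of "weight r" "p - 1" 1] by simp
    thus ?thesis unfolding rad_def using weight_pos[OF r] pos weight_powr[OF r] by (simp add: powr_mult)
  qed
  have "((\<lambda>r. weight r * (\<Phi>' r - drift r * \<Phi> r)) has_real_derivative
     - weight r * drift r * (\<Phi>' r - drift r * \<Phi> r)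
     + (?z' - (- (k / 2) * is2 * \<Phi> r + \<Phi>' r * drift r)) * weight r) (at r)"
    using DERIV_mult[OF weight_has_derivative[OF r]
        DERIV_diff[OF d2 DERIV_mult[OF drift_has_derivative[OF r] d1]]]
    by (rule DERIV_cong) (simp add: is2_def)
  moreover have "- weight r * drift r * (\<Phi>' r - drift r * \<Phi> r)
     + (?z' - (- (k / 2) * is2 * \<Phi> r + \<Phi>' r * drift r)) * weight r
    = - (k * (cosh r / sinh r) * rad_deriv \<Phi> \<Phi>' r) - (k\<^sup>2 / 4 - \<sigma>\<^sup>2) * rad \<Phi> r - rad \<Phi> r powr p"
  proof -
    have "- weight r * drift r * (\<Phi>' r - drift r * \<Phi> r)
       + (?z' - (- (k / 2) * is2 * \<Phi> r + \<Phi>' r * drift r)) * weight r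
      = weight r * ((2 * \<sigma> - 2 * drift r) * \<Phi>' r + (pot r + (drift r)\<^sup>2 + k / 2 * is2) * \<Phi> r - coef r * \<Phi> r powr p)"
      by (simp add: algebra_simps power2_eq_square)
    also have "2 * \<sigma> - 2 * drift r = - (k * ct)" by (simp add: g)
    also have "pot r + (drift r)\<^sup>2 + k / 2 * is2 = k * ct * drift r - (k\<^sup>2 / 4 - \<sigma>\<^sup>2)"
      unfolding pot g2 gct by (simp add: field_simps)
    finally show ?thesis unfolding up unfolding rad_deriv_def rad_def ct_def[symmetric]
      by (simp add: algebra_simps)
  qed
  ultimately show ?thesis unfolding rad_deriv_def[abs_def] by simp
qed

lemma rad_tendsto_infinity:
  assumes "(\<Phi> \<longlongrightarrow> \<alpha>) at_top"
  shows "((\<lambda>r. rad \<Phi> r * exp ((k / 2 + \<sigma>) * r)) \<longlongrightarrow> 2 powr (k / 2) * \<alpha>) at_top"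
proof -
  have "((\<lambda>r::real. (1 - exp (- 2 * r)) / 2) \<longlongrightarrow> 1 / 2) at_top" by real_asymp
  from tendsto_powr[OF this tendsto_const, of "- (k / 2)"]
  have "((\<lambda>r::real. ((1 - exp (- 2 * r)) / 2) powr (- (k / 2))) \<longlongrightarrow> (1 / 2) powr (- (k / 2))) at_top" by simp
  from tendsto_mult[OF this assms]
  have "((\<lambda>r. ((1 - exp (- 2 * r)) / 2) powr (- (k / 2)) * \<Phi> r) \<longlongrightarrow> 2 powr (k / 2) * \<alpha>) at_top"
    by (simp add: powr_divide powr_minus)
  moreover have "\<forall>\<^sub>F r in at_top. ((1 - exp (- 2 * r)) / 2) powr (- (k / 2)) * \<Phi> r = rad \<Phi> r * exp ((k / 2 + \<sigma>) * r)"
    using eventually_gt_at_top[of 0]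
  proof eventually_elim
    case (elim r)
    have "sinh r = (1 - exp (- 2 * r)) / 2 * exp r"
      by (simp add: sinh_field_def left_diff_distrib exp_add[symmetric])
    moreover have "(1 - exp (- 2 * r)) / 2 \<ge> 0" using elim by simp
    ultimately have "sinh r powr (- (k / 2)) = ((1 - exp (- 2 * r)) / 2) powr (- (k / 2)) * exp (- (k / 2) * r)"
      by (simp only: powr_mult exp_ge_zero) (simp add: exp_powr_real mult.commute)
    hence "rad \<Phi> r * exp ((k / 2 + \<sigma>) * r) = ((1 - exp (- 2 * r)) / 2) powr (- (k / 2)) * \<Phi> r
         * (exp (- (k / 2) * r) * exp (- (\<sigma> * r)) * exp ((k / 2 + \<sigma>) * r))"
      by (simp add: rad_def weight_def mult_ac)
    also have "exp (- (k / 2) * r) * exp (- (\<sigma> * r)) * exp ((k / 2 + \<sigma>) * r) = 1"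
      unfolding exp_add[symmetric] by (simp add: algebra_simps)
    finally show ?case by simp
  qed
  ultimately show ?thesis by (rule Lim_transform_eventually)
qed

lemma sinh_bounds:
  fixes r :: real
  assumes "0 < r" "r \<le> 1"
  shows "r \<le> sinh r" "sinh r \<le> r * cosh 1" "r * (cosh r / sinh r) \<le> cosh 1"
    "1 \<le> r * (cosh r / sinh r)" "r * (cosh r / sinh r) - 1 \<le> (cosh 1)\<^sup>2 * r\<^sup>2"
proof -
  show 1: "r \<le> sinh r" using le_sinh assms by simp
  have c: "cosh r \<le> cosh 1" using assms by (simp add: cosh_real_nonneg_le_iff)
  have s: "sinh r > 0" using assms by simp
  have "r * cosh r \<le> r * cosh 1" using assms c by (intro mult_left_mono) auto
  thus 2: "sinh r \<le> r * cosh 1" using sinh_le_mult_cosh[of r] assms by linarith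
  have "r * cosh r \<le> sinh r * cosh 1" using 1 c assms by (intro mult_mono) auto
  thus "r * (cosh r / sinh r) \<le> cosh 1" using s by (simp add: field_simps)
  have rs: "r * cosh r \<ge> sinh r" using sinh_le_mult_cosh[of r] assms by simp
  hence "sinh r / sinh r \<le> r * cosh r / sinh r" using s by (intro divide_right_mono) auto
  thus "1 \<le> r * (cosh r / sinh r)" using s by (simp only: times_divide_eq_right) simp
  have "r * (cosh r / sinh r) - 1 \<le> cosh r - 1"
  proof -
    have "r * cosh r \<le> sinh r * cosh r" using 1 by (intro mult_right_mono) auto
    hence "r * cosh r / sinh r \<le> sinh r * cosh r / sinh r" using s by (intro divide_right_mono) auto
    thus ?thesis using s by simp
  qed
  also have "cosh r - 1 \<le> (cosh r - 1) * (cosh r + 1)"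
    using cosh_real_ge_1[of r] mult_left_mono[of 1 "cosh r + 1" "cosh r - 1"] by simp
  also have "\<dots> = (sinh r)\<^sup>2" using cosh_square_eq[of r] by (simp add: power2_eq_square algebra_simps)
  also have "\<dots> \<le> (r * cosh 1)\<^sup>2" using 2 s by (intro power_mono) auto
  finally show "r * (cosh r / sinh r) - 1 \<le> (cosh 1)\<^sup>2 * r\<^sup>2" by (simp add: power_mult_distrib mult.commute)
qed

text \<open>
  Each bound results from discarding some terms of \<open>pohozaev \<Phi> \<Phi>' r \<le> - \<kappa>\<close>; the mixed term is
  absorbed by completing the square. In terms of \<open>u = rad \<Phi>\<close> they say that \<open>u\<close> is at least of the
  order \<open>r powr (- (k - 1) / 2)\<close>, that \<open>r powr (2 / (p - 1)) * u\<close> is bounded, and that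
  \<open>r * u' / u\<close> is bounded.
\<close>

lemma pohozaev_negative_bounds:
  assumes r: "0 < r" "r \<le> 1" and y: "\<Phi> r > 0" and \<kappa>: "\<kappa> > 0" and F: "pohozaev \<Phi> \<Phi>' r \<le> - \<kappa>"
  defines "E0 \<equiv> damp 1"
  shows "\<kappa> / (1 / (8 * E0) + \<omega> / 2) * r \<le> (\<Phi> r)\<^sup>2"
    and "r\<^sup>2 * (coef r * \<Phi> r powr (p - 1)) \<le> (p + 1) * (1 / (8 * E0\<^sup>2) + \<omega> / 2)"
    and "\<bar>r * \<Phi>' r\<bar> \<le> (1 + (1 + \<omega>) / E0) * \<Phi> r"
proof -
  define a where "a = dilation r"
  define W where "W = pot r"
  define h where "h = coef r * \<Phi> r powr (p - 1)"
  define y z where "y = \<Phi> r" and "z = \<Phi>' r"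
  have y: "y > 0" using y by (simp add: y_def)
  have E0: "E0 > 0" using damp_pos by (simp add: E0_def)
  have "damp r \<ge> E0" using r \<sigma> by (simp add: damp_def E0_def mult_left_le)
  hence "r * E0 \<le> r * damp r" using r by (intro mult_left_mono) auto
  hence a: "r * E0 \<le> a" "a \<le> r" using dilation_ge[of r] dilation_le[of r] by (auto simp: a_def)
  have a0: "a > 0" using dilation_pos r by (simp add: a_def)
  have h0: "h \<ge> 0" using coef_nonneg[of r] by (simp add: h_def)
  have W0: "W \<ge> 0" by (simp add: W_def pot_nonneg)
  have W: "W * r\<^sup>2 \<le> \<omega>"
  proof -
    have s: "sinh r > 0" using r by simp
    have "r\<^sup>2 \<le> (sinh r)\<^sup>2" using sinh_bounds(1)[OF r] r by (intro power_mono) auto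
    hence "\<omega> * r\<^sup>2 \<le> \<omega> * (sinh r)\<^sup>2" using \<omega>_nonneg by (intro mult_left_mono) auto
    thus ?thesis using s unfolding W_def pot_def by (simp add: divide_le_eq)
  qed
  have "\<Phi> r powr (p + 1) = \<Phi> r powr (p - 1) * y\<^sup>2"
    using y powr_add[of y "p - 1" 2] by (simp add: y_def powr_numeral add.commute)
  hence Z: "coef r * \<Phi> r powr (p + 1) = h * y\<^sup>2" by (simp add: h_def)
  define I where "I = a * (z\<^sup>2 / 2 - W * y\<^sup>2 / 2 + h * y\<^sup>2 / (p + 1)) - y * z / 2"
  have "damp r * I \<le> - \<kappa>" using F by (simp add: pohozaev_def I_def a_def W_def y_def z_def Z[unfolded y_def])
  hence "I \<le> 0" using damp_pos[of r] \<kappa> by (meson mult_pos_pos not_le order_trans less_imp_le neg_le_0_iff_le less_le_trans)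
  moreover have "damp r * I \<ge> 1 * I" if "I \<le> 0"
    using damp_le_1[of r] r that by (intro mult_right_mono_neg) auto
  ultimately have I: "I \<le> - \<kappa>" using \<open>damp r * I \<le> - \<kappa>\<close> by linarith
  have Ie: "I = a * z\<^sup>2 / 2 - a * W * y\<^sup>2 / 2 + a * h * y\<^sup>2 / (p + 1) - y * z / 2"
    by (simp add: I_def algebra_simps)
  have n1: "a * h * y\<^sup>2 / (p + 1) \<ge> 0" "a * z\<^sup>2 \<ge> 0" "a * W * y\<^sup>2 \<ge> 0" using a0 h0 p W0 by auto
  have sq: "y * z / 2 - a * z\<^sup>2 / 2 \<le> y\<^sup>2 / (8 * a)"
  proof -
    have "0 \<le> (2 * a * z - y)\<^sup>2 / (8 * a)" using a0 by simp
    also have "\<dots> = a * z\<^sup>2 / 2 - y * z / 2 + y\<^sup>2 / (8 * a)" using a0 by (simp add: power2_eq_square field_simps)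
    finally show ?thesis by simp
  qed
  have ya: "y\<^sup>2 / (8 * a) \<le> y\<^sup>2 / (8 * (r * E0))"
    using a a0 r E0 by (intro divide_left_mono mult_pos_pos) auto
  have aW: "a * W * y\<^sup>2 \<le> \<omega> / r * y\<^sup>2"
  proof (rule mult_right_mono)
    have "a * W \<le> r * W" using a W0 by (intro mult_right_mono) auto
    also have "\<dots> \<le> \<omega> / r" using W r by (simp add: field_simps power2_eq_square)
    finally show "a * W \<le> \<omega> / r" .
  qed simp
  have arith: "\<kappa> \<le> Y8 + V8 / 2" "H \<le> Y + V / 2" "Z \<le> T + V8"
    if "I \<le> - \<kappa>" "I = Z / 2 - V / 2 + H - T / 2" "H \<ge> 0" "T / 2 - Z / 2 \<le> Y" "Y \<le> Y8" "V \<le> V8"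
    for Z V H T Y Y8 V8 using that \<kappa> by linarith+
  note ineqs = arith[OF I Ie n1(1) sq ya aW]
  have "\<kappa> \<le> y\<^sup>2 / (8 * (r * E0)) + \<omega> / r * y\<^sup>2 / 2" by (rule ineqs(1))
  also have "\<dots> = y\<^sup>2 * (1 / (8 * E0) + \<omega> / 2) / r" using r E0 by (simp add: field_simps)
  finally have "\<kappa> * r \<le> y\<^sup>2 * (1 / (8 * E0) + \<omega> / 2)" using r by (simp add: field_simps)
  moreover have "1 / (8 * E0) + \<omega> / 2 > 0" using E0 \<omega>_nonneg by (simp add: add_pos_nonneg)
  ultimately show "\<kappa> / (1 / (8 * E0) + \<omega> / 2) * r \<le> (\<Phi> r)\<^sup>2" unfolding y_def[symmetric] by (simp add: pos_divide_le_eq)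
  have "a * h * y\<^sup>2 / (p + 1) \<le> y\<^sup>2 / (8 * a) + a * W * y\<^sup>2 / 2" by (rule ineqs(2))
  also have "\<dots> = (a / (8 * a\<^sup>2) + a * W / 2) * y\<^sup>2" using a0 by (simp add: field_simps power2_eq_square)
  finally have "a * y\<^sup>2 * (h / (p + 1)) \<le> a * y\<^sup>2 * (1 / (8 * a\<^sup>2) + W / 2)"
    by (simp add: algebra_simps)
  hence "h / (p + 1) \<le> 1 / (8 * a\<^sup>2) + W / 2"
    by (rule mult_left_le_imp_le) (use a0 y in simp)
  also have "1 / (8 * a\<^sup>2) \<le> 1 / (8 * (r * E0)\<^sup>2)"
    using a a0 r E0 by (intro divide_left_mono mult_left_mono power_mono mult_pos_pos) auto
  finally have "r\<^sup>2 * (h / (p + 1)) \<le> r\<^sup>2 * (1 / (8 * (r * E0)\<^sup>2) + W / 2)" by (intro mult_left_mono) auto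
  also have "\<dots> = 1 / (8 * E0\<^sup>2) + W * r\<^sup>2 / 2" using r E0 by (simp add: field_simps)
  also have "\<dots> \<le> 1 / (8 * E0\<^sup>2) + \<omega> / 2" using W by simp
  finally show "r\<^sup>2 * (coef r * \<Phi> r powr (p - 1)) \<le> (p + 1) * (1 / (8 * E0\<^sup>2) + \<omega> / 2)"
    unfolding h_def[symmetric] using p by (simp add: field_simps)
  define \<eta> where "\<eta> = r * z / y"
  have z: "z = \<eta> * y / r" using y r by (simp add: \<eta>_def)
  have "a * z\<^sup>2 \<le> y * z + \<omega> / r * y\<^sup>2" by (rule ineqs(3))
  moreover have "r * E0 * z\<^sup>2 \<le> a * z\<^sup>2" using a by (intro mult_right_mono) auto
  ultimately have "r * E0 * z\<^sup>2 \<le> y * z + \<omega> / r * y\<^sup>2" by linarith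
  moreover have "r * E0 * z\<^sup>2 = E0 * \<eta>\<^sup>2 * (y\<^sup>2 / r)" "y * z + \<omega> / r * y\<^sup>2 = (\<eta> + \<omega>) * (y\<^sup>2 / r)"
    unfolding z using r by (simp_all add: field_simps power2_eq_square)
  ultimately have "E0 * \<eta>\<^sup>2 * (y\<^sup>2 / r) \<le> (\<eta> + \<omega>) * (y\<^sup>2 / r)" by simp
  moreover have "y\<^sup>2 / r > 0" using y r by simp
  ultimately have chi: "E0 * \<eta>\<^sup>2 \<le> \<eta> + \<omega>" by (rule mult_right_le_imp_le)
  have "\<bar>\<eta>\<bar> \<le> 1 + (1 + \<omega>) / E0"
  proof (cases "\<bar>\<eta>\<bar> \<le> 1")
    case True
    have "(1 + \<omega>) / E0 \<ge> 0" using \<omega>_nonneg E0 by simp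
    with True show ?thesis by linarith
  next
    case False
    have "\<omega> * 1 \<le> \<omega> * \<bar>\<eta>\<bar>" using False \<omega>_nonneg by (intro mult_left_mono) auto
    hence "E0 * \<eta>\<^sup>2 \<le> (1 + \<omega>) * \<bar>\<eta>\<bar>" using chi by (simp add: algebra_simps)
    hence "(E0 * \<bar>\<eta>\<bar>) * \<bar>\<eta>\<bar> \<le> (1 + \<omega>) * \<bar>\<eta>\<bar>" by (simp add: power2_eq_square mult.assoc)
    hence "E0 * \<bar>\<eta>\<bar> \<le> 1 + \<omega>" by (rule mult_right_le_imp_le) (use False in simp)
    thus ?thesis using E0 by (simp add: field_simps)
  qed
  moreover have "\<bar>r * z\<bar> = \<bar>\<eta>\<bar> * y" using y by (simp add: \<eta>_def abs_mult)
  ultimately show "\<bar>r * \<Phi>' r\<bar> \<le> (1 + (1 + \<omega>) / E0) * \<Phi> r"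
    unfolding y_def[symmetric] z_def[symmetric] using y by (auto intro!: mult_right_mono)
qed

end

section \<open>Behaviour at the singularity\<close>

text \<open>
  For \<open>k = N - 1\<close>, the assumption is \<open>N / (N - 2) \<le> p\<close>, or equivalently \<open>\<mu> \<le> N - 2\<close> for the scaling
  exponent \<open>\<mu> = 2 / (p - 1)\<close> of the equation.
\<close>

locale singular_emden = subcritical_emden +
  assumes crit: "2 \<le> (k - 1) * (p - 1)"
begin

definition "\<mu> = 2 / (p - 1)"
definition "lin_coeff = k\<^sup>2 / 4 - \<sigma>\<^sup>2"

lemma \<mu>: "0 < \<mu>" "\<mu> \<le> k - 1" "k - 1 < 2 * \<mu>" "\<mu> * p = \<mu> + 2" "\<mu> * (p - 1) = 2"
proof -
  show "0 < \<mu>" "\<mu> \<le> k - 1" using p crit by (auto simp: \<mu>_def field_simps)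
  show "k - 1 < 2 * \<mu>" using p sub by (simp add: \<mu>_def field_simps)
  show 1: "\<mu> * (p - 1) = 2" using nonzero_eq_divide_eq[of "p - 1" \<mu> 2] p by (simp add: \<mu>_def)
  thus "\<mu> * p = \<mu> + 2" by (simp add: algebra_simps)
qed

lemma rad_lower_bound:
  assumes r: "0 < r" "r \<le> 1" and y: "\<Phi> r > 0" and K: "K * r \<le> (\<Phi> r)\<^sup>2" "K > 0"
  shows "cosh 1 powr (- (k / 2)) * exp (- \<sigma>) * sqrt K * r powr (- ((k - 1) / 2)) \<le> rad \<Phi> r"
proof -
  have "(r * cosh 1) powr (- (k / 2)) \<le> sinh r powr (- (k / 2))"
    using sinh_bounds[OF r] r k by (intro powr_mono2') auto
  hence 1: "cosh 1 powr (- (k / 2)) * r powr (- (k / 2)) \<le> sinh r powr (- (k / 2))"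
    using r by (simp add: powr_mult mult.commute)
  have "\<sigma> * r \<le> \<sigma> * 1" using r \<sigma> by (intro mult_left_mono) auto
  hence 2: "exp (- \<sigma>) \<le> exp (- (\<sigma> * r))" by simp
  have "sqrt (K * r) \<le> sqrt ((\<Phi> r)\<^sup>2)" using K by (intro real_sqrt_le_mono)
  hence 3: "sqrt K * r powr (1 / 2) \<le> \<Phi> r" using y r by (simp add: real_sqrt_mult powr_half_sqrt)
  have "(cosh 1 powr (- (k / 2)) * r powr (- (k / 2))) * exp (- \<sigma>) * (sqrt K * r powr (1 / 2)) \<le> rad \<Phi> r"
    unfolding rad_def weight_def using 1 2 3 K r by (intro mult_mono) auto
  hence "cosh 1 powr (- (k / 2)) * exp (- \<sigma>) * sqrt K * (r powr (- (k / 2)) * r powr (1 / 2)) \<le> rad \<Phi> r"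
    by (simp only: mult_ac)
  moreover have "r powr (- (k / 2)) * r powr (1 / 2) = r powr (- ((k - 1) / 2))"
  proof -
    have "- (k / 2) + 1 / 2 = - ((k - 1) / 2)" by (simp add: field_simps)
    thus ?thesis by (simp only: powr_add[symmetric])
  qed
  ultimately show ?thesis by (simp only:)
qed

text \<open>
  In the variable \<open>x = ln (1 / r)\<close> the nonlinearity is free of explicit factors of \<open>r\<close>, because
  \<open>\<mu> p = \<mu> + 2\<close>. The errors come from \<open>r * coth r - 1\<close> and \<open>\<lambda> r\<^sup>2\<close>, both \<open>O(r\<^sup>2)\<close>. The bounds that
  \<^locale>\<open>perturbed_emden\<close> asks for are those that the negative Pohozaev functional provides.
\<close>

lemma perturbed_emden_at_singularity:
  assumes d1: "\<And>r. r > 0 \<Longrightarrow> (\<Phi> has_real_derivative \<Phi>' r) (at r)"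
    and d2: "\<And>r. r > 0 \<Longrightarrow> (\<Phi>' has_real_derivative
        (2 * \<sigma> * \<Phi>' r + pot r * \<Phi> r - coef r * \<Phi> r powr p)) (at r)"
    and pos: "\<And>r. r > 0 \<Longrightarrow> \<Phi> r > 0"
    and F: "0 < r0" "0 < \<kappa>" "\<And>r. 0 < r \<Longrightarrow> r \<le> r0 \<Longrightarrow> pohozaev \<Phi> \<Phi>' r \<le> - \<kappa>"
  defines "w \<equiv> \<lambda>x. exp (- (\<mu> * x)) * rad \<Phi> (exp (- x))"
  shows "\<exists>w1 e1 e2 C c0 x0. perturbed_emden w w1 e1 e2 p \<mu> (k - 1) C c0 x0"
proof -
  define E0 where "E0 = damp 1"
  define K3 where "K3 = \<kappa> / (1 / (8 * E0) + \<omega> / 2)"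
  define K1 where "K1 = (p + 1) * (1 / (8 * E0\<^sup>2) + \<omega> / 2)"
  define K2 where "K2 = 1 + (1 + \<omega>) / E0"
  have E0: "E0 > 0" using damp_pos by (simp add: E0_def)
  have K: "K1 > 0" "K2 > 0" "K3 > 0"
    using E0 \<omega>_nonneg F(2) p by (auto simp: K1_def K2_def K3_def intro!: divide_pos_pos mult_pos_pos add_pos_nonneg)
  define \<rho> where "\<rho> = min 1 r0"
  have rho: "0 < \<rho>" using F by (simp add: \<rho>_def)
  have bd: "K3 * r \<le> (\<Phi> r)\<^sup>2" "r\<^sup>2 * (coef r * \<Phi> r powr (p - 1)) \<le> K1"
    "\<bar>r * \<Phi>' r\<bar> \<le> K2 * \<Phi> r" if "0 < r" "r \<le> \<rho>" for r
    using pohozaev_negative_bounds[of r \<Phi> \<kappa> \<Phi>'] that pos[of r] F unfolding K1_def K2_def K3_def E0_def \<rho>_def by auto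
  define w1 where "w1 = (\<lambda>x. - (\<mu> * w x) - exp (- ((\<mu> + 1) * x)) * rad_deriv \<Phi> \<Phi>' (exp (- x)))"
  define e1 where "e1 = (\<lambda>x. k * (exp (- x) * (cosh (exp (- x)) / sinh (exp (- x))) - 1))"
  define e2 where "e2 = (\<lambda>x. \<mu> * e1 x - lin_coeff * exp (- 2 * x))"
  define x0 where "x0 = - ln \<rho>"
  define c0 where "c0 = cosh 1 powr (- (k / 2)) * exp (- \<sigma>) * sqrt K3"
  define C1 where "C1 = K1 powr (1 / (p - 1))"
  define C2 where "C2 = \<mu> + (K2 + \<sigma> + k / 2 * cosh 1)"
  define C3 where "C3 = k * (cosh 1)\<^sup>2"
  define C where "C = C1 + C2 + C3 + (\<mu> * C3 + \<bar>lin_coeff\<bar>)"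
  have Cn: "C1 \<ge> 0" "C2 \<ge> 0" "C3 \<ge> 0" "\<mu> * C3 + \<bar>lin_coeff\<bar> \<ge> 0"
    using \<mu>(1) K \<sigma> k by (auto simp: C1_def C2_def C3_def)
  have Cle: "C1 \<le> C" "C2 \<le> C" "C3 \<le> C" "\<mu> * C3 + \<bar>lin_coeff\<bar> \<le> C"
    using Cn unfolding C_def by linarith+
  have rx: "0 < exp (- x)" "exp (- x) \<le> \<rho>" "exp (- x) \<le> 1" if "x \<ge> x0" for x
  proof -
    have "exp (- x) \<le> exp (ln \<rho>)" using that by (simp add: x0_def)
    thus "exp (- x) \<le> \<rho>" using rho by simp
    thus "exp (- x) \<le> 1" by (simp add: \<rho>_def)
  qed simp
  have r2: "(exp (- x))\<^sup>2 = exp (- 2 * x)" for x :: real by (simp add: exp_of_nat_mult[symmetric])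
  have Ar: "exp (- ((\<mu> + 1) * x)) = exp (- (\<mu> * x)) * exp (- x)" for x
    by (simp add: exp_add[symmetric] algebra_simps)
  have wp: "w x powr (p - 1) = (exp (- x))\<^sup>2 * (coef (exp (- x)) * \<Phi> (exp (- x)) powr (p - 1))" for x
  proof -
    have "exp (- (\<mu> * x)) powr (p - 1) = exp (- (\<mu> * (p - 1)) * x)" by (simp add: exp_powr_real mult_ac)
    also have "\<dots> = (exp (- x))\<^sup>2" unfolding \<mu>(5) r2 by simp
    finally show ?thesis
      unfolding w_def rad_def using weight_pos[of "exp (- x)"] pos[of "exp (- x)"] weight_powr[of "exp (- x)"]
      by (simp add: powr_mult)
  qed
  have wpos: "w x > 0" for x
    using weight_pos[of "exp (- x)"] pos[of "exp (- x)"] by (simp add: w_def rad_def)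
  have de: "((\<lambda>x. exp (- (c * x))) has_real_derivative - c * exp (- (c * x))) (at x)" for c x :: real
    by (auto intro!: derivative_eq_intros)
  have R1: "(rad \<Phi> has_real_derivative rad_deriv \<Phi> \<Phi>' r) (at r)" if "r > 0" for r
    by (rule rad_has_derivative) (use that d1 in auto)
  have R2: "(rad_deriv \<Phi> \<Phi>' has_real_derivative
     (- (k * (cosh r / sinh r) * rad_deriv \<Phi> \<Phi>' r) - lin_coeff * rad \<Phi> r - rad \<Phi> r powr p)) (at r)" if "r > 0" for r
    unfolding lin_coeff_def by (rule rad_deriv_has_derivative) (use that d1 d2 pos in auto)
  have dr: "((\<lambda>x. exp (- x)) has_real_derivative - exp (- x)) (at x)" for x :: real
    by (auto intro!: derivative_eq_intros)
  have "perturbed_emden w w1 e1 e2 p \<mu> (k - 1) C c0 x0"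
  proof
    show "1 < p" "0 < \<mu>" "\<mu> \<le> k - 1" "k - 1 < 2 * \<mu>" by (fact p \<mu>)+
    show "0 < c0" using K by (simp add: c0_def)
    show "0 \<le> x0" using rho by (simp add: x0_def \<rho>_def)
    fix x assume x: "x0 \<le> x"
    let ?r = "exp (- x)" and ?A = "exp (- (\<mu> * x))"
    note r = rx[OF x]
    have du: "((\<lambda>x. rad \<Phi> (exp (- x))) has_real_derivative rad_deriv \<Phi> \<Phi>' ?r * - ?r) (at x)"
      by (rule DERIV_chain2[OF R1[OF r(1)] dr])
    show dw: "(w has_real_derivative w1 x) (at x)"
      unfolding w_def using DERIV_mult[OF de[of \<mu> x] du]
      by (rule DERIV_cong) (unfold w1_def w_def Ar, simp add: algebra_simps)
    have du1: "((\<lambda>x. rad_deriv \<Phi> \<Phi>' (exp (- x))) has_real_derivative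
       (- (k * (cosh ?r / sinh ?r) * rad_deriv \<Phi> \<Phi>' ?r) - lin_coeff * rad \<Phi> ?r - rad \<Phi> ?r powr p) * - ?r) (at x)"
      by (rule DERIV_chain2[OF R2[OF r(1)] dr])
    have "(w1 has_real_derivative - (\<mu> * w1 x) - (- (\<mu> + 1) * exp (- ((\<mu> + 1) * x)) * rad_deriv \<Phi> \<Phi>' ?r
       + (- (k * (cosh ?r / sinh ?r) * rad_deriv \<Phi> \<Phi>' ?r) - lin_coeff * rad \<Phi> ?r - rad \<Phi> ?r powr p) * - ?r * exp (- ((\<mu> + 1) * x)))) (at x)"
      unfolding w1_def using DERIV_diff[OF DERIV_minus[OF DERIV_cmult[OF dw, of \<mu>]] DERIV_mult[OF de[of "\<mu> + 1" x] du1]]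
      by (rule DERIV_cong) (simp add: w1_def)
    moreover have "- (\<mu> * w1 x) - (- (\<mu> + 1) * exp (- ((\<mu> + 1) * x)) * rad_deriv \<Phi> \<Phi>' ?r
       + (- (k * (cosh ?r / sinh ?r) * rad_deriv \<Phi> \<Phi>' ?r) - lin_coeff * rad \<Phi> ?r - rad \<Phi> ?r powr p) * - ?r * exp (- ((\<mu> + 1) * x)))
     = - (2 * \<mu> - (k - 1) - e1 x) * w1 x + (\<mu> * (k - 1 - \<mu>) + e2 x) * w x - w x powr p"
    proof -
      have "exp (- (\<mu> * x)) powr p = exp (- (\<mu> * p) * x)" by (simp add: exp_powr_real mult_ac)
      also have "\<dots> = ?A * ?r\<^sup>2" unfolding \<mu>(4) r2 by (simp add: exp_add[symmetric] algebra_simps)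
      finally have P: "w x powr p = ?A * ?r\<^sup>2 * rad \<Phi> ?r powr p"
        unfolding w_def using wpos[of x] by (simp add: powr_mult w_def zero_less_mult_iff)
      define A r u u1 ct U where gen: "A = ?A" "r = ?r" "u = rad \<Phi> ?r" "u1 = rad_deriv \<Phi> \<Phi>' ?r"
        "ct = cosh ?r / sinh ?r" "U = rad \<Phi> ?r powr p"
      have W: "w x = A * u" "w1 x = - (\<mu> * (A * u)) - A * r * u1" "w x powr p = A * r\<^sup>2 * U"
        "exp (- ((\<mu> + 1) * x)) = A * r" "e1 x = k * (r * ct - 1)" "e2 x = \<mu> * (k * (r * ct - 1)) - lin_coeff * r\<^sup>2"
        unfolding w1_def e2_def P by (simp_all add: gen w_def Ar e1_def r2)
      show ?thesis unfolding W(3) unfolding W(1,2,4-6) unfolding gen(6)[symmetric]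
        unfolding gen(3-5)[symmetric] unfolding gen(2)[symmetric]
        by (simp add: algebra_simps power2_eq_square)
    qed
    ultimately show "(w1 has_real_derivative
       - (2 * \<mu> - (k - 1) - e1 x) * w1 x + (\<mu> * (k - 1 - \<mu>) + e2 x) * w x - w x powr p) (at x)" by simp
    show "0 < w x" by (rule wpos)
    show "w x \<le> C"
    proof -
      have "w x powr (p - 1) \<le> K1" unfolding wp using bd(2)[OF r(1,2)] .
      hence "(w x powr (p - 1)) powr (1 / (p - 1)) \<le> C1" unfolding C1_def using p by (intro powr_mono2) auto
      hence "w x \<le> C1" using p wpos[of x] by (simp add: powr_powr)
      thus ?thesis using Cle by linarith
    qed
    show "\<bar>w1 x\<bar> \<le> C * w x"
    proof -
      let ?ct = "?r * (cosh ?r / sinh ?r)"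
      have ct: "?ct \<le> cosh 1" "0 \<le> ?ct" using sinh_bounds(3,4)[OF r(1,3)] by auto
      have eq: "?r * drift ?r = \<sigma> * ?r + k / 2 * ?ct" by (simp add: drift_def algebra_simps)
      have "\<sigma> * ?r \<le> \<sigma> * 1" using \<sigma> r by (intro mult_left_mono) auto
      moreover have "k / 2 * ?ct \<le> k / 2 * cosh 1" using ct(1) k by (intro mult_left_mono) auto
      moreover have "0 \<le> k / 2 * ?ct" using ct(2) k by (intro mult_nonneg_nonneg) auto
      moreover have "0 \<le> \<sigma> * ?r" using \<sigma> by simp
      ultimately have "\<bar>?r * drift ?r\<bar> \<le> \<sigma> + k / 2 * cosh 1" unfolding eq by linarith
      hence "\<bar>?r * drift ?r * \<Phi> ?r\<bar> \<le> (\<sigma> + k / 2 * cosh 1) * \<Phi> ?r"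
        unfolding abs_mult[of "?r * drift ?r"] using pos[OF r(1)] by (intro mult_mono) auto
      hence "\<bar>?r * \<Phi>' ?r - ?r * drift ?r * \<Phi> ?r\<bar> \<le> K2 * \<Phi> ?r + (\<sigma> + k / 2 * cosh 1) * \<Phi> ?r"
        using bd(3)[OF r(1,2)] by linarith
      hence "(?A * weight ?r) * \<bar>?r * \<Phi>' ?r - ?r * drift ?r * \<Phi> ?r\<bar>
          \<le> (?A * weight ?r) * (K2 * \<Phi> ?r + (\<sigma> + k / 2 * cosh 1) * \<Phi> ?r)"
        using weight_pos[OF r(1)] by (intro mult_left_mono) auto
      also have "\<dots> = (K2 + \<sigma> + k / 2 * cosh 1) * w x" by (simp add: w_def rad_def algebra_simps)
      also have "(?A * weight ?r) * \<bar>?r * \<Phi>' ?r - ?r * drift ?r * \<Phi> ?r\<bar>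
         = \<bar>exp (- ((\<mu> + 1) * x)) * rad_deriv \<Phi> \<Phi>' ?r\<bar>"
      proof -
        have "exp (- ((\<mu> + 1) * x)) * rad_deriv \<Phi> \<Phi>' ?r = (?A * weight ?r) * (?r * \<Phi>' ?r - ?r * drift ?r * \<Phi> ?r)"
          unfolding Ar rad_deriv_def by (simp add: algebra_simps)
        thus ?thesis using weight_pos[OF r(1)] by (simp add: abs_mult)
      qed
      finally have "\<bar>exp (- ((\<mu> + 1) * x)) * rad_deriv \<Phi> \<Phi>' ?r\<bar> \<le> (K2 + \<sigma> + k / 2 * cosh 1) * w x" .
      moreover have "\<bar>\<mu> * w x\<bar> = \<mu> * w x" using \<mu>(1) wpos[of x] by simp
      moreover have "C2 * w x = \<mu> * w x + (K2 + \<sigma> + k / 2 * cosh 1) * w x" by (simp add: C2_def algebra_simps)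
      moreover have "\<bar>w1 x\<bar> \<le> \<bar>\<mu> * w x\<bar> + \<bar>exp (- ((\<mu> + 1) * x)) * rad_deriv \<Phi> \<Phi>' ?r\<bar>"
        unfolding w1_def by linarith
      moreover have "C2 * w x \<le> C * w x" using Cle(2) wpos[of x] by (intro mult_right_mono) auto
      ultimately show ?thesis by linarith
    qed
    have e1b: "\<bar>e1 x\<bar> \<le> C3 * exp (- 2 * x)"
    proof -
      have "\<bar>e1 x\<bar> = k * (?r * (cosh ?r / sinh ?r) - 1)"
        using sinh_bounds(4)[OF r(1,3)] k unfolding e1_def abs_mult by simp
      also have "\<dots> \<le> k * ((cosh 1)\<^sup>2 * ?r\<^sup>2)"
        using sinh_bounds(5)[OF r(1,3)] k by (intro mult_left_mono) auto
      finally show ?thesis by (simp add: C3_def r2)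
    qed
    have "C3 * exp (- 2 * x) \<le> C * exp (- 2 * x)" using Cle by (intro mult_right_mono) auto
    thus "\<bar>e1 x\<bar> \<le> C * exp (- 2 * x)" using e1b by linarith
    have "\<bar>\<mu> * e1 x\<bar> \<le> \<mu> * (C3 * exp (- 2 * x))"
      unfolding abs_mult using e1b \<mu>(1) by (simp add: mult_left_mono)
    hence "\<bar>e2 x\<bar> \<le> (\<mu> * C3 + \<bar>lin_coeff\<bar>) * exp (- 2 * x)"
      unfolding e2_def using abs_triangle_ineq4[of "\<mu> * e1 x" "lin_coeff * exp (- 2 * x)"]
      by (simp add: abs_mult algebra_simps)
    moreover have "(\<mu> * C3 + \<bar>lin_coeff\<bar>) * exp (- 2 * x) \<le> C * exp (- 2 * x)" using Cle by (intro mult_right_mono) auto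
    ultimately show "\<bar>e2 x\<bar> \<le> C * exp (- 2 * x)" by linarith
    show "c0 * exp (- (\<mu> - (k - 1) / 2) * x) \<le> w x"
    proof -
      have "c0 * ?r powr (- ((k - 1) / 2)) \<le> rad \<Phi> ?r"
        unfolding c0_def by (rule rad_lower_bound) (use r pos bd(1) K(3) in auto)
      hence "?A * (c0 * ?r powr (- ((k - 1) / 2))) \<le> w x" unfolding w_def by (intro mult_left_mono) auto
      moreover have "?r powr (- ((k - 1) / 2)) = exp ((k - 1) / 2 * x)" by (simp add: exp_powr_real mult_ac)
      moreover have "?A * (c0 * exp ((k - 1) / 2 * x)) = c0 * exp (- (\<mu> - (k - 1) / 2) * x)"
        by (simp add: exp_add[symmetric] algebra_simps)
      ultimately show ?thesis by (simp only:)
    qed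
  qed
  thus ?thesis by blast
qed

definition "singular_fast_decay \<alpha> u u1 \<longleftrightarrow>
     (\<forall>r>0. (u has_real_derivative u1 r) (at r)) \<and>
     (\<forall>r>0. (u1 has_real_derivative (- (k * (cosh r / sinh r) * u1 r) - lin_coeff * u r - u r powr p)) (at r)) \<and>
     (\<forall>r>0. u r > 0) \<and> filterlim u at_top (at_right 0) \<and>
     (\<mu> < k - 1 \<longrightarrow> ((\<lambda>r. r powr \<mu> * u r) \<longlongrightarrow> (\<mu> * (k - 1 - \<mu>)) powr (1 / (p - 1))) (at_right 0)) \<and>
     (\<mu> = k - 1 \<longrightarrow> ((\<lambda>r. r powr \<mu> * u r * ln (1 / r) powr (1 / (p - 1)))
         \<longlongrightarrow> ((k - 1) / (p - 1)) powr (1 / (p - 1))) (at_right 0)) \<and>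
     ((\<lambda>r. u r * exp ((k / 2 + \<sigma>) * r)) \<longlongrightarrow> 2 powr (k / 2) * \<alpha>) at_top"

theorem singular_solution_family:
  "\<exists>\<alpha>0>0. \<forall>\<alpha>. 0 < \<alpha> \<and> \<alpha> < \<alpha>0 \<longrightarrow> (\<exists>u u1. singular_fast_decay \<alpha> u u1)"
proof -
  obtain \<alpha>0 where \<alpha>0: "\<alpha>0 > 0" "\<forall>\<alpha>. 0 < \<alpha> \<and> \<alpha> < \<alpha>0 \<longrightarrow> (\<exists>\<Phi> \<Phi>'. positive_fast_decay \<alpha> \<Phi> \<Phi>')"
    using positive_fast_decay_solutions by (elim exE conjE) (rule that)
  show ?thesis
  proof (rule exI[of _ \<alpha>0], intro conjI allI impI \<alpha>0(1))
    fix \<alpha> assume "0 < \<alpha> \<and> \<alpha> < \<alpha>0"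
    from mp[OF spec[OF \<alpha>0(2)] this] obtain \<Phi> \<Phi>' r0 \<kappa> where
      ode: "\<forall>r>0. (\<Phi> has_real_derivative \<Phi>' r) (at r)"
        "\<forall>r>0. (\<Phi>' has_real_derivative
          (2 * \<sigma> * \<Phi>' r + pot r * \<Phi> r - coef r * \<Phi> r powr p)) (at r)"
        "\<forall>r>0. \<Phi> r > 0" and lim: "(\<Phi> \<longlongrightarrow> \<alpha>) at_top" and
      neg: "0 < r0" "0 < \<kappa>" "\<forall>r. 0 < r \<and> r \<le> r0 \<longrightarrow> pohozaev \<Phi> \<Phi>' r \<le> - \<kappa>"
      unfolding positive_fast_decay_def by (elim exE conjE) (rule that)
    have d1: "\<And>r. r > 0 \<Longrightarrow> (\<Phi> has_real_derivative \<Phi>' r) (at r)"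
      and d2: "\<And>r. r > 0 \<Longrightarrow> (\<Phi>' has_real_derivative
        (2 * \<sigma> * \<Phi>' r + pot r * \<Phi> r - coef r * \<Phi> r powr p)) (at r)"
      and pos: "\<And>r. r > 0 \<Longrightarrow> \<Phi> r > 0"
      and F: "0 < r0" "0 < \<kappa>" "\<And>r. 0 < r \<Longrightarrow> r \<le> r0 \<Longrightarrow> pohozaev \<Phi> \<Phi>' r \<le> - \<kappa>"
      using ode neg by auto
    define w where "w = (\<lambda>x. exp (- (\<mu> * x)) * rad \<Phi> (exp (- x)))"
    have "\<exists>w1 e1 e2 C c0 x0. perturbed_emden w w1 e1 e2 p \<mu> (k - 1) C c0 x0"
      unfolding w_def
      by (rule perturbed_emden_at_singularity[of \<Phi> \<Phi>' r0 \<kappa>]) (use d1 d2 pos F in auto)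
    then obtain w1 e1 e2 C c0 x0 where E: "perturbed_emden w w1 e1 e2 p \<mu> (k - 1) C c0 x0"
      by blast
    interpret E: perturbed_emden w w1 e1 e2 p \<mu> "k - 1" C c0 x0 by (fact E)
    have fl: "filterlim (\<lambda>r::real. - ln r) at_top (at_right 0)"
      by (rule filterlim_compose[OF filterlim_uminus_at_top_at_bot ln_at_0])
    have ev: "\<forall>\<^sub>F r in at_right (0::real). r > 0" by (simp add: eventually_at_right_less)
    have w_eq: "w (- ln r) = r powr \<mu> * rad \<Phi> r" if "r > 0" for r
      using that by (simp add: w_def powr_def)
    have lead: "((\<lambda>r. r powr \<mu> * rad \<Phi> r) \<longlongrightarrow> (\<mu> * (k - 1 - \<mu>)) powr (1 / (p - 1))) (at_right 0)" if "\<mu> < k - 1"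
      using filterlim_compose[OF E.tendsto_equilibrium[OF that] fl]
      by (rule Lim_transform_eventually) (use ev in eventually_elim, use w_eq in auto)
    have log: "((\<lambda>r. r powr \<mu> * rad \<Phi> r * ln (1 / r) powr (1 / (p - 1)))
         \<longlongrightarrow> ((k - 1) / (p - 1)) powr (1 / (p - 1))) (at_right 0)" if "\<mu> = k - 1"
      using filterlim_compose[OF E.log_decay[OF that] fl]
      by (rule Lim_transform_eventually) (use ev in eventually_elim, use w_eq in \<open>auto simp: ln_div\<close>)
    have blow: "filterlim (rad \<Phi>) at_top (at_right 0)"
    proof (rule filterlim_at_top_mono)
      have k1: "(k - 1) / 2 > 0" using k by simp
      show "filterlim (\<lambda>r. c0 * exp ((k - 1) / 2 * (- ln r))) at_top (at_right 0)"
        by (rule filterlim_compose[OF _ fl]) (use E.c0 k1 in real_asymp)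
      have "\<forall>\<^sub>F r in at_right 0. - ln r \<ge> x0" using fl by (simp add: filterlim_at_top)
      thus "\<forall>\<^sub>F r in at_right 0. c0 * exp ((k - 1) / 2 * (- ln r)) \<le> rad \<Phi> r"
        using ev
      proof eventually_elim
        case (elim r)
        have "c0 * exp (- (\<mu> - (k - 1) / 2) * (- ln r)) \<le> exp (- (\<mu> * (- ln r))) * rad \<Phi> r"
          using E.w_ge[OF elim(1)] elim(2) by (simp add: w_def)
        hence "c0 * exp (- (\<mu> - (k - 1) / 2) * (- ln r)) * exp (\<mu> * (- ln r)) \<le> exp (- (\<mu> * (- ln r))) * rad \<Phi> r * exp (\<mu> * (- ln r))"
          by (intro mult_right_mono) auto
        moreover have "exp (- (\<mu> - (k - 1) / 2) * (- ln r)) * exp (\<mu> * (- ln r)) = exp ((k - 1) / 2 * (- ln r))"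
          unfolding exp_add[symmetric] by (simp add: algebra_simps)
        moreover have "exp (- (\<mu> * (- ln r))) * rad \<Phi> r * exp (\<mu> * (- ln r)) = rad \<Phi> r"
          by (simp add: exp_minus)
        ultimately show ?case by (simp only: mult.assoc)
      qed
    qed
    show "\<exists>u u1. singular_fast_decay \<alpha> u u1"
      unfolding singular_fast_decay_def
    proof (rule exI[of _ "rad \<Phi>"], rule exI[of _ "rad_deriv \<Phi> \<Phi>'"], intro conjI allI impI)
      fix r :: real assume r: "r > 0"
      show "(rad \<Phi> has_real_derivative rad_deriv \<Phi> \<Phi>' r) (at r)"
        by (rule rad_has_derivative) (use r d1 in auto)
      show "(rad_deriv \<Phi> \<Phi>' has_real_derivative
         (- (k * (cosh r / sinh r) * rad_deriv \<Phi> \<Phi>' r) - lin_coeff * rad \<Phi> r - rad \<Phi> r powr p)) (at r)"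
        unfolding lin_coeff_def by (rule rad_deriv_has_derivative) (use r pos d1 d2 in auto)
      show "rad \<Phi> r > 0" using weight_pos[OF r] pos[OF r] by (simp add: rad_def)
    qed (use lead log blow rad_tendsto_infinity[OF lim] in auto)
  qed
qed

end

section \<open>The family of singular solutions\<close>

lemma positive_radial_singular_solutionI:
  assumes u1: "\<And>r. r > 0 \<Longrightarrow> (u has_real_derivative u1 r) (at r)"
    and u2: "\<And>r. r > 0 \<Longrightarrow> (u1 has_real_derivative
        (- ((real N - 1) * (cosh r / sinh r) * u1 r) - lam * u r - u r powr p)) (at r)"
    and pos: "\<And>r. r > 0 \<Longrightarrow> u r > 0" and blow: "filterlim u at_top (at_right 0)"
  shows "positive_radial_singular_solution N p lam u"
proof -
  let ?u2 = "\<lambda>r. - ((real N - 1) * (cosh r / sinh r) * u1 r) - lam * u r - u r powr p"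
  have d: "deriv u r = u1 r" if "r > 0" for r using DERIV_imp_deriv[OF u1[OF that]] .
  have "(deriv u has_real_derivative ?u2 r) (at r)" if r: "r > 0" for r
  proof (rule has_field_derivative_transform_within_open[OF u2[OF r]])
    show "open {0::real<..}" "r \<in> {0<..}" using r by auto
  qed (use d in auto)
  note du2 = this
  have d2: "deriv (deriv u) r = ?u2 r" if "r > 0" for r using DERIV_imp_deriv[OF du2[OF that]] .
  have cu: "continuous_on {0<..} u"
    by (rule DERIV_continuous_on[where D = u1]) (use u1 in \<open>auto intro: has_field_derivative_at_within\<close>)
  have cu1: "continuous_on {0<..} u1"
    by (rule DERIV_continuous_on[where D = ?u2]) (use u2 in \<open>auto intro: has_field_derivative_at_within\<close>)
  have nz: "sinh r \<noteq> 0" "u r \<noteq> 0" if "r \<in> {0<..}" for r using that pos[of r] by auto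
  have "continuous_on {0<..} ?u2"
    by (intro continuous_intros cu cu1) (use nz in auto)
  hence "continuous_on {0<..} (deriv (deriv u))"
    using continuous_on_cong[of "{0<..}" "{0<..}" "deriv (deriv u)" ?u2] d2 by auto
  moreover have "u differentiable (at x)" "deriv u differentiable (at x)" if "x > 0" for x
    using u1[OF that] du2[OF that] unfolding real_differentiable_def by blast+
  ultimately have "C2_on u {0<..}" by (simp add: C2_on_def)
  moreover have "\<forall>r>0. hyp_radial_laplacian N u r + lam * u r + u r powr p = 0"
    unfolding hyp_radial_laplacian_def
  proof (intro allI impI)
    fix r :: real assume "r > 0"
    thus "deriv (deriv u) r + (real N - 1) * (cosh r / sinh r) * deriv u r + lam * u r + u r powr p = 0"
      using d[of r] d2[of r] by simp
  qed
  ultimately show ?thesis using pos blow by (simp add: positive_radial_singular_solution_def)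
qed

text \<open>
  The constant of the logarithmic profile, with \<open>n = N - 2\<close> and \<open>p - 1 = 2 / n\<close>.
\<close>

lemma critical_constant:
  fixes n :: real
  assumes "n > 0"
  shows "(n / sqrt 2) powr n = (n / (2 / n)) powr (n / 2)"
proof -
  have "(n / sqrt 2) powr n = ((n / sqrt 2) powr 2) powr (n / 2)" by (simp add: powr_powr)
  also have "(n / sqrt 2) powr 2 = n / (2 / n)"
    using assms by (simp add: powr_numeral power_divide power2_eq_square)
  finally show ?thesis .
qed

theorem theorem1p1:
  fixes N :: nat and p lam :: real
  assumes "N \<ge> 3"
    and "real N / (real N - 2) \<le> p"
    and "p < (real N + 2) / (real N - 2)"
    and "lam \<le> (real N - 1)\<^sup>2 / 4"
  shows "\<exists>U :: (real \<Rightarrow> real) set.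
           infinite ((\<lambda>u. restrict u {0<..}) ` U) \<and>
           (\<forall>u\<in>U. positive_radial_singular_solution N p lam u \<and>
                   u \<sim>[at_right 0] singular_profile N p \<and>
                   (\<exists>u_inf>0. u \<sim>[at_top] (\<lambda>r. u_inf * exp (- nu_exp N lam * r))))"
proof -
  define k where "k = real N - 1"
  define \<sigma> where "\<sigma> = sqrt (k\<^sup>2 / 4 - lam)"
  have N: "real N \<ge> 3" using assms(1) by simp
  have Nk: "real N = k + 1" by (simp add: k_def)
  have n0: "k - 1 > 0" "real N - 2 = k - 1" using N unfolding Nk by auto
  have "(k + 1) / (k - 1) \<le> p" "p < (k + 3) / (k - 1)" using assms(2,3) unfolding n0(2) Nk by (simp_all add: add.commute)
  hence lo: "k + 1 \<le> p * (k - 1)" and hi: "p * (k - 1) < k + 3"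
    using n0(1) by (simp_all add: pos_divide_le_eq pos_less_divide_eq)
  have p: "p > 1"
  proof (rule ccontr)
    assume "\<not> p > 1"
    hence "p * (k - 1) \<le> 1 * (k - 1)" using n0 by (intro mult_right_mono) auto
    with lo show False by simp
  qed
  interpret singular_emden k \<sigma> p
  proof
    show "2 \<le> k" using N by (simp add: k_def)
    show "0 \<le> \<sigma>" using assms(4) by (simp add: \<sigma>_def k_def)
    show "1 < p" by (fact p)
    show "2 \<le> (k - 1) * (p - 1)" using lo by (simp add: algebra_simps)
    thus "1 < k * (p - 1) / 2" using p by (simp add: algebra_simps)
    show "k * (p - 1) < p + 3" using hi by (simp add: algebra_simps)
  qed
  have lam: "lam = k\<^sup>2 / 4 - \<sigma>\<^sup>2" using assms(4) by (simp add: \<sigma>_def k_def)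
  obtain \<alpha>0 where \<alpha>0: "\<alpha>0 > 0" and ex: "\<forall>\<alpha>. 0 < \<alpha> \<and> \<alpha> < \<alpha>0 \<longrightarrow> (\<exists>u u1. singular_fast_decay \<alpha> u u1)"
    using singular_solution_family by blast
  have solution: "\<exists>u. positive_radial_singular_solution N p lam u \<and> u \<sim>[at_right 0] singular_profile N p \<and>
      ((\<lambda>r. u r * exp ((k / 2 + \<sigma>) * r)) \<longlongrightarrow> 2 powr (k / 2) * \<alpha>) at_top"
    if \<alpha>: "0 < \<alpha>" "\<alpha> < \<alpha>0" for \<alpha>
  proof -
    have "0 < \<alpha> \<and> \<alpha> < \<alpha>0" using \<alpha> by simp
    from mp[OF spec[OF ex] this] obtain u u1 where
      ode: "\<forall>r>0. (u has_real_derivative u1 r) (at r)"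
      "\<forall>r>0. (u1 has_real_derivative (- (k * (cosh r / sinh r) * u1 r) - lam * u r - u r powr p)) (at r)"
      "\<forall>r>0. u r > 0" "filterlim u at_top (at_right 0)"
      and lead: "\<mu> < k - 1 \<longrightarrow> ((\<lambda>r. r powr \<mu> * u r) \<longlongrightarrow> (\<mu> * (k - 1 - \<mu>)) powr (1 / (p - 1))) (at_right 0)"
      and log: "\<mu> = k - 1 \<longrightarrow> ((\<lambda>r. r powr \<mu> * u r * ln (1 / r) powr (1 / (p - 1)))
         \<longlongrightarrow> ((k - 1) / (p - 1)) powr (1 / (p - 1))) (at_right 0)"
      and inf: "((\<lambda>r. u r * exp ((k / 2 + \<sigma>) * r)) \<longlongrightarrow> 2 powr (k / 2) * \<alpha>) at_top"
      unfolding singular_fast_decay_def lin_coeff_def lam[symmetric] by (elim exE conjE) (rule that)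
    have "positive_radial_singular_solution N p lam u"
      by (rule positive_radial_singular_solutionI) (use ode in \<open>auto simp: k_def\<close>)
    moreover have "u \<sim>[at_right 0] singular_profile N p"
    proof (cases "p = real N / (real N - 2)")
      case True
      have pk: "p - 1 = 2 / (k - 1)" using True n0(1) unfolding n0(2) Nk by (simp add: field_simps)
      have muk: "\<mu> = k - 1" using n0 by (simp add: \<mu>_def pk)
      have inv: "1 / (p - 1) = (k - 1) / 2" using n0 by (simp add: pk)
      define c where "c = ((k - 1) / (p - 1)) powr (1 / (p - 1))"
      have c: "c > 0" using n0 p by (simp add: c_def)
      have cc: "((k - 1) / sqrt 2) powr (k - 1) = c"
        using critical_constant[OF n0(1)] unfolding c_def inv pk by simp
      have "((\<lambda>r. r powr \<mu> * u r * ln (1 / r) powr (1 / (p - 1)) / c) \<longlongrightarrow> c / c) (at_right 0)"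
        using mp[OF log muk] c unfolding c_def[symmetric] by (intro tendsto_intros) auto
      hence "((\<lambda>r. r powr \<mu> * u r * ln (1 / r) powr (1 / (p - 1)) / c) \<longlongrightarrow> 1) (at_right 0)" using c by simp
      moreover have "\<forall>\<^sub>F r in at_right 0. r powr \<mu> * u r * ln (1 / r) powr (1 / (p - 1)) / c = u r / singular_profile N p r"
        using eventually_at_right_less[of 0]
      proof eventually_elim
        case (elim r)
        have e1: "2 - real N = - (k - 1)" "(real N - 2) / 2 = (k - 1) / 2" by (simp_all add: k_def)
        have "singular_profile N p r = c * r powr (- (k - 1)) * ln (1 / r) powr (- ((k - 1) / 2))"
          unfolding singular_profile_def if_P[OF True] by (simp only: e1 n0(2) cc)
        also have "\<dots> = c * (1 / r powr (k - 1)) * (1 / ln (1 / r) powr ((k - 1) / 2))"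
          by (simp only: powr_minus_divide)
        finally show ?case unfolding muk inv using c by simp
      qed
      ultimately have "((\<lambda>r. u r / singular_profile N p r) \<longlongrightarrow> 1) (at_right 0)"
        by (rule Lim_transform_eventually)
      thus ?thesis by (rule asymp_equivI')
    next
      case False
      hence "(k + 1) / (k - 1) < p" using assms(2) unfolding n0(2) Nk by simp
      hence "k + 1 < p * (k - 1)" using n0(1) by (simp add: pos_divide_less_eq)
      hence "2 < (k - 1) * (p - 1)" by (simp add: algebra_simps)
      hence muk: "\<mu> < k - 1" using p by (simp add: \<mu>_def field_simps)
      have mu: "m_exp p = \<mu>" by (simp add: m_exp_def \<mu>_def)
      have L: "L_const N p = (\<mu> * (k - 1 - \<mu>)) powr (1 / (p - 1))"
        by (simp add: L_const_def mu n0(2))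
      have L0: "L_const N p > 0" unfolding L using muk \<mu>(1) by simp
      have "((\<lambda>r. r powr \<mu> * u r / L_const N p) \<longlongrightarrow> L_const N p / L_const N p) (at_right 0)"
        using mp[OF lead muk] L0 unfolding L[symmetric] by (intro tendsto_intros) auto
      hence "((\<lambda>r. r powr \<mu> * u r / L_const N p) \<longlongrightarrow> 1) (at_right 0)" using L0 by simp
      moreover have "\<forall>\<^sub>F r in at_right 0. r powr \<mu> * u r / L_const N p = u r / singular_profile N p r"
        using eventually_at_right_less[of 0]
        by eventually_elim (use False in \<open>simp add: singular_profile_def mu powr_minus field_simps\<close>)
      ultimately have "((\<lambda>r. u r / singular_profile N p r) \<longlongrightarrow> 1) (at_right 0)"
        by (rule Lim_transform_eventually)
      thus ?thesis by (rule asymp_equivI')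
    qed
    ultimately show ?thesis using inf by blast
  qed
  define u where "u = (\<lambda>\<alpha>. SOME u. positive_radial_singular_solution N p lam u \<and> u \<sim>[at_right 0] singular_profile N p \<and>
      ((\<lambda>r. u r * exp ((k / 2 + \<sigma>) * r)) \<longlongrightarrow> 2 powr (k / 2) * \<alpha>) at_top)"
  have u: "positive_radial_singular_solution N p lam (u \<alpha>)" "u \<alpha> \<sim>[at_right 0] singular_profile N p"
      "((\<lambda>r. u \<alpha> r * exp ((k / 2 + \<sigma>) * r)) \<longlongrightarrow> 2 powr (k / 2) * \<alpha>) at_top" if "\<alpha> \<in> {0<..<\<alpha>0}" for \<alpha>
    using someI_ex[OF solution[of \<alpha>]] that unfolding u_def by auto
  show ?thesis
  proof (intro exI[of _ "u ` {0<..<\<alpha>0}"] conjI ballI)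
    \<comment> \<open>The parameter \<open>\<alpha>\<close> can be recovered from the behaviour of the solution at infinity.\<close>
    have "inj_on (\<lambda>\<alpha>. restrict (u \<alpha>) {0<..}) {0<..<\<alpha>0}"
    proof (rule inj_onI)
      fix \<alpha> \<beta> assume ab: "\<alpha> \<in> {0<..<\<alpha>0}" "\<beta> \<in> {0<..<\<alpha>0}"
        and eq: "restrict (u \<alpha>) {0<..} = restrict (u \<beta>) {0<..}"
      have same: "u \<alpha> r = u \<beta> r" if "r > 0" for r using fun_cong[OF eq, of r] that by simp
      have "\<forall>\<^sub>F r in at_top. u \<alpha> r * exp ((k / 2 + \<sigma>) * r) = u \<beta> r * exp ((k / 2 + \<sigma>) * r)"
        using eventually_gt_at_top[of 0] by eventually_elim (simp only: same)
      from Lim_transform_eventually[OF u(3)[OF ab(1)] this]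
      have "2 powr (k / 2) * \<alpha> = 2 powr (k / 2) * \<beta>"
        using u(3)[OF ab(2)] by (rule tendsto_unique[OF trivial_limit_at_top_linorder])
      thus "\<alpha> = \<beta>" by simp
    qed
    thus "infinite ((\<lambda>u. restrict u {0<..}) ` u ` {0<..<\<alpha>0})"
      using finite_imageD[of "\<lambda>\<alpha>. restrict (u \<alpha>) {0<..}" "{0<..<\<alpha>0}"] \<alpha>0
      by (auto simp: image_image infinite_Ioo)
    fix v assume "v \<in> u ` {0<..<\<alpha>0}"
    then obtain \<alpha> where \<alpha>: "\<alpha> \<in> {0<..<\<alpha>0}" "v = u \<alpha>" by blast
    show "positive_radial_singular_solution N p lam v" "v \<sim>[at_right 0] singular_profile N p"
      using u(1,2)[OF \<alpha>(1)] \<alpha>(2) by auto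
    show "\<exists>u_inf>0. v \<sim>[at_top] (\<lambda>r. u_inf * exp (- nu_exp N lam * r))"
    proof (intro exI[of _ "2 powr (k / 2) * \<alpha>"] conjI)
      let ?c = "2 powr (k / 2) * \<alpha>"
      show c: "?c > 0" using \<alpha> by simp
      have nu: "nu_exp N lam = k / 2 + \<sigma>" by (simp add: nu_exp_def k_def \<sigma>_def)
      have "((\<lambda>r. v r * exp ((k / 2 + \<sigma>) * r) / ?c) \<longlongrightarrow> ?c / ?c) at_top"
        unfolding \<alpha>(2) by (rule tendsto_divide[OF u(3)[OF \<alpha>(1)] tendsto_const]) (use \<alpha> in auto)
      moreover have "v r * exp ((k / 2 + \<sigma>) * r) / ?c = v r / (?c * exp (- nu_exp N lam * r))" for r
        by (simp add: nu exp_minus field_simps)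
      moreover have "?c / ?c = 1" using \<alpha> by (intro divide_self) auto
      ultimately have "((\<lambda>r. v r / (?c * exp (- nu_exp N lam * r))) \<longlongrightarrow> 1) at_top"
        by (simp only:)
      thus "v \<sim>[at_top] (\<lambda>r. ?c * exp (- nu_exp N lam * r))" by (rule asymp_equivI')
    qed
  qed
qed

end
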